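(* Let $B_H=\{B_H(t)\}_{t\in\mathbb{R}}$ be an $\mathbb{R}^n$-valued operator fractional Brownian motion as described in the context, and let $D(2^j,k)=\int_{\mathbb{R}}\psi(z)B_H(2^jz+2^jk)\,dz$ be its wavelet coefficients, $j\in\mathbb{N}$, $k\in\mathbb{Z}$ (with $D(1,k)$ denoting the coefficient for $j=0$). Then: (P1) $D(2^j,k)$ is well defined in the mean-square sense, and $ED(2^j,k)=0$; (P2) for a fixed scale, $\{D(2^j,k+h)\}_{k\in\mathbb{Z}}\stackrel{\mathcal L}=\{D(2^j,k)\}_{k\in\mathbb{Z}}$ for all $h\in\mathbb{Z}$; (P3) $\{D(2^j,k)\}_{k\in\mathbb{Z}}\stackrel{\mathcal L}=\{2^{jH}D(1,k)\}_{k\in\mathbb{Z}}$; (P4) for some constant $C>0$, the wavelet spectrum $EW(2^j)=ED(2^j,k)D(2^j,k)^*$ (which does not depend on $k$) is given by $$EW(2^j)=C\int_{\mathbb{R}}\big(x_+^{-D}AA^*x_+^{-D^*}+x_-^{-D}\overline{AA^*}x_-^{-D^*}\big)\frac{|\widehat\psi(2^jx)|^2}{x^2}dx;$$ (P5) for $j\in\mathbb{N}$, $$EW(2^j)=2^{jH}EW(1)2^{jH^*}=2^{jH}\Big\{\int_{\mathbb{R}}\int_{\mathbb{R}}\psi(t)\psi(t')\,EB_H(t)B_H(t')^*\,dtdt'\Big\}2^{jH^*};$$ in particular, if $\Im(AA^* )=0$, then, with $\Sigma:=EB_H(1)B_H(1)^*$, $$EW(2^j)=-\frac12\,2^{jH}\Big\{\int_{\mathbb{R}}\int_{\mathbb{R}}\psi(t)\psi(t')\,|t-t'|^H\Sigma|t-t'|^{H^*}dtdt'\Big\}2^{jH^*};$$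 (P6) $W(2^j)\stackrel d=2^{jH}\Big(\frac1{K_j}\sum_{k=1}^{K_j}D(1,k)D(1,k)^*\Big)2^{jH^*}$; (P7) $\det EW(2^j)\neq0$ for $j\in\mathbb{N}$.
   Context: $\stackrel{\mathcal L}=$ denotes equality of finite-dimensional distributions. Matrix conventions: $^*$ is (Hermitian) transposition; $c^M=\exp(\log(c)M)$ for $c>0$; $x_\pm=\max\{\pm x,0\}$, and $x_\pm^{-D}$ is read as the zero matrix when $x_\pm=0$; $|0|^H\Sigma|0|^{H^*}=0$. Operator fractional Brownian motion (OFBM), $n\ge2$. $B_H$ is the $\mathbb{R}^n$-valued centered Gaussian process with finite-dimensional distributions those of $\int_{\mathbb{R}}\frac{e^{itx}-1}{ix}(x_+^{-D}A+x_-^{-D}\overline A)\widetilde B(dx)$, where $H\in M(n,\mathbb{R})$, $D=H-\frac12I$, $A\in M(n,\mathbb{C})$, and $\widetilde B(dx)$ is a complex Gaussian random measure with $\widetilde B(-dx)=\overline{\widetilde B(dx)}$, $E\widetilde B(dx)\widetilde B(dx)^*=dx\,I$. Assumptions: all eigenvalues $h_k$ of $H$ satisfy $0<\Re(h_k)<1$; $\Re(AA^* )$ has full rank. Such a process has stationary increments and satisfies $\{B_H(ct)\}_t\stackrel{\mathcal L}=\{c^HB_H(t)\}_t$, $c>0$. Wavelet. $\psi\in L^1(\mathbb{R})$ is real-valued with $\int\psi^2=1$, $\int t^q\psi(t)dt=0$ for $q=0,\dots,N_\psi-1$, $N_\psi\ge2$; $\mathrm{supp}(\psi)$ is a compact interval;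 $\sup_x|\widehat\psi(x)|(1+|x|)^\alpha<\infty$ for some $\alpha>1$. $\widehat\psi$ is the Fourier transform of $\psi$ (its normalization only affects the constant $C$ in (P4)). With $\nu$ (number of data points) a power of $2$ and $K_j=\nu/2^j$ (a positive integer), $W(2^j)=\frac1{K_j}\sum_{k=1}^{K_j}D(2^j,k)D(2^j,k)^*$. *)

theory Defs
  imports "HOL-Probability.Probability"
begin

section \<open>Matrices\<close>

definition vec_cnj :: "complex^'n \<Rightarrow> complex^'n" where
  "vec_cnj v = (\<chi> i. cnj (v $ i))"

definition vec_complex :: "real^'n \<Rightarrow> complex^'n" where
  "vec_complex v = (\<chi> i. complex_of_real (v $ i))"

definition mat_complex :: "real^'n^'m \<Rightarrow> complex^'n^'m" where
  "mat_complex = map_matrix complex_of_real"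

definition mat_cnj :: "complex^'n^'m \<Rightarrow> complex^'n^'m" where
  "mat_cnj = map_matrix cnj"

definition hermitian_transpose :: "complex^'n^'m \<Rightarrow> complex^'m^'n" where
  "hermitian_transpose A = transpose (mat_cnj A)"

text \<open>\<open>outer v w\<close> is $v w^T$; hence $v w^*$ is \<open>outer v w\<close> for real vectors and
  \<open>outer v (vec_cnj w)\<close> for complex ones.\<close>

definition outer :: "('a::times)^'m \<Rightarrow> 'a^'n \<Rightarrow> 'a^'n^'m" where
  "outer v w = (\<chi> i j. v $ i * w $ j)"

definition complex_eigenvalues :: "real^'n^'n \<Rightarrow> complex set" where
  "complex_eigenvalues H = {h. \<exists>v. v \<noteq> 0 \<and> mat_complex H *v v = h *s v}"

text \<open>The multiplication of the type class structure on \<open>real^'n^'n\<close> is componentwise, so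
  the library function \<open>exp\<close> is not the matrix exponential.\<close>

definition mat_exp :: "real^'n^'n \<Rightarrow> real^'n^'n" where
  "mat_exp M = (\<Sum>k. (1 / fact k) *\<^sub>R (((**) M ^^ k) (mat 1)))"

text \<open>$c^M$ for $c > 0$. The value at $c = 0$ implements both conventions: $x_\pm^{-D} = 0$ if
  $x_\pm = 0$, and $|0|^H \Sigma |0|^{H^*} = 0$.\<close>

definition mat_powr :: "real \<Rightarrow> real^'n^'n \<Rightarrow> real^'n^'n" where
  "mat_powr c M = (if c > 0 then mat_exp (ln c *\<^sub>R M) else 0)"


section \<open>Stochastic processes\<close>

text \<open>Univariate Gaussian law, point masses included.\<close>

definition gaussian_rv :: "'a measure \<Rightarrow> ('a \<Rightarrow> real) \<Rightarrow> bool" where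
  "gaussian_rv M Y \<longleftrightarrow> Y \<in> borel_measurable M \<and>
     ((\<exists>\<mu> \<sigma>. \<sigma> > 0 \<and> distributed M lborel Y (\<lambda>x. ennreal (normal_density \<mu> \<sigma> x))) \<or>
      (\<exists>\<mu>. AE \<omega> in M. Y \<omega> = \<mu>))"

text \<open>For values in \<open>complex^'n\<close> the inner product is the real one, so that all real and
  imaginary parts are jointly Gaussian.\<close>

definition gaussian_process ::
    "'a measure \<Rightarrow> 'i set \<Rightarrow> ('i \<Rightarrow> 'a \<Rightarrow> 'v::euclidean_space) \<Rightarrow> bool" where
  "gaussian_process M T X \<longleftrightarrow>
     (\<forall>t\<in>T. X t \<in> borel_measurable M) \<and>
     (\<forall>J c. finite J \<and> J \<subseteq> T \<longrightarrow> gaussian_rv M (\<lambda>\<omega>. \<Sum>t\<in>J. c t \<bullet> X t \<omega>))"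

definition fdd_eq ::
    "'a measure \<Rightarrow> ('i \<Rightarrow> 'a \<Rightarrow> 'v::topological_space) \<Rightarrow> 'b measure \<Rightarrow> ('i \<Rightarrow> 'b \<Rightarrow> 'v) \<Rightarrow> bool" where
  "fdd_eq M X N Y \<longleftrightarrow>
     (\<forall>t. X t \<in> borel_measurable M) \<and> (\<forall>t. Y t \<in> borel_measurable N) \<and>
     (\<forall>J. finite J \<longrightarrow>
        distr M (PiM J (\<lambda>_. borel)) (\<lambda>\<omega>. \<lambda>t\<in>J. X t \<omega>) =
        distr N (PiM J (\<lambda>_. borel)) (\<lambda>\<omega>. \<lambda>t\<in>J. Y t \<omega>))"

definition square_integrable_rv :: "'a measure \<Rightarrow> ('a \<Rightarrow> 'v::euclidean_space) \<Rightarrow> bool" where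
  "square_integrable_rv M X \<longleftrightarrow>
     X \<in> borel_measurable M \<and> integrable M (\<lambda>\<omega>. (norm (X \<omega>))\<^sup>2)"

definition ms_norm :: "'a measure \<Rightarrow> ('a \<Rightarrow> 'v::euclidean_space) \<Rightarrow> real" where
  "ms_norm M X = sqrt (\<integral>\<omega>. (norm (X \<omega>))\<^sup>2 \<partial>M)"

definition finite_borel_sets :: "real set set" where
  "finite_borel_sets = {E \<in> sets borel. emeasure lborel E < \<infinity>}"

text \<open>Mean-square integral over the real line: the Bochner integral of a function
  with values in $L^2(M)$, i.e. the mean-square limit \<open>Y\<close> of the integrals of simple functions
  $\sum_l 1_{E_l} Z_l$ that approximate \<open>f\<close> in $L^1(\mathbb{R}; L^2(M))$. The measurability
  clause is needed because the nonnegative integral of a non-measurable function is a lower integral.\<close>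

definition has_ms_integral ::
    "'a measure \<Rightarrow> (real \<Rightarrow> 'a \<Rightarrow> 'v::euclidean_space) \<Rightarrow> ('a \<Rightarrow> 'v) \<Rightarrow> bool" where
  "has_ms_integral M f Y \<longleftrightarrow>
     (\<forall>z. square_integrable_rv M (f z)) \<and> square_integrable_rv M Y \<and>
     (\<exists>(m :: nat \<Rightarrow> nat) (E :: nat \<Rightarrow> nat \<Rightarrow> real set) (Z :: nat \<Rightarrow> nat \<Rightarrow> 'a \<Rightarrow> 'v).
        (\<forall>i. \<forall>l<m i. E i l \<in> finite_borel_sets \<and> square_integrable_rv M (Z i l)) \<and>
        (\<forall>i. (\<lambda>z. ms_norm M (\<lambda>\<omega>. f z \<omega> - (\<Sum>l<m i. indicator (E i l) z *\<^sub>R Z i l \<omega>)))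
               \<in> borel_measurable borel) \<and>
        (\<lambda>i. \<integral>\<^sup>+ z. ennreal (ms_norm M
               (\<lambda>\<omega>. f z \<omega> - (\<Sum>l<m i. indicator (E i l) z *\<^sub>R Z i l \<omega>))) \<partial>lborel) \<longlonglongrightarrow> 0 \<and>
        (\<lambda>i. ms_norm M (\<lambda>\<omega>. Y \<omega> - (\<Sum>l<m i. measure lborel (E i l) *\<^sub>R Z i l \<omega>))) \<longlonglongrightarrow> 0)"

text \<open>Some version of the integral, which is determined up to almost sure equality.\<close>

definition ms_integral ::
    "'a measure \<Rightarrow> (real \<Rightarrow> 'a \<Rightarrow> 'v::euclidean_space) \<Rightarrow> 'a \<Rightarrow> 'v" where
  "ms_integral M f = (SOME Y. has_ms_integral M f Y)"


section \<open>Operator fractional Brownian motion\<close>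

text \<open>The measure $\widetilde B$. Almost sure additivity and mean-square countable additivity follow
  from the covariance identity, which spells out
  $E \widetilde B(dx) \widetilde B(dx)^* = dx\, I$ together with orthogonality on disjoint sets.\<close>

definition hermitian_gaussian_random_measure ::
    "'b measure \<Rightarrow> (real set \<Rightarrow> 'b \<Rightarrow> complex^'n) \<Rightarrow> bool" where
  "hermitian_gaussian_random_measure N Bt \<longleftrightarrow>
     prob_space N \<and>
     gaussian_process N finite_borel_sets Bt \<and>
     (\<forall>E\<in>finite_borel_sets. (\<integral>\<omega>. Bt E \<omega> \<partial>N) = 0) \<and>
     (\<forall>E\<in>finite_borel_sets. AE \<omega> in N. Bt (uminus ` E) \<omega> = vec_cnj (Bt E \<omega>)) \<and>
     (\<forall>E\<in>finite_borel_sets. \<forall>F\<in>finite_borel_sets.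
        (\<integral>\<omega>. outer (Bt E \<omega>) (vec_cnj (Bt F \<omega>)) \<partial>N) =
        mat (complex_of_real (measure lborel (E \<inter> F))))"

text \<open>$Y = \int f(x) \widetilde B(dx)$: the mean-square limit of $\sum_l C_l \widetilde B(E_l)$ along
  simple functions $\sum_l 1_{E_l} C_l$ converging to \<open>f\<close> in $L^2(\mathbb{R})$.\<close>

definition has_wiener_integral ::
    "'b measure \<Rightarrow> (real set \<Rightarrow> 'b \<Rightarrow> complex^'n) \<Rightarrow> (real \<Rightarrow> complex^'n^'n) \<Rightarrow>
     ('b \<Rightarrow> complex^'n) \<Rightarrow> bool" where
  "has_wiener_integral N Bt f Y \<longleftrightarrow>
     f \<in> borel_measurable borel \<and> square_integrable_rv N Y \<and>
     (\<exists>(m :: nat \<Rightarrow> nat) (E :: nat \<Rightarrow> nat \<Rightarrow> real set) (C :: nat \<Rightarrow> nat \<Rightarrow> complex^'n^'n).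
        (\<forall>i. \<forall>l<m i. E i l \<in> finite_borel_sets) \<and>
        (\<lambda>i. \<integral>\<^sup>+ x. ennreal ((norm (f x - (\<Sum>l<m i. indicator (E i l) x *\<^sub>R C i l)))\<^sup>2) \<partial>lborel)
          \<longlonglongrightarrow> 0 \<and>
        (\<lambda>i. ms_norm N (\<lambda>\<omega>. Y \<omega> - (\<Sum>l<m i. C i l *v Bt (E i l) \<omega>))) \<longlonglongrightarrow> 0)"

definition ofbm_exponent :: "real^'n^'n \<Rightarrow> real^'n^'n" where
  "ofbm_exponent H = H - (1 / 2) *\<^sub>R mat 1"

definition ofbm_kernel :: "real^'n^'n \<Rightarrow> complex^'n^'n \<Rightarrow> real \<Rightarrow> real \<Rightarrow> complex^'n^'n" where
  "ofbm_kernel H A t x =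
     mat ((cis (t * x) - 1) / (\<i> * complex_of_real x)) **
       (mat_complex (mat_powr (max x 0) (- ofbm_exponent H)) ** A +
        mat_complex (mat_powr (max (- x) 0) (- ofbm_exponent H)) ** mat_cnj A)"

text \<open>The process \<open>B\<close> on \<open>M\<close> may live on a different probability space than the random measure
  \<open>Bt\<close> on \<open>N\<close>; only its finite-dimensional distributions are tied to the latter.\<close>

definition ofbm ::
    "'a measure \<Rightarrow> (real \<Rightarrow> 'a \<Rightarrow> real^'n) \<Rightarrow> 'b measure \<Rightarrow> (real set \<Rightarrow> 'b \<Rightarrow> complex^'n) \<Rightarrow>
     real^'n^'n \<Rightarrow> complex^'n^'n \<Rightarrow> bool" where
  "ofbm M B N Bt H A \<longleftrightarrow>
     prob_space M \<and>
     hermitian_gaussian_random_measure N Bt \<and>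
     (\<forall>h\<in>complex_eigenvalues H. 0 < Re h \<and> Re h < 1) \<and>
     rank (map_matrix Re (A ** hermitian_transpose A)) = CARD('n) \<and>
     gaussian_process M UNIV B \<and>
     (\<forall>t. (\<integral>\<omega>. B t \<omega> \<partial>M) = 0) \<and>
     (\<exists>I. (\<forall>t. has_wiener_integral N Bt (ofbm_kernel H A t) (I t)) \<and>
          fdd_eq M (\<lambda>t \<omega>. vec_complex (B t \<omega>)) N I)"


section \<open>Wavelets\<close>

definition fourier :: "(real \<Rightarrow> real) \<Rightarrow> real \<Rightarrow> complex" where
  "fourier \<psi> x = (\<integral>t. complex_of_real (\<psi> t) * cis (- (x * t)) \<partial>lborel)"

definition wavelet :: "(real \<Rightarrow> real) \<Rightarrow> nat \<Rightarrow> real \<Rightarrow> bool" where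
  "wavelet \<psi> N\<^sub>\<psi> \<alpha> \<longleftrightarrow>
     integrable lborel \<psi> \<and>
     (\<integral>t. (\<psi> t)\<^sup>2 \<partial>lborel) = 1 \<and>
     N\<^sub>\<psi> \<ge> 2 \<and> (\<forall>q<N\<^sub>\<psi>. (\<integral>t. t ^ q * \<psi> t \<partial>lborel) = 0) \<and>
     (\<exists>a b. closure {t. \<psi> t \<noteq> 0} = {a..b}) \<and>
     \<alpha> > 1 \<and> bdd_above (range (\<lambda>x. cmod (fourier \<psi> x) * (1 + \<bar>x\<bar>) powr \<alpha>))"

definition wavelet_integrand ::
    "(real \<Rightarrow> real) \<Rightarrow> (real \<Rightarrow> 'a \<Rightarrow> real^'n) \<Rightarrow> nat \<Rightarrow> int \<Rightarrow> real \<Rightarrow> 'a \<Rightarrow> real^'n" where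
  "wavelet_integrand \<psi> B j k z \<omega> = \<psi> z *\<^sub>R B (2 ^ j * z + 2 ^ j * real_of_int k) \<omega>"

text \<open>\<open>wavelet_coeff M \<psi> B j k\<close> is $D(2^j, k)$.\<close>

definition wavelet_coeff ::
    "'a measure \<Rightarrow> (real \<Rightarrow> real) \<Rightarrow> (real \<Rightarrow> 'a \<Rightarrow> real^'n) \<Rightarrow> nat \<Rightarrow> int \<Rightarrow> 'a \<Rightarrow> real^'n" where
  "wavelet_coeff M \<psi> B j k = ms_integral M (wavelet_integrand \<psi> B j k)"

text \<open>$\frac1K \sum_{k=1}^{K} D(2^j,k) D(2^j,k)^*$; the sample wavelet variance $W(2^j)$ is the case
  $K = K_j$.\<close>

definition wavelet_average ::
    "(nat \<Rightarrow> int \<Rightarrow> 'a \<Rightarrow> real^'n) \<Rightarrow> nat \<Rightarrow> nat \<Rightarrow> 'a \<Rightarrow> real^'n^'n" where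
  "wavelet_average D K j \<omega> =
     (1 / real K) *\<^sub>R (\<Sum>k=1..K. outer (D j (int k) \<omega>) (D j (int k) \<omega>))"

definition wavelet_variance ::
    "(nat \<Rightarrow> int \<Rightarrow> 'a \<Rightarrow> real^'n) \<Rightarrow> nat \<Rightarrow> nat \<Rightarrow> 'a \<Rightarrow> real^'n^'n" where
  "wavelet_variance D \<nu> j = wavelet_average D (\<nu> div 2 ^ j) j"

text \<open>The integrand of the spectral representation of $E W(2^j)$.\<close>

definition wavelet_spectral_density ::
    "real^'n^'n \<Rightarrow> complex^'n^'n \<Rightarrow> (real \<Rightarrow> real) \<Rightarrow> nat \<Rightarrow> real \<Rightarrow> complex^'n^'n" where
  "wavelet_spectral_density H A \<psi> j x =
     ((cmod (fourier \<psi> (2 ^ j * x)))\<^sup>2 / x\<^sup>2) *\<^sub>R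
       (mat_complex (mat_powr (max x 0) (- ofbm_exponent H)) ** (A ** hermitian_transpose A) **
          mat_complex (mat_powr (max x 0) (- transpose (ofbm_exponent H))) +
        mat_complex (mat_powr (max (- x) 0) (- ofbm_exponent H)) **
          mat_cnj (A ** hermitian_transpose A) **
          mat_complex (mat_powr (max (- x) 0) (- transpose (ofbm_exponent H))))"

end

theory Submission
  imports Defs
begin

text \<open>The mean-square integral is also a weak integral, so the covariances of the wavelet coefficients
  are double integrals of the covariance \<open>\<Gamma>\<close> of the process against \<open>\<psi> \<otimes> \<psi>\<close>. By the isometry of
  the Wiener integral \<open>\<Gamma>\<close> has a spectral representation, from which one reads off self-similarity and
  stationarity of the increments; since \<open>\<psi>\<close> has mean zero, the latter makes the wavelet coefficients
  stationary. All coefficients lie in the closed linear span of a centered Gaussian process, so equality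
  of covariances is equality in law. Inserting the spectral representation into the double integral and
  exchanging integrals yields the wavelet spectrum, with constant 1; it is nonsingular because the Fourier
  transform of \<open>\<psi>\<close> does not vanish almost everywhere and $\Re(AA^*)$ has full rank.\<close>

section \<open>The matrix exponential\<close>

text \<open>The analytic crux is a dominating function. Both the continuity of \<Gamma>, on which
  the construction of the mean-square integrals rests, and the exchange of integrals come from the
  integrability of |S(x)|^2/(1+x^2), where S(x) = x_+^{-D} A + x_-^{-D} conj(A). No normal form of H
  is used to bound S: the existence of the Wiener integrals already makes every variance finite,
  self-similarity bounds these variances uniformly for t in [1,2], and averaging over t recovers the
  weight. This is why self-similarity is derived early, at the level of covariances, by substitution
  in the spectral integral; the random measure itself is never rescaled. The process and the random
  measure may live on different spaces, so only expectations are carried over. Equality in law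
  within the closed span goes through characteristic functions: the formula exp(-variance/2) passes
  to mean-square limits, and Levy's one-dimensional uniqueness theorem is extended to vectors one
  coordinate at a time.\<close>

lemma matrix_scaleR_left: "(c *\<^sub>R M) ** N = c *\<^sub>R (M ** N)" for M :: "real^'n^'m"
  by (simp add: matrix_matrix_mult_def vec_eq_iff sum_distrib_left ac_simps)

lemma matrix_scaleR_right: "M ** (c *\<^sub>R N) = c *\<^sub>R (M ** N)" for M :: "real^'n^'m"
  by (simp add: matrix_matrix_mult_def vec_eq_iff sum_distrib_left ac_simps)

lemma matrix_add_rdistrib: "(A + B) ** C = A ** C + B ** C" for A B :: "real^'n^'m"
  by (simp add: matrix_matrix_mult_def vec_eq_iff sum.distrib algebra_simps)

definition mpow :: "real^'n^'n \<Rightarrow> nat \<Rightarrow> real^'n^'n" where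
  "mpow M k = ((**) M ^^ k) (mat 1)"

lemma mpow_0 [simp]: "mpow M 0 = mat 1"
  and mpow_Suc: "mpow M (Suc k) = M ** mpow M k"
  by (simp_all add: mpow_def)

lemma mpow_scaleR:
  fixes M :: "real^'n^'n"
  shows "mpow (c *\<^sub>R M) k = c ^ k *\<^sub>R mpow M k"
  by (induction k) (simp_all add: mpow_Suc matrix_scaleR_left matrix_scaleR_right)

lemma mpow_commute:
  fixes M N :: "real^'n^'n"
  assumes "M ** N = N ** M"
  shows "mpow M k ** N = N ** mpow M k"
proof (induction k)
  case (Suc k)
  then show ?case
    by (metis assms mpow_Suc matrix_mul_assoc)
qed simp

lemma mpow_transpose:
  fixes M :: "real^'n^'n"
  shows "mpow (transpose M) k = transpose (mpow M k)"
proof (induction k)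
  case (Suc k)
  have "transpose (M ** mpow M k) = transpose (mpow M k ** M)"
    by (simp add: mpow_commute)
  then show ?case
    using Suc by (simp add: mpow_Suc matrix_transpose_mul)
qed (simp add: transpose_mat)

text \<open>The operator norm is submultiplicative and dominates every entry, so the entries of the
  exponential series are majorised by the scalar series of exp at the operator norm of
  \<open>M\<close>.\<close>

lemma mpow_component_le:
  fixes M :: "real^'n^'n"
  shows "\<bar>mpow M k $ i $ j\<bar> \<le> onorm ((*v) M) ^ k"
proof -
  have "onorm ((*v) (mpow M k)) \<le> onorm ((*v) M) ^ k"
  proof (induction k)
    case 0
    show ?case by (simp add: onorm_id_le)
  next
    case (Suc k)
    have "onorm ((*v) (M ** mpow M k))
        \<le> onorm ((*v) M) * onorm ((*v) (mpow M k))"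
      using onorm_compose[of "(*v) M" "(*v) (mpow M k)"]
      by (simp add: o_def matrix_vector_mul_assoc)
    also have "\<dots> \<le> onorm ((*v) M) * onorm ((*v) M) ^ k"
      by (intro mult_left_mono Suc onorm_pos_le matrix_vector_mul_bounded_linear)
    finally show ?case by (simp add: mpow_Suc)
  qed
  then show ?thesis
    using matrix_component_le_onorm[of "mpow M k" i j] by linarith
qed

lemma mat_exp_series_component:
  fixes M :: "real^'n^'n"
  shows "summable (\<lambda>k. \<bar>mpow M k $ i $ j / fact k\<bar>)"
proof (rule summable_comparison_test')
  show "summable (\<lambda>k. onorm ((*v) M) ^ k / fact k)"
    using summable_exp by (simp add: divide_inverse_commute)
  show "norm \<bar>mpow M k $ i $ j / fact k\<bar> \<le> onorm ((*v) M) ^ k / fact k" for k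
    using mpow_component_le[of M k i j] by (simp add: divide_simps)
qed

text \<open>Reduces the matrix series to scalar ones. The basic facts about \<open>mat_exp\<close>
  (bound, addition, transposition, measurability) are then proved entry by entry, where absolute
  convergence and Cauchy products are available.\<close>

lemma mat_exp_nth:
  fixes M :: "real^'n^'n"
  shows "mat_exp M $ i $ j = (\<Sum>k. mpow M k $ i $ j / fact k)"
    and "(\<lambda>k. mpow M k $ i $ j / fact k) sums (mat_exp M $ i $ j)"
proof -
  let ?L = "\<chi> i j. \<Sum>k. mpow M k $ i $ j / fact k"
  have s: "summable (\<lambda>k. mpow M k $ i $ j / fact k)" for i j
    using mat_exp_series_component[of M i j] by (rule summable_rabs_cancel)
  have "(\<lambda>n. \<Sum>k<n. (1 / fact k) *\<^sub>R mpow M k) \<longlonglongrightarrow> ?L"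
    by (intro vec_tendstoI) (use s in \<open>simp add: summable_LIMSEQ\<close>)
  then have e: "mat_exp M = ?L"
    unfolding mat_exp_def mpow_def[symmetric] by (intro sums_unique[symmetric]) (simp add: sums_def)
  show 1: "mat_exp M $ i $ j = (\<Sum>k. mpow M k $ i $ j / fact k)"
    by (simp add: e)
  show "(\<lambda>k. mpow M k $ i $ j / fact k) sums (mat_exp M $ i $ j)"
    unfolding 1 using s by (rule summable_sums)
qed

lemma mat_exp_component_le:
  fixes M :: "real^'n^'n"
  shows "\<bar>mat_exp M $ i $ j\<bar> \<le> exp (onorm ((*v) M))"
proof -
  have "\<bar>mat_exp M $ i $ j\<bar> \<le> (\<Sum>k. \<bar>mpow M k $ i $ j / fact k\<bar>)"
    unfolding mat_exp_nth by (intro summable_rabs mat_exp_series_component)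
  also have "\<dots> \<le> (\<Sum>k. onorm ((*v) M) ^ k / fact k)"
  proof (rule suminf_le[OF _ mat_exp_series_component])
    show "summable (\<lambda>k. onorm ((*v) M) ^ k / fact k)"
      using summable_exp[of "onorm ((*v) M)"] by (simp add: divide_inverse_commute)
  qed (use mpow_component_le[of M _ i j] in \<open>simp add: divide_right_mono\<close>)
  finally show ?thesis by (simp add: exp_def divide_inverse_commute)
qed

text \<open>The binomial theorem divided by n!: the coefficients 1/(i! (n-i)!) are those of the
  Cauchy product of two exponential series.\<close>

lemma mpow_add_commuting:
  fixes M N :: "real^'n^'n"
  assumes MN: "M ** N = N ** M"
  shows "(1 / fact n) *\<^sub>R mpow (M + N) n =
    (\<Sum>i\<le>n. (1 / (fact i * fact (n - i))) *\<^sub>R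
       (mpow M i ** mpow N (n - i)))"
proof (induction n)
  case (Suc n)
  let ?M = "\<lambda>i. mpow M i" and ?N = "\<lambda>i. mpow N i"
  let ?T = "\<lambda>i k. (1 / (fact i * fact k)) *\<^sub>R (?M i ** ?N k)"
  \<comment> \<open>With the factorials built into \<open>?T\<close>, multiplication by M or N
    raises one index and releases the new index as a factor. After the shift both sums run over i up
    to Suc n with weights i and Suc n - i, which add up to Suc n.\<close>
  have M: "M ** ?T i k = real (Suc i) *\<^sub>R ?T (Suc i) k" for i k
    by (simp add: matrix_scaleR_right matrix_mul_assoc field_simps mpow_Suc del: of_nat_Suc)
  have N: "N ** ?T i k = real (Suc k) *\<^sub>R ?T i (Suc k)" for i k
  proof -
    have "N ** (?M i ** ?N k) = ?M i ** ?N (Suc k)"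
      using mpow_commute[OF MN, of i] by (simp add: mpow_Suc matrix_mul_assoc)
    then show ?thesis
      by (simp add: matrix_scaleR_right field_simps del: of_nat_Suc)
  qed
  have distr: "X ** (\<Sum>i\<le>n. f i) = (\<Sum>i\<le>n. X ** f i)" for X :: "real^'n^'n" and f
    by (induction n) (simp_all add: matrix_add_ldistrib)
  have "real (Suc n) *\<^sub>R ((1 / fact (Suc n)) *\<^sub>R mpow (M + N) (Suc n))
      = (M + N) ** ((1 / fact n) *\<^sub>R mpow (M + N) n)"
    by (simp add: mpow_Suc matrix_scaleR_right field_simps del: of_nat_Suc)
  also have "\<dots> = (\<Sum>i\<le>n. real (Suc i) *\<^sub>R ?T (Suc i) (n - i))
      + (\<Sum>i\<le>n. real (Suc (n - i)) *\<^sub>R ?T i (Suc (n - i)))"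
    unfolding Suc.IH matrix_add_rdistrib distr M N by (simp only: sum.distrib)
  also have "(\<Sum>i\<le>n. real (Suc i) *\<^sub>R ?T (Suc i) (n - i))
      = (\<Sum>i\<le>Suc n. real i *\<^sub>R ?T i (Suc n - i))"
    by (subst sum.atMost_Suc_shift) simp
  also have "(\<Sum>i\<le>n. real (Suc (n - i)) *\<^sub>R ?T i (Suc (n - i)))
      = (\<Sum>i\<le>Suc n. real (Suc n - i) *\<^sub>R ?T i (Suc n - i))"
    unfolding sum.atMost_Suc diff_self_eq_0 of_nat_0 scaleR_zero_left add_0_right
    by (intro sum.cong refl) (simp only: Suc_diff_le atMost_iff)
  also have "(\<Sum>i\<le>Suc n. real i *\<^sub>R ?T i (Suc n - i))
      + (\<Sum>i\<le>Suc n. real (Suc n - i) *\<^sub>R ?T i (Suc n - i))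
      = real (Suc n) *\<^sub>R (\<Sum>i\<le>Suc n. ?T i (Suc n - i))"
    unfolding sum.distrib[symmetric] scaleR_sum_right scaleR_add_left[symmetric]
    by (intro sum.cong refl) (simp flip: of_nat_add del: of_nat_Suc)
  finally show ?case
    unfolding scaleR_cancel_left by (simp only: of_nat_eq_0_iff nat.simps simp_thms)
qed simp

text \<open>For each inner index l of the matrix product the two scalar series are multiplied as a
  Cauchy product; summing over l turns the coefficients into those of
  \<open>mpow_add_commuting\<close>.\<close>

lemma mat_exp_add:
  fixes M N :: "real^'n^'n"
  assumes "M ** N = N ** M"
  shows "mat_exp (M + N) = mat_exp M ** mat_exp N"
proof -
  have "mat_exp (M + N) $ i $ j = (mat_exp M ** mat_exp N) $ i $ j" for i j
  proof -
    let ?a = "\<lambda>l k. mpow M k $ i $ l / fact k"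
    let ?b = "\<lambda>l k. mpow N k $ l $ j / fact k"
    have "(\<lambda>k. \<Sum>m\<le>k. ?a l m * ?b l (k - m)) sums (mat_exp M $ i $ l * mat_exp N $ l $ j)" for l
      unfolding mat_exp_nth using mat_exp_series_component
      by (intro Cauchy_product_sums) (simp_all only: real_norm_def)
    then have "(\<lambda>k. \<Sum>l\<in>UNIV. \<Sum>m\<le>k. ?a l m * ?b l (k - m))
        sums (\<Sum>l\<in>UNIV. mat_exp M $ i $ l * mat_exp N $ l $ j)"
      by (intro sums_sum)
    moreover have "(\<Sum>l\<in>UNIV. \<Sum>m\<le>k. ?a l m * ?b l (k - m))
        = mpow (M + N) k $ i $ j / fact k" for k
    proof -
      have "mpow (M + N) k $ i $ j / fact k
          = ((1 / fact k) *\<^sub>R mpow (M + N) k) $ i $ j"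
        by simp
      also have "\<dots> = (\<Sum>m\<le>k. \<Sum>l\<in>UNIV. ?a l m * ?b l (k - m))"
        unfolding mpow_add_commuting[OF assms]
        by (simp add: matrix_matrix_mult_def sum_distrib_left field_simps sum_divide_distrib)
      finally show ?thesis
        by (subst (asm) sum.swap) simp
    qed
    ultimately show ?thesis
      unfolding mat_exp_nth(1)[of "M + N"] by (simp add: sums_iff matrix_matrix_mult_def)
  qed
  then show ?thesis
    by (simp add: vec_eq_iff)
qed

lemma mat_exp_transpose:
  fixes M :: "real^'n^'n"
  shows "mat_exp (transpose M) = transpose (mat_exp M)"
  unfolding vec_eq_iff mat_exp_nth(1) mpow_transpose by (simp add: transpose_def mat_exp_nth(1))

lemma mat_exp_scalar: "mat_exp (a *\<^sub>R mat 1 :: real^'n^'n) = exp a *\<^sub>R mat 1"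
proof -
  have 1: "mpow (mat 1 :: real^'n^'n) k = mat 1" for k
    by (induction k) (simp_all add: mpow_Suc)
  have "mat_exp (a *\<^sub>R mat 1 :: real^'n^'n) $ i $ j = (exp a *\<^sub>R mat 1 :: real^'n^'n) $ i $ j" for i j
    unfolding mat_exp_nth mpow_scaleR 1
    by (cases "i = j") (simp_all add: mat_def exp_def divide_inverse_commute)
  then show ?thesis
    by (simp add: vec_eq_iff)
qed

section \<open>Real powers of a matrix\<close>

lemma mat_powr_mult:
  assumes "c > 0" "d > 0"
  shows "mat_powr (c * d) M = mat_powr c M ** mat_powr d M"
  using assms by (simp add: mat_powr_def ln_mult scaleR_add_left mat_exp_add
      matrix_scaleR_left matrix_scaleR_right ac_simps)

lemma mat_powr_transpose: "mat_powr c (transpose M) = transpose (mat_powr c M)"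
proof -
  have "mat_exp (a *\<^sub>R transpose M) = transpose (mat_exp (a *\<^sub>R M))" for a
    by (metis mat_exp_transpose transpose_scalar)
  then show ?thesis
    by (simp add: mat_powr_def transpose_def vec_eq_iff)
qed

lemma mat_powr_one: "mat_powr 1 M = mat 1"
  using mat_exp_scalar[of 0] by (simp add: mat_powr_def)

lemma mat_powr_inverse:
  assumes "c > 0"
  shows "mat_powr c M ** mat_powr (inverse c) M = mat 1"
  using assms by (simp add: mat_powr_one flip: mat_powr_mult)

text \<open>Translates the exponent -D of the kernel into the exponent H of self-similarity:
  (1/c)^{-D} = c^D, and D differs from H by the scalar matrix I/2, which commutes with everything
  and contributes the factor c^{-1/2}.\<close>

lemma mat_powr_ofbm_exponent:
  assumes "c > 0"
  shows "sqrt c *\<^sub>R mat_powr (inverse c) (- ofbm_exponent H) = mat_powr c H"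
proof -
  have "ln c *\<^sub>R H = (ln c / 2) *\<^sub>R mat 1 + ln (inverse c) *\<^sub>R (- ofbm_exponent H)"
    using assms by (simp add: ofbm_exponent_def ln_inverse algebra_simps)
  then have "mat_exp (ln c *\<^sub>R H) = exp (ln c / 2) *\<^sub>R mat_exp (ln (inverse c) *\<^sub>R (- ofbm_exponent H))"
    using mat_exp_add[of "(ln c / 2) *\<^sub>R mat 1" "ln (inverse c) *\<^sub>R (- ofbm_exponent H)"]
    unfolding mat_exp_scalar matrix_scaleR_left[of "ln c / 2"] matrix_scaleR_left[of "exp x" for x]
      matrix_scaleR_right[of _ "ln c / 2"] matrix_mul_lid matrix_mul_rid by simp
  moreover have "exp (ln c / 2) = sqrt c"
    using assms powr_half_sqrt[of c] by (simp add: powr_def)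
  ultimately show ?thesis
    using assms by (simp add: mat_powr_def)
qed

text \<open>For fixed M each entry is a pointwise convergent power series in ln c, so measurability
  follows without continuity of \<open>mat_exp\<close>.\<close>

lemma mat_powr_measurable [measurable]: "(\<lambda>c. mat_powr c M) \<in> borel_measurable borel"
proof -
  have [measurable]: "(\<lambda>c. mat_exp (ln c *\<^sub>R M) $ i $ j) \<in> borel_measurable borel" for i j
    unfolding mat_exp_nth mpow_scaleR by simp
  have "(\<lambda>c. mat_exp (ln c *\<^sub>R M)) \<in> borel_measurable borel"
    by (subst borel_measurable_euclidean_space)
      (auto simp: Basis_vec_def inner_axis)
  then show ?thesis
    unfolding mat_powr_def by measurable
qed


section \<open>Square-integrable random variables\<close>

text \<open>Valid for every \<open>f\<close>: a non-integrable function has integral 0, and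
  \<open>g\<close> is nonnegative because it dominates a norm. This saves measurability proofs in
  the estimates below.\<close>

lemma norm_integral_le:
  fixes f :: "'a \<Rightarrow> 'v::{banach,second_countable_topology}"
  assumes "integrable M g" "\<And>x. norm (f x) \<le> g x"
  shows "norm (\<integral>x. f x \<partial>M) \<le> (\<integral>x. g x \<partial>M)"
proof -
  have "norm (\<integral>x. f x \<partial>M) \<le> (\<integral>x. norm (f x) \<partial>M)"
    by (rule integral_norm_bound)
  also have "\<dots> \<le> (\<integral>x. g x \<partial>M)"
    using assms by (intro integral_mono_AE') (auto intro: order_trans[OF norm_ge_zero])
  finally show ?thesis .
qed

lemma square_integrable_rvD:
  assumes "square_integrable_rv M X"
  shows "X \<in> borel_measurable M" "integrable M (\<lambda>\<omega>. (norm (X \<omega>))\<^sup>2)"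
  using assms by (auto simp: square_integrable_rv_def)

lemma ms_norm_nonneg [simp]: "0 \<le> ms_norm M X"
  by (simp add: ms_norm_def)

lemma ms_norm_square: "(ms_norm M X)\<^sup>2 = (\<integral>\<omega>. (norm (X \<omega>))\<^sup>2 \<partial>M)"
  by (simp add: ms_norm_def)

lemma ms_norm_minus_commute: "ms_norm M (\<lambda>\<omega>. X \<omega> - Y \<omega>) = ms_norm M (\<lambda>\<omega>. Y \<omega> - X \<omega>)"
  by (simp add: ms_norm_def norm_minus_commute)

lemma square_integrable_rv_add:
  assumes X: "square_integrable_rv M X" and Y: "square_integrable_rv M Y"
  shows "square_integrable_rv M (\<lambda>\<omega>. X \<omega> + Y \<omega>)"
proof -
  note [measurable] = square_integrable_rvD(1)[OF X] square_integrable_rvD(1)[OF Y]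
  have "integrable M (\<lambda>\<omega>. (norm (X \<omega> + Y \<omega>))\<^sup>2)"
  proof (rule Bochner_Integration.integrable_bound)
    show "integrable M (\<lambda>\<omega>. 2 * (norm (X \<omega>))\<^sup>2 + 2 * (norm (Y \<omega>))\<^sup>2)"
      using X Y by (intro Bochner_Integration.integrable_add integrable_mult_right)
          (auto simp: square_integrable_rv_def)
    show "AE \<omega> in M. norm ((norm (X \<omega> + Y \<omega>))\<^sup>2) \<le> norm (2 * (norm (X \<omega>))\<^sup>2 + 2 * (norm (Y \<omega>))\<^sup>2)"
    proof (rule AE_I2)
      fix \<omega>
      have "(norm (X \<omega> + Y \<omega>))\<^sup>2 \<le> (norm (X \<omega>) + norm (Y \<omega>))\<^sup>2"
        by (intro power_mono norm_triangle_ineq) auto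
      also have "\<dots> \<le> 2 * (norm (X \<omega>))\<^sup>2 + 2 * (norm (Y \<omega>))\<^sup>2"
        using sum_squares_bound[of "norm (X \<omega>)" "norm (Y \<omega>)"] by (simp add: power2_sum)
      finally show "norm ((norm (X \<omega> + Y \<omega>))\<^sup>2) \<le> norm (2 * (norm (X \<omega>))\<^sup>2 + 2 * (norm (Y \<omega>))\<^sup>2)"
        by simp
    qed
  qed simp
  then show ?thesis
    by (simp add: square_integrable_rv_def)
qed

lemma square_integrable_rv_linear:
  assumes "bounded_linear T" and X: "square_integrable_rv M X"
  shows "square_integrable_rv M (\<lambda>\<omega>. T (X \<omega>))"
proof -
  interpret T: bounded_linear T by fact
  obtain K where K: "\<And>x. norm (T x) \<le> norm x * K" and "K \<ge> 0"
    using T.nonneg_bounded by blast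
  have [measurable]: "(\<lambda>\<omega>. T (X \<omega>)) \<in> borel_measurable M"
    using square_integrable_rvD(1)[OF X]
    by (rule borel_measurable_continuous_on[OF linear_continuous_on[OF assms(1)]])
  have "integrable M (\<lambda>\<omega>. (norm (T (X \<omega>)))\<^sup>2)"
  proof (rule Bochner_Integration.integrable_bound)
    show "integrable M (\<lambda>\<omega>. K\<^sup>2 * (norm (X \<omega>))\<^sup>2)"
      using X by (intro integrable_mult_right) (auto simp: square_integrable_rv_def)
    show "AE \<omega> in M. norm ((norm (T (X \<omega>)))\<^sup>2) \<le> norm (K\<^sup>2 * (norm (X \<omega>))\<^sup>2)"
    proof (rule AE_I2)
      fix \<omega> show "norm ((norm (T (X \<omega>)))\<^sup>2) \<le> norm (K\<^sup>2 * (norm (X \<omega>))\<^sup>2)"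
        using power_mono[OF K[of "X \<omega>"], of 2] by (simp add: power_mult_distrib ac_simps)
    qed
  qed simp
  then show ?thesis
    by (simp add: square_integrable_rv_def)
qed

lemma square_integrable_rv_zero [simp]: "square_integrable_rv M (\<lambda>\<omega>. 0)"
  by (simp add: square_integrable_rv_def)

lemma square_integrable_rv_scaleR:
  "square_integrable_rv M X \<Longrightarrow> square_integrable_rv M (\<lambda>\<omega>. c *\<^sub>R X \<omega>)"
  by (rule square_integrable_rv_linear) (simp add: bounded_linear_scaleR_right)

lemma square_integrable_rv_diff:
  assumes "square_integrable_rv M X" "square_integrable_rv M Y"
  shows "square_integrable_rv M (\<lambda>\<omega>. X \<omega> - Y \<omega>)"
  using square_integrable_rv_add[OF assms(1) square_integrable_rv_scaleR[OF assms(2), of "-1"]] by simp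

lemma square_integrable_rv_sum:
  "(\<And>i. i \<in> I \<Longrightarrow> square_integrable_rv M (X i)) \<Longrightarrow> square_integrable_rv M (\<lambda>\<omega>. \<Sum>i\<in>I. X i \<omega>)"
  by (induction I rule: infinite_finite_induct) (auto intro: square_integrable_rv_add)

lemma integral_norm_mult_le:
  assumes X: "square_integrable_rv M X" and Y: "square_integrable_rv M Y"
  shows "integrable M (\<lambda>\<omega>. norm (X \<omega>) * norm (Y \<omega>))"
    and "(\<integral>\<omega>. norm (X \<omega>) * norm (Y \<omega>) \<partial>M) \<le> ms_norm M X * ms_norm M Y"
proof -
  note [measurable] = square_integrable_rvD(1)[OF X] square_integrable_rvD(1)[OF Y]
  note i = square_integrable_rvD(2)[OF X] square_integrable_rvD(2)[OF Y]
  show *: "integrable M (\<lambda>\<omega>. norm (X \<omega>) * norm (Y \<omega>))"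
  proof (rule Bochner_Integration.integrable_bound)
    show "integrable M (\<lambda>\<omega>. (norm (X \<omega>))\<^sup>2 + (norm (Y \<omega>))\<^sup>2)"
      using i by (rule Bochner_Integration.integrable_add)
    show "AE \<omega> in M. norm (norm (X \<omega>) * norm (Y \<omega>)) \<le> norm ((norm (X \<omega>))\<^sup>2 + (norm (Y \<omega>))\<^sup>2)"
    proof (rule AE_I2)
      fix \<omega>
      have "2 * (norm (X \<omega>) * norm (Y \<omega>)) \<le> (norm (X \<omega>))\<^sup>2 + (norm (Y \<omega>))\<^sup>2"
        using sum_squares_bound[of "norm (X \<omega>)" "norm (Y \<omega>)"] by simp
      moreover have "0 \<le> norm (X \<omega>) * norm (Y \<omega>)" by simp
      ultimately have "norm (X \<omega>) * norm (Y \<omega>) \<le> (norm (X \<omega>))\<^sup>2 + (norm (Y \<omega>))\<^sup>2"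
        by linarith
      then show "norm (norm (X \<omega>) * norm (Y \<omega>)) \<le> norm ((norm (X \<omega>))\<^sup>2 + (norm (Y \<omega>))\<^sup>2)"
        by simp
    qed
  qed simp
  let ?I = "\<integral>\<omega>. norm (X \<omega>) * norm (Y \<omega>) \<partial>M"
  have "ennreal (?I\<^sup>2) = (\<integral>\<^sup>+\<omega>. ennreal (norm (X \<omega>)) * ennreal (norm (Y \<omega>)) \<partial>M)\<^sup>2"
    using nn_integral_eq_integral[OF *] by (simp add: ennreal_mult ennreal_power integral_nonneg_AE)
  also have "\<dots> \<le> (\<integral>\<^sup>+\<omega>. (ennreal (norm (X \<omega>)))\<^sup>2 \<partial>M) * (\<integral>\<^sup>+\<omega>. (ennreal (norm (Y \<omega>)))\<^sup>2 \<partial>M)"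
    by (rule Cauchy_Schwarz_nn_integral) auto
  also have "\<dots> = ennreal ((ms_norm M X * ms_norm M Y)\<^sup>2)"
    using nn_integral_eq_integral[OF i(1)] nn_integral_eq_integral[OF i(2)]
    by (simp add: ennreal_power power_mult_distrib ms_norm_square ennreal_mult integral_nonneg_AE)
  finally have "?I\<^sup>2 \<le> (ms_norm M X * ms_norm M Y)\<^sup>2"
    by (subst (asm) ennreal_le_iff) auto
  then show "?I \<le> ms_norm M X * ms_norm M Y"
    by (rule power2_le_imp_le) simp
qed

lemma ms_norm_triangle:
  assumes X: "square_integrable_rv M X" and Y: "square_integrable_rv M Y"
  shows "ms_norm M (\<lambda>\<omega>. X \<omega> + Y \<omega>) \<le> ms_norm M X + ms_norm M Y"
proof (rule power2_le_imp_le)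
  note i = square_integrable_rvD(2)[OF X] square_integrable_rvD(2)[OF Y]
  note XY = integral_norm_mult_le[OF X Y]
  have "(ms_norm M (\<lambda>\<omega>. X \<omega> + Y \<omega>))\<^sup>2
      \<le> (\<integral>\<omega>. (norm (X \<omega>))\<^sup>2 + (norm (Y \<omega>))\<^sup>2 + 2 * (norm (X \<omega>) * norm (Y \<omega>)) \<partial>M)"
    unfolding ms_norm_square
  proof (rule integral_mono)
    show "integrable M (\<lambda>\<omega>. (norm (X \<omega> + Y \<omega>))\<^sup>2)"
      using square_integrable_rv_add[OF X Y] by (simp add: square_integrable_rv_def)
    show "integrable M (\<lambda>\<omega>. (norm (X \<omega>))\<^sup>2 + (norm (Y \<omega>))\<^sup>2 + 2 * (norm (X \<omega>) * norm (Y \<omega>)))"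
      using i XY(1) by (intro Bochner_Integration.integrable_add integrable_mult_right) auto
    fix \<omega>
    have "(norm (X \<omega> + Y \<omega>))\<^sup>2 \<le> (norm (X \<omega>) + norm (Y \<omega>))\<^sup>2"
      by (intro power_mono norm_triangle_ineq) auto
    then show "(norm (X \<omega> + Y \<omega>))\<^sup>2 \<le> (norm (X \<omega>))\<^sup>2 + (norm (Y \<omega>))\<^sup>2 + 2 * (norm (X \<omega>) * norm (Y \<omega>))"
      by (simp add: power2_sum)
  qed
  also have "\<dots> = (ms_norm M X)\<^sup>2 + (ms_norm M Y)\<^sup>2 + 2 * (\<integral>\<omega>. norm (X \<omega>) * norm (Y \<omega>) \<partial>M)"
    using i XY(1) by (simp add: ms_norm_square)
  also have "\<dots> \<le> (ms_norm M X + ms_norm M Y)\<^sup>2"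
    using XY(2) by (simp add: power2_sum)
  finally show "(ms_norm M (\<lambda>\<omega>. X \<omega> + Y \<omega>))\<^sup>2 \<le> (ms_norm M X + ms_norm M Y)\<^sup>2" .
qed simp

lemma ms_norm_triangle_diff:
  assumes "square_integrable_rv M X" "square_integrable_rv M Y" "square_integrable_rv M Z"
  shows "ms_norm M (\<lambda>\<omega>. X \<omega> - Z \<omega>) \<le> ms_norm M (\<lambda>\<omega>. X \<omega> - Y \<omega>) + ms_norm M (\<lambda>\<omega>. Y \<omega> - Z \<omega>)"
  using ms_norm_triangle[of M "\<lambda>\<omega>. X \<omega> - Y \<omega>" "\<lambda>\<omega>. Y \<omega> - Z \<omega>"] assms
  by (simp add: square_integrable_rv_diff)

lemma ms_norm_scaleR: "ms_norm M (\<lambda>\<omega>. c *\<^sub>R X \<omega>) = \<bar>c\<bar> * ms_norm M X"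
  by (simp add: ms_norm_def power_mult_distrib real_sqrt_mult)

lemma ms_norm_eq_0_iff:
  assumes "square_integrable_rv M X"
  shows "ms_norm M X = 0 \<longleftrightarrow> (AE \<omega> in M. X \<omega> = 0)"
  using integral_nonneg_eq_0_iff_AE[OF square_integrable_rvD(2)[OF assms]] by (simp add: ms_norm_def)

section \<open>Continuity of bilinear pairings under mean-square convergence\<close>

context
  fixes prod :: "'v::euclidean_space \<Rightarrow> 'w::euclidean_space \<Rightarrow> 'u::euclidean_space"
  assumes prod: "bounded_bilinear prod"
begin

lemma bilinear_integrable:
  assumes X: "square_integrable_rv M X" and Y: "square_integrable_rv M Y"
  shows "integrable M (\<lambda>\<omega>. prod (X \<omega>) (Y \<omega>))"
proof -
  note [measurable] = square_integrable_rvD(1)[OF X] square_integrable_rvD(1)[OF Y]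
  obtain K where K: "\<And>x y. norm (prod x y) \<le> norm x * norm y * K" "K \<ge> 0"
    using bounded_bilinear.nonneg_bounded[OF prod] by blast
  have "(\<lambda>\<omega>. prod (X \<omega>) (Y \<omega>)) \<in> borel_measurable M"
    by (rule borel_measurable_continuous_Pair)
      (auto intro!: bounded_bilinear.continuous_on[OF prod] continuous_intros)
  moreover have "integrable M (\<lambda>\<omega>. norm (X \<omega>) * norm (Y \<omega>) * K)"
    using integral_norm_mult_le(1)[OF X Y] by (rule integrable_mult_left)
  moreover have "norm (prod (X \<omega>) (Y \<omega>)) \<le> norm (norm (X \<omega>) * norm (Y \<omega>) * K)" for \<omega>
    using K(1)[of "X \<omega>" "Y \<omega>"] K(2) by (simp add: abs_mult)
  ultimately show ?thesis
    by (blast intro: Bochner_Integration.integrable_bound)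
qed

lemma bilinear_integral_bound:
  obtains K where "K \<ge> 0"
    "\<And>M X Y. square_integrable_rv M X \<Longrightarrow> square_integrable_rv M Y \<Longrightarrow>
      norm (\<integral>\<omega>. prod (X \<omega>) (Y \<omega>) \<partial>M) \<le> K * (ms_norm M X * ms_norm M Y)"
proof -
  obtain K where K: "\<And>x y. norm (prod x y) \<le> norm x * norm y * K" "K \<ge> 0"
    using bounded_bilinear.nonneg_bounded[OF prod] by blast
  have "norm (\<integral>\<omega>. prod (X \<omega>) (Y \<omega>) \<partial>M) \<le> K * (ms_norm M X * ms_norm M Y)"
    if XY: "square_integrable_rv M X" "square_integrable_rv M Y" for M :: "'a measure" and X Y
  proof -
    have "norm (prod (X \<omega>) (Y \<omega>)) \<le> K * (norm (X \<omega>) * norm (Y \<omega>))" for \<omega>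
      using K(1)[of "X \<omega>" "Y \<omega>"] by (simp only: ac_simps)
    then have "norm (\<integral>\<omega>. prod (X \<omega>) (Y \<omega>) \<partial>M) \<le> (\<integral>\<omega>. K * (norm (X \<omega>) * norm (Y \<omega>)) \<partial>M)"
      using integral_norm_mult_le(1)[OF XY] by (intro norm_integral_le integrable_mult_right)
    also have "\<dots> \<le> K * (ms_norm M X * ms_norm M Y)"
      using integral_norm_mult_le(2)[OF XY] K(2) by (simp add: mult_left_mono)
    finally show ?thesis .
  qed
  with K(2) show ?thesis
    using that by blast
qed

text \<open>One argument for three pairings: the real inner product for weak integrals, v w^* for
  covariances of complex vectors, and C D^* for matrix functions on \<open>lborel\<close>.\<close>

lemma bilinear_integral_tendsto:
  assumes X: "\<And>n. square_integrable_rv M (X n)" "square_integrable_rv M X'"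
    and Y: "\<And>n. square_integrable_rv M (Y n)" "square_integrable_rv M Y'"
    and lim: "(\<lambda>n. ms_norm M (\<lambda>\<omega>. X' \<omega> - X n \<omega>)) \<longlonglongrightarrow> 0" "(\<lambda>n. ms_norm M (\<lambda>\<omega>. Y' \<omega> - Y n \<omega>)) \<longlonglongrightarrow> 0"
  shows "(\<lambda>n. \<integral>\<omega>. prod (X n \<omega>) (Y n \<omega>) \<partial>M) \<longlonglongrightarrow> (\<integral>\<omega>. prod (X' \<omega>) (Y' \<omega>) \<partial>M)"
proof -
  obtain K where K: "K \<ge> 0"
    "\<And>X Y. square_integrable_rv M X \<Longrightarrow> square_integrable_rv M Y \<Longrightarrow>
      norm (\<integral>\<omega>. prod (X \<omega>) (Y \<omega>) \<partial>M) \<le> K * (ms_norm M X * ms_norm M Y)"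
    using bilinear_integral_bound[where 'a = 'a] by metis
  let ?dX = "\<lambda>n. ms_norm M (\<lambda>\<omega>. X' \<omega> - X n \<omega>)" and ?dY = "\<lambda>n. ms_norm M (\<lambda>\<omega>. Y' \<omega> - Y n \<omega>)"
  have "(\<lambda>n. K * (?dX n * ms_norm M Y' + (ms_norm M X' + ?dX n) * ?dY n))
      \<longlonglongrightarrow> K * (0 * ms_norm M Y' + (ms_norm M X' + 0) * 0)"
    by (intro tendsto_intros lim)
  then have lim0: "(\<lambda>n. K * (?dX n * ms_norm M Y' + (ms_norm M X' + ?dX n) * ?dY n)) \<longlonglongrightarrow> 0"
    by simp
  have "norm ((\<integral>\<omega>. prod (X n \<omega>) (Y n \<omega>) \<partial>M) - (\<integral>\<omega>. prod (X' \<omega>) (Y' \<omega>) \<partial>M))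
      \<le> K * (?dX n * ms_norm M Y' + (ms_norm M X' + ?dX n) * ?dY n)" for n
  proof -
    note d = square_integrable_rv_diff[OF X(2) X(1)[of n]] square_integrable_rv_diff[OF Y(2) Y(1)[of n]]
    \<comment> \<open>The difference of products is telescoped. The second term carries
      \<open>X n\<close>, whose norm is bounded by that of the limit plus the error.\<close>
    have e: "prod (X' \<omega>) (Y' \<omega>) - prod (X n \<omega>) (Y n \<omega>)
        = prod (X' \<omega> - X n \<omega>) (Y' \<omega>) + prod (X n \<omega>) (Y' \<omega> - Y n \<omega>)" for \<omega>
      by (simp add: bounded_bilinear.diff_left[OF prod] bounded_bilinear.diff_right[OF prod])
    have split: "(\<integral>\<omega>. prod (X' \<omega>) (Y' \<omega>) \<partial>M) - (\<integral>\<omega>. prod (X n \<omega>) (Y n \<omega>) \<partial>M)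
        = (\<integral>\<omega>. prod (X' \<omega> - X n \<omega>) (Y' \<omega>) \<partial>M) + (\<integral>\<omega>. prod (X n \<omega>) (Y' \<omega> - Y n \<omega>) \<partial>M)"
      unfolding Bochner_Integration.integral_add[OF bilinear_integrable[OF d(1) Y(2)]
          bilinear_integrable[OF X(1)[of n] d(2)], symmetric]
        Bochner_Integration.integral_diff[OF bilinear_integrable[OF X(2) Y(2)]
          bilinear_integrable[OF X(1)[of n] Y(1)[of n]], symmetric] e ..
    have "norm ((\<integral>\<omega>. prod (X n \<omega>) (Y n \<omega>) \<partial>M) - (\<integral>\<omega>. prod (X' \<omega>) (Y' \<omega>) \<partial>M))
        \<le> norm (\<integral>\<omega>. prod (X' \<omega> - X n \<omega>) (Y' \<omega>) \<partial>M) + norm (\<integral>\<omega>. prod (X n \<omega>) (Y' \<omega> - Y n \<omega>) \<partial>M)"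
      by (subst norm_minus_commute, subst split, rule norm_triangle_ineq)
    also have "\<dots> \<le> K * (?dX n * ms_norm M Y') + K * (ms_norm M (X n) * ?dY n)"
      by (intro add_mono K(2) d X Y)
    also have "\<dots> \<le> K * (?dX n * ms_norm M Y') + K * ((ms_norm M X' + ?dX n) * ?dY n)"
    proof (intro add_left_mono mult_left_mono mult_right_mono K(1))
      show "ms_norm M (X n) \<le> ms_norm M X' + ?dX n"
        using ms_norm_triangle[OF X(2) square_integrable_rv_diff[OF X(1)[of n] X(2)]]
        by (simp add: ms_norm_minus_commute[of M "X n"])
    qed simp
    finally show ?thesis
      by (simp only: distrib_left)
  qed
  then show ?thesis
    by (intro LIM_zero_cancel[OF Lim_null_comparison[OF always_eventually lim0]]) auto
qed

end

lemma inner_integrable: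
  "square_integrable_rv M X \<Longrightarrow> square_integrable_rv M Y \<Longrightarrow> integrable M (\<lambda>\<omega>. X \<omega> \<bullet> Y \<omega>)"
  by (rule bilinear_integrable[OF bounded_bilinear_inner])

lemma inner_integral_le:
  assumes "square_integrable_rv M X" "square_integrable_rv M Y"
  shows "\<bar>\<integral>\<omega>. X \<omega> \<bullet> Y \<omega> \<partial>M\<bar> \<le> ms_norm M X * ms_norm M Y"
proof -
  have "\<bar>\<integral>\<omega>. X \<omega> \<bullet> Y \<omega> \<partial>M\<bar> \<le> (\<integral>\<omega>. norm (X \<omega>) * norm (Y \<omega>) \<partial>M)"
    unfolding real_norm_def[symmetric]
    using integral_norm_mult_le(1)[OF assms] by (rule norm_integral_le) (simp add: Cauchy_Schwarz_ineq2)
  with integral_norm_mult_le(2)[OF assms] show ?thesis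
    by linarith
qed

text \<open>Stated for an arbitrary measure because it is applied to \<open>lborel\<close>:
  \<open>has_wiener_integral\<close> expresses L^2 approximation by nonnegative integrals. One
  finite error term already makes the limit square-integrable.\<close>

lemma square_integrable_rv_of_nn_limit:
  assumes [measurable]: "f \<in> borel_measurable M" and s: "\<And>i. square_integrable_rv M (s i)"
    and lim: "(\<lambda>i. \<integral>\<^sup>+x. ennreal ((norm (f x - s i x))\<^sup>2) \<partial>M) \<longlonglongrightarrow> 0"
  shows "square_integrable_rv M f" "(\<lambda>i. ms_norm M (\<lambda>x. f x - s i x)) \<longlonglongrightarrow> 0"
proof -
  note [measurable] = square_integrable_rvD(1)[OF s]
  obtain i where "(\<integral>\<^sup>+x. ennreal ((norm (f x - s i x))\<^sup>2) \<partial>M) < 1"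
    using order_tendstoD(2)[OF lim, of 1] by (auto dest!: eventually_happens)
  then have "(\<integral>\<^sup>+x. ennreal ((norm (f x - s i x))\<^sup>2) \<partial>M) < \<infinity>"
    by (rule order.strict_trans) simp
  then have "square_integrable_rv M (\<lambda>x. f x - s i x)"
    by (simp add: square_integrable_rv_def integrable_iff_bounded)
  from square_integrable_rv_add[OF this s[of i]] show f: "square_integrable_rv M f"
    by simp
  have "ennreal ((ms_norm M (\<lambda>x. f x - s i x))\<^sup>2) = (\<integral>\<^sup>+x. ennreal ((norm (f x - s i x))\<^sup>2) \<partial>M)" for i
    using nn_integral_eq_integral[OF square_integrable_rvD(2)[OF square_integrable_rv_diff[OF f s[of i]]]]
    by (simp add: ms_norm_square)
  with lim have "(\<lambda>i. ennreal ((ms_norm M (\<lambda>x. f x - s i x))\<^sup>2)) \<longlonglongrightarrow> ennreal 0"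
    by simp
  then have "(\<lambda>i. (ms_norm M (\<lambda>x. f x - s i x))\<^sup>2) \<longlonglongrightarrow> 0"
    by (subst (asm) tendsto_ennreal_iff) auto
  from tendsto_real_sqrt[OF this] show "(\<lambda>i. ms_norm M (\<lambda>x. f x - s i x)) \<longlonglongrightarrow> 0"
    by simp
qed

section \<open>Completeness in mean square\<close>

lemma (in prob_space) integral_norm_le_ms_norm:
  assumes "square_integrable_rv M X"
  shows "integrable M X" "expectation (\<lambda>\<omega>. norm (X \<omega>)) \<le> ms_norm M X"
proof -
  have "square_integrable_rv M (\<lambda>\<omega>. 1::real)"
    by (simp add: square_integrable_rv_def)
  from integral_norm_mult_le[OF assms this]
  show "integrable M X" "expectation (\<lambda>\<omega>. norm (X \<omega>)) \<le> ms_norm M X"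
    using square_integrable_rvD(1)[OF assms]
    by (simp_all add: ms_norm_def prob_space integrable_norm_iff)
qed

text \<open>The Riesz-Fischer theorem for vector-valued variables: a rapidly converging subsequence
  converges almost surely, and Fatou's lemma makes its limit the mean-square limit of the full
  sequence.\<close>

lemma (in prob_space) ms_complete:
  fixes X :: "nat \<Rightarrow> 'a \<Rightarrow> 'v::euclidean_space"
  assumes X: "\<And>n. square_integrable_rv M (X n)"
    and Cauchy: "\<And>e. e > 0 \<Longrightarrow> \<exists>N. \<forall>m\<ge>N. \<forall>n\<ge>N. ms_norm M (\<lambda>\<omega>. X m \<omega> - X n \<omega>) < e"
  obtains Y where "square_integrable_rv M Y" "(\<lambda>n. ms_norm M (\<lambda>\<omega>. Y \<omega> - X n \<omega>)) \<longlonglongrightarrow> 0"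
proof -
  note [measurable] = square_integrable_rvD(1)[OF X]
  have "\<forall>i. \<exists>N. \<forall>m\<ge>N. \<forall>n\<ge>N. ms_norm M (\<lambda>\<omega>. X m \<omega> - X n \<omega>) < (1 / 2) ^ i"
    using Cauchy by simp
  then obtain N where N: "\<And>i m n. m \<ge> N i \<Longrightarrow> n \<ge> N i \<Longrightarrow> ms_norm M (\<lambda>\<omega>. X m \<omega> - X n \<omega>) < (1 / 2) ^ i"
    by metis
  \<comment> \<open>The partial sums are monotone and dominate \<open>N i\<close>, so the
    consecutive indices \<open>r i\<close> and \<open>r (Suc i)\<close> both lie beyond
    \<open>N i\<close>; the summand i forces \<open>r i\<close> to infinity.\<close>
  define r where "r i = (\<Sum>k\<le>i. N k) + i" for i :: nat
  have r: "N i \<le> r i" "N i \<le> r (Suc i)" "i \<le> r i" for i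
  proof -
    show 1: "N i \<le> r i"
      unfolding r_def by (rule trans_le_add1) (rule member_le_sum, auto)
    then show "N i \<le> r (Suc i)"
      by (simp add: r_def)
  qed (simp add: r_def)
  define d where "d i \<omega> = X (r (Suc i)) \<omega> - X (r i) \<omega>" for i \<omega>
  have d: "square_integrable_rv M (d i)" for i
    unfolding d_def by (intro square_integrable_rv_diff X)
  note [measurable] = square_integrable_rvD(1)[OF d]
  \<comment> \<open>The L^1 norms of the increments are at most their mean-square norms, hence
    bounded by a geometric series; the telescoping series therefore converges absolutely almost
    surely.\<close>
  have "(\<integral>\<^sup>+\<omega>. (\<Sum>i. ennreal (norm (d i \<omega>))) \<partial>M) = (\<Sum>i. \<integral>\<^sup>+\<omega>. ennreal (norm (d i \<omega>)) \<partial>M)"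
    by (rule nn_integral_suminf) simp
  also have "\<dots> \<le> (\<Sum>i. ennreal ((1 / 2) ^ i))"
  proof (intro suminf_le summableI)
    fix i
    have "(\<integral>\<^sup>+\<omega>. ennreal (norm (d i \<omega>)) \<partial>M) = ennreal (expectation (\<lambda>\<omega>. norm (d i \<omega>)))"
      using integral_norm_le_ms_norm(1)[OF d[of i]] by (intro nn_integral_eq_integral) auto
    also have "\<dots> \<le> ennreal ((1 / 2) ^ i)"
      using integral_norm_le_ms_norm(2)[OF d[of i]] N[OF r(2,1), of i]
      by (intro ennreal_leI) (simp add: d_def[abs_def])
    finally show "(\<integral>\<^sup>+\<omega>. ennreal (norm (d i \<omega>)) \<partial>M) \<le> ennreal ((1 / 2) ^ i)" .
  qed
  also have "\<dots> = ennreal (\<Sum>i. (1 / 2) ^ i)"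
    by (intro suminf_ennreal_eq) (auto intro: summable_sums)
  also have "\<dots> < \<infinity>"
    by simp
  finally have "(\<integral>\<^sup>+\<omega>. (\<Sum>i. ennreal (norm (d i \<omega>))) \<partial>M) < \<infinity>" .
  then have "AE \<omega> in M. (\<Sum>i. ennreal (norm (d i \<omega>))) \<noteq> \<infinity>"
    by (intro nn_integral_noteq_infinite) auto
  then have conv: "AE \<omega> in M. (\<lambda>i. X (r i) \<omega>) \<longlonglongrightarrow> lim (\<lambda>i. X (r i) \<omega>)"
  proof eventually_elim
    case (elim \<omega>)
    then have "summable (\<lambda>i. norm (d i \<omega>))"
      by (intro summable_suminf_not_top) auto
    then have "summable (\<lambda>i. d i \<omega>)"
      by (rule summable_norm_cancel)
    then have "convergent (\<lambda>n. \<Sum>i<n. d i \<omega>)"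
      by (simp add: summable_iff_convergent)
    moreover have "(\<Sum>i<n. d i \<omega>) = X (r n) \<omega> - X (r 0) \<omega>" for n
      unfolding d_def by (rule sum_lessThan_telescope)
    ultimately have "convergent (\<lambda>n. X (r n) \<omega>)"
      by (simp add: convergent_diff_const_right_iff)
    then show ?case
      by (simp add: convergent_LIMSEQ_iff)
  qed
  define Y where "Y \<omega> = lim (\<lambda>i. X (r i) \<omega>)" for \<omega>
  have [measurable]: "Y \<in> borel_measurable M"
    unfolding Y_def by (rule borel_measurable_lim_metric) simp
  \<comment> \<open>A bound valid for all large m passes along the subsequence to the almost sure
    limit. The arbitrary value of \<open>lim\<close> on the exceptional null set does not
    matter.\<close>
  have Fatou: "(\<integral>\<^sup>+\<omega>. ennreal ((norm (Y \<omega> - X n \<omega>))\<^sup>2) \<partial>M) \<le> ennreal (e\<^sup>2)"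
    if e: "\<And>m. m \<ge> n0 \<Longrightarrow> ms_norm M (\<lambda>\<omega>. X m \<omega> - X n \<omega>) < e" for n n0 e
  proof -
    have "(\<integral>\<^sup>+\<omega>. ennreal ((norm (Y \<omega> - X n \<omega>))\<^sup>2) \<partial>M)
        \<le> (\<integral>\<^sup>+\<omega>. liminf (\<lambda>i. ennreal ((norm (X (r i) \<omega> - X n \<omega>))\<^sup>2)) \<partial>M)"
    proof (rule nn_integral_mono_AE, use conv in eventually_elim)
      case (elim \<omega>)
      then have "(\<lambda>i. ennreal ((norm (X (r i) \<omega> - X n \<omega>))\<^sup>2)) \<longlonglongrightarrow> ennreal ((norm (Y \<omega> - X n \<omega>))\<^sup>2)"
        unfolding Y_def by (intro tendsto_intros)
      then show ?case
        by (simp add: lim_imp_Liminf del: tendsto_ennreal_iff)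
    qed
    also have "\<dots> \<le> liminf (\<lambda>i. \<integral>\<^sup>+\<omega>. ennreal ((norm (X (r i) \<omega> - X n \<omega>))\<^sup>2) \<partial>M)"
      by (rule nn_integral_liminf) simp
    also have "\<dots> \<le> ennreal (e\<^sup>2)"
    proof (rule Liminf_le[OF sequentially_bot])
      have "(\<integral>\<^sup>+\<omega>. ennreal ((norm (X (r i) \<omega> - X n \<omega>))\<^sup>2) \<partial>M) \<le> ennreal (e\<^sup>2)" if "i \<ge> n0" for i
      proof -
        have "(\<integral>\<^sup>+\<omega>. ennreal ((norm (X (r i) \<omega> - X n \<omega>))\<^sup>2) \<partial>M)
            = ennreal ((ms_norm M (\<lambda>\<omega>. X (r i) \<omega> - X n \<omega>))\<^sup>2)"
          unfolding ms_norm_square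
          using square_integrable_rvD(2)[OF square_integrable_rv_diff[OF X[of "r i"] X[of n]]]
          by (intro nn_integral_eq_integral) auto
        also have "\<dots> \<le> ennreal (e\<^sup>2)"
          using e[of "r i"] that r(3)[of i] by (intro ennreal_leI power_mono) auto
        finally show ?thesis .
      qed
      then show "\<forall>\<^sub>F i in sequentially. (\<integral>\<^sup>+\<omega>. ennreal ((norm (X (r i) \<omega> - X n \<omega>))\<^sup>2) \<partial>M) \<le> ennreal (e\<^sup>2)"
        by (auto simp: eventually_sequentially)
    qed
    finally show ?thesis .
  qed
  have Yd: "square_integrable_rv M (\<lambda>\<omega>. Y \<omega> - X n \<omega>)" "ms_norm M (\<lambda>\<omega>. Y \<omega> - X n \<omega>) \<le> e"
    if e: "\<And>m. m \<ge> n0 \<Longrightarrow> ms_norm M (\<lambda>\<omega>. X m \<omega> - X n \<omega>) < e" for n n0 e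
  proof -
    have "(\<integral>\<^sup>+\<omega>. ennreal ((norm (Y \<omega> - X n \<omega>))\<^sup>2) \<partial>M) < \<infinity>"
      using Fatou[OF e] by (rule order.strict_trans1) simp_all
    then show sq: "square_integrable_rv M (\<lambda>\<omega>. Y \<omega> - X n \<omega>)"
      by (simp add: square_integrable_rv_def integrable_iff_bounded)
    have "ennreal ((ms_norm M (\<lambda>\<omega>. Y \<omega> - X n \<omega>))\<^sup>2) \<le> ennreal (e\<^sup>2)"
      using Fatou[OF e] nn_integral_eq_integral[OF square_integrable_rvD(2)[OF sq]]
      by (simp add: ms_norm_square)
    then have "(ms_norm M (\<lambda>\<omega>. Y \<omega> - X n \<omega>))\<^sup>2 \<le> e\<^sup>2"
      by (subst (asm) ennreal_le_iff) auto
    moreover have "e \<ge> 0"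
      using e[of n0] ms_norm_nonneg[of M "\<lambda>\<omega>. X n0 \<omega> - X n \<omega>"] by linarith
    ultimately show "ms_norm M (\<lambda>\<omega>. Y \<omega> - X n \<omega>) \<le> e"
      by (rule power2_le_imp_le)
  qed
  obtain N0 where "\<forall>m\<ge>N0. \<forall>n\<ge>N0. ms_norm M (\<lambda>\<omega>. X m \<omega> - X n \<omega>) < 1"
    using Cauchy[of 1] by auto
  then have "square_integrable_rv M (\<lambda>\<omega>. Y \<omega> - X N0 \<omega>)"
    by (intro Yd(1)[of N0 N0 1]) auto
  from square_integrable_rv_add[OF this X[of N0]] have Y: "square_integrable_rv M Y"
    by simp
  have "(\<lambda>n. ms_norm M (\<lambda>\<omega>. Y \<omega> - X n \<omega>)) \<longlonglongrightarrow> 0"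
  proof (rule LIMSEQ_I)
    fix e :: real assume "e > 0"
    then obtain n0 where n0: "\<forall>m\<ge>n0. \<forall>n\<ge>n0. ms_norm M (\<lambda>\<omega>. X m \<omega> - X n \<omega>) < e / 2"
      using Cauchy[of "e / 2"] by auto
    have "ms_norm M (\<lambda>\<omega>. Y \<omega> - X n \<omega>) < e" if "n \<ge> n0" for n
      using Yd(2)[of n0 n "e / 2"] n0 that \<open>e > 0\<close> by force
    then show "\<exists>n0. \<forall>n\<ge>n0. norm (ms_norm M (\<lambda>\<omega>. Y \<omega> - X n \<omega>) - 0) < e"
      by auto
  qed
  with Y show ?thesis
    by (rule that)
qed


section \<open>Characteristic functions of random vectors\<close>

text \<open>Normalising a bounded nonnegative weight of mass c > 0 makes a probability law on the
  line, to which Levy's uniqueness theorem applies; integrals against it are weighted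
  expectations.\<close>

lemma weighted_distr:
  fixes X w :: "'a \<Rightarrow> real"
  assumes "prob_space M" and [measurable]: "X \<in> borel_measurable M" "w \<in> borel_measurable M"
    and w: "\<And>\<omega>. 0 \<le> w \<omega>" "\<And>\<omega>. w \<omega> \<le> K" and c: "(\<integral>\<omega>. w \<omega> \<partial>M) = c" "c > 0"
  defines "\<mu> \<equiv> distr (density M (\<lambda>\<omega>. ennreal (w \<omega> / c))) borel X"
  shows "real_distribution \<mu>"
    and "\<And>g :: real \<Rightarrow> 'v::{banach,second_countable_topology}. g \<in> borel_measurable borel \<Longrightarrow>
      (\<integral>x. g x \<partial>\<mu>) = (1 / c) *\<^sub>R (\<integral>\<omega>. w \<omega> *\<^sub>R g (X \<omega>) \<partial>M)"
proof -
  interpret prob_space M by fact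
  have int: "integrable M w"
    using w by (intro integrable_const_bound[where B = K]) auto
  have "prob_space (density M (\<lambda>\<omega>. ennreal (w \<omega> / c)))"
  proof (rule prob_spaceI)
    have "(\<integral>\<^sup>+\<omega>. ennreal (w \<omega> / c) \<partial>M) = ennreal (\<integral>\<omega>. w \<omega> / c \<partial>M)"
      using int w c by (intro nn_integral_eq_integral) auto
    then show "emeasure (density M (\<lambda>\<omega>. ennreal (w \<omega> / c))) (space (density M (\<lambda>\<omega>. ennreal (w \<omega> / c)))) = 1"
      using c by (simp add: emeasure_density cong: nn_integral_cong)
  qed
  then show "real_distribution \<mu>"
    unfolding \<mu>_def by (intro prob_space.real_distribution_distr) (use assms(2) in simp_all)
  show "(\<integral>x. g x \<partial>\<mu>) = (1 / c) *\<^sub>R (\<integral>\<omega>. w \<omega> *\<^sub>R g (X \<omega>) \<partial>M)"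
    if [measurable]: "g \<in> borel_measurable borel" for g :: "real \<Rightarrow> 'v"
  proof -
    have "(\<integral>x. g x \<partial>\<mu>) = (\<integral>\<omega>. (w \<omega> / c) *\<^sub>R g (X \<omega>) \<partial>M)"
      unfolding \<mu>_def using w c(2) by (simp add: integral_distr integral_density)
    also have "\<dots> = (\<integral>\<omega>. (1 / c) *\<^sub>R (w \<omega> *\<^sub>R g (X \<omega>)) \<partial>M)"
      by simp
    finally show ?thesis
      by (simp only: integral_scaleR_right)
  qed
qed

text \<open>Levy's theorem for weighted laws. Evaluation at t = 0 shows that both weights have the
  same mass and so the same normalising constant; mass 0 is treated separately, as the weights then
  vanish almost surely.\<close>

lemma weighted_char_unique:
  fixes X w :: "'a \<Rightarrow> real" and Y v :: "'b \<Rightarrow> real"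
  assumes M: "prob_space M" "X \<in> borel_measurable M" "w \<in> borel_measurable M"
      "\<And>\<omega>. 0 \<le> w \<omega>" "\<And>\<omega>. w \<omega> \<le> K"
    and N: "prob_space N" "Y \<in> borel_measurable N" "v \<in> borel_measurable N"
      "\<And>\<omega>. 0 \<le> v \<omega>" "\<And>\<omega>. v \<omega> \<le> K"
    and eq: "\<And>t. (\<integral>\<omega>. w \<omega> *\<^sub>R iexp (t * X \<omega>) \<partial>M) = (\<integral>\<omega>. v \<omega> *\<^sub>R iexp (t * Y \<omega>) \<partial>N)"
    and A: "A \<in> sets borel"
  shows "(\<integral>\<omega>. w \<omega> * indicator A (X \<omega>) \<partial>M) = (\<integral>\<omega>. v \<omega> * indicator A (Y \<omega>) \<partial>N)"
proof -
  interpret M: prob_space M by (rule M(1))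
  interpret N: prob_space N by (rule N(1))
  note [measurable] = M(2,3) N(2,3) A
  have "complex_of_real (\<integral>\<omega>. w \<omega> \<partial>M) = complex_of_real (\<integral>\<omega>. v \<omega> \<partial>N)"
    using eq[of 0] by (simp add: scaleR_conv_of_real)
  then obtain c where c: "(\<integral>\<omega>. w \<omega> \<partial>M) = c" "(\<integral>\<omega>. v \<omega> \<partial>N) = c"
    by simp
  have "c \<ge> 0"
    using M(4) c(1) by (auto intro!: integral_nonneg_AE)
  show ?thesis
  proof (cases "c = 0")
    case True
    have "integrable M w" "integrable N v"
      using M N by (auto intro!: M.integrable_const_bound[where B
          = K] N.integrable_const_bound[where B = K])
    then have "AE \<omega> in M. w \<omega> = 0" "AE \<omega> in N. v \<omega> = 0"
      using c True M(4) N(4) by (simp_all add: integral_nonneg_eq_0_iff_AE)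
    then have "(\<integral>\<omega>. w \<omega> * indicator A (X \<omega>) \<partial>M) = (\<integral>\<omega>. 0 \<partial>M)"
      "(\<integral>\<omega>. v \<omega> * indicator A (Y \<omega>) \<partial>N) = (\<integral>\<omega>. 0 \<partial>N)"
      by (intro integral_cong_AE; auto)+
    then show ?thesis by simp
  next
    case False
    then have "c > 0" using \<open>c \<ge> 0\<close> by simp
    note \<mu> = weighted_distr[OF M c(1) this] and \<nu> = weighted_distr[OF N c(2) this]
    let ?\<mu> = "distr (density M (\<lambda>\<omega>. ennreal (w \<omega> / c))) borel X"
    let ?\<nu> = "distr (density N (\<lambda>\<omega>. ennreal (v \<omega> / c))) borel Y"
    have "?\<mu> = ?\<nu>"
    proof (rule Levy_uniqueness[OF \<mu>(1) \<nu>(1)], rule ext)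
      show "char ?\<mu> t = char ?\<nu> t" for t
        using eq[of t] by (simp add: char_def \<mu>(2) \<nu>(2))
    qed
    then have "(\<integral>x. indicat_real A x \<partial>?\<mu>) = (\<integral>x. indicat_real A x \<partial>?\<nu>)"
      by simp
    then show ?thesis
      unfolding \<mu>(2)[OF borel_measurable_indicator[OF A]] \<nu>(2)[OF borel_measurable_indicator[OF A]]
      using \<open>c > 0\<close> by simp
  qed
qed

lemma iexp_add: "iexp (a + b) = iexp a * iexp b"
  by (simp add: exp_add distrib_left)

lemma (in prob_space) integrable_bounded_iexp:
  assumes [measurable]: "p \<in> borel_measurable M" "\<theta> \<in> borel_measurable M"
    and p: "\<And>\<omega>. norm (p \<omega>) \<le> K"
  shows "integrable M (\<lambda>\<omega>. p \<omega> *\<^sub>R iexp (\<theta> \<omega>))" "integrable M (\<lambda>\<omega>. p \<omega> * cos (\<theta> \<omega>))"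
    "integrable M (\<lambda>\<omega>. p \<omega> * sin (\<theta> \<omega>))" "integrable M p"
proof -
  have "\<bar>p \<omega> * cos (\<theta> \<omega>)\<bar> \<le> K" "\<bar>p \<omega> * sin (\<theta> \<omega>)\<bar> \<le> K" for \<omega>
    using mult_mono[OF p abs_cos_le_one] mult_mono[OF p abs_sin_le_one] order_trans[OF norm_ge_zero p]
    by (simp_all add: abs_mult)
  then show "integrable M (\<lambda>\<omega>. p \<omega> *\<^sub>R iexp (\<theta> \<omega>))" "integrable M (\<lambda>\<omega>. p \<omega> * cos (\<theta> \<omega>))"
    "integrable M (\<lambda>\<omega>. p \<omega> * sin (\<theta> \<omega>))" "integrable M p"
    using p by (auto intro!: integrable_const_bound[where B = K])
qed

text \<open>Euler's formulas: a weight 1 + cos or 1 + sin of \<theta> against an exponential is a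
  combination of exponentials shifted by 0, \<theta> and -\<theta>. An identity for complex
  exponentials thus yields one for nonnegative weights.\<close>

lemma weighted_cos_sin_iexp:
  assumes "prob_space M" and [measurable]: "p \<in> borel_measurable M" "X \<in> borel_measurable M" "\<theta>
      \<in> borel_measurable M"
    and p: "\<And>\<omega>. norm (p \<omega>) \<le> K"
  shows "(\<integral>\<omega>. (p \<omega> * (1 + cos (\<theta> \<omega>))) *\<^sub>R iexp (X \<omega>) \<partial>M) =
      (\<integral>\<omega>. p \<omega> *\<^sub>R iexp (X \<omega>) \<partial>M) + (1 / 2) * (\<integral>\<omega>. p \<omega> *\<^sub>R iexp (X \<omega> + \<theta> \<omega>) \<partial>M)
        + (1 / 2) * (\<integral>\<omega>. p \<omega> *\<^sub>R iexp (X \<omega> + - \<theta> \<omega>) \<partial>M)"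
    "(\<integral>\<omega>. (p \<omega> * (1 + sin (\<theta> \<omega>))) *\<^sub>R iexp (X \<omega>) \<partial>M) =
      (\<integral>\<omega>. p \<omega> *\<^sub>R iexp (X \<omega>) \<partial>M) + (- \<i> / 2) * (\<integral>\<omega>. p \<omega> *\<^sub>R iexp (X \<omega> + \<theta> \<omega>) \<partial>M)
        + (\<i> / 2) * (\<integral>\<omega>. p \<omega> *\<^sub>R iexp (X \<omega> + - \<theta> \<omega>) \<partial>M)"
proof -
  interpret prob_space M by fact
  have i: "integrable M (\<lambda>\<omega>. p \<omega> *\<^sub>R iexp (X \<omega>))" "integrable M (\<lambda>\<omega>. p \<omega> *\<^sub>R iexp (X \<omega> + \<theta> \<omega>))"
    "integrable M (\<lambda>\<omega>. p \<omega> *\<^sub>R iexp (X \<omega> + - \<theta> \<omega>))"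
    by (intro integrable_bounded_iexp(1)[OF _ _ p]; measurable)+
  have "(p \<omega> * (1 + cos (\<theta> \<omega>))) *\<^sub>R iexp (X \<omega>) =
      p \<omega> *\<^sub>R iexp (X \<omega>) + (1 / 2) * (p \<omega> *\<^sub>R iexp (X \<omega> + \<theta> \<omega>))
          + (1 / 2) * (p \<omega> *\<^sub>R iexp (X \<omega> + - \<theta> \<omega>))" for \<omega>
    unfolding iexp_add cis_conv_exp[symmetric] by (simp add: complex_eq_iff)
      (simp add: field_simps cos_add cos_diff sin_add sin_diff)
  then show "(\<integral>\<omega>. (p \<omega> * (1 + cos (\<theta> \<omega>))) *\<^sub>R iexp (X \<omega>) \<partial>M) =
      (\<integral>\<omega>. p \<omega> *\<^sub>R iexp (X \<omega>) \<partial>M) + (1 / 2) * (\<integral>\<omega>. p \<omega> *\<^sub>R iexp (X \<omega> + \<theta> \<omega>) \<partial>M)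
        + (1 / 2) * (\<integral>\<omega>. p \<omega> *\<^sub>R iexp (X \<omega> + - \<theta> \<omega>) \<partial>M)"
    using i by (simp only: Bochner_Integration.integral_add integral_mult_right_zero integrable_mult_right
        Bochner_Integration.integrable_add)
  have "(p \<omega> * (1 + sin (\<theta> \<omega>))) *\<^sub>R iexp (X \<omega>) =
      p \<omega> *\<^sub>R iexp (X \<omega>) + (- \<i> / 2) * (p \<omega> *\<^sub>R iexp (X \<omega> + \<theta> \<omega>))
          + (\<i> / 2) * (p \<omega> *\<^sub>R iexp (X \<omega> + - \<theta> \<omega>))" for \<omega>
    unfolding iexp_add cis_conv_exp[symmetric] by (simp add: complex_eq_iff)
      (simp add: field_simps cos_add cos_diff sin_add sin_diff)
  then show "(\<integral>\<omega>. (p \<omega> * (1 + sin (\<theta> \<omega>))) *\<^sub>R iexp (X \<omega>) \<partial>M) =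
      (\<integral>\<omega>. p \<omega> *\<^sub>R iexp (X \<omega>) \<partial>M) + (- \<i> / 2) * (\<integral>\<omega>. p \<omega> *\<^sub>R iexp (X \<omega> + \<theta> \<omega>) \<partial>M)
        + (\<i> / 2) * (\<integral>\<omega>. p \<omega> *\<^sub>R iexp (X \<omega> + - \<theta> \<omega>) \<partial>M)"
    using i by (simp only: Bochner_Integration.integral_add integral_mult_right_zero integrable_mult_right
        Bochner_Integration.integrable_add)
qed

text \<open>Multivariate uniqueness is reduced to \<open>Levy_uniqueness\<close> by replacing the exponentials in
  the characteristic function by indicators, one coordinate at a time; the factor
  \<open>1 + cos\<close> (or \<open>1 + sin\<close>) keeps the weights nonnegative.\<close>

lemma char_eq_imp_indicator_eq:
  fixes X :: "'i \<Rightarrow> 'a \<Rightarrow> real" and Y :: "'i \<Rightarrow> 'b \<Rightarrow> real"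
  assumes M: "prob_space M" "\<And>i. X i \<in> borel_measurable M"
    and N: "prob_space N" "\<And>i. Y i \<in> borel_measurable N"
    and I: "finite I" and A: "\<And>i. A i \<in> sets borel"
    and eq: "\<And>u. (\<integral>\<omega>. iexp (\<Sum>i\<in>I. u i * X i \<omega>) \<partial>M) = (\<integral>\<omega>. iexp (\<Sum>i\<in>I. u i * Y i \<omega>) \<partial>N)"
    and S: "S \<subseteq> I"
  shows "(\<integral>\<omega>. (\<Prod>i\<in>S. indicator (A i) (X i \<omega>)) *\<^sub>R iexp (\<Sum>i\<in>I - S. u i * X i \<omega>) \<partial>M) =
    (\<integral>\<omega>. (\<Prod>i\<in>S. indicator (A i) (Y i \<omega>)) *\<^sub>R iexp (\<Sum>i\<in>I - S. u i * Y i \<omega>) \<partial>N)"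
  using finite_subset[OF S I] S
proof (induction S arbitrary: u rule: finite_induct)
  case empty
  then show ?case using eq by simp
next
  case (insert s S)
  interpret M: prob_space M by (rule M(1))
  interpret N: prob_space N by (rule N(1))
  note [measurable] = M(2) N(2) A
  let ?R = "I - insert s S"
  have s: "s \<notin> ?R" "s \<notin> S" "I - S = insert s ?R" "finite ?R"
    using insert I by auto
  define p where "p \<omega> = (\<Prod>i\<in>S. indicat_real (A i) (X i \<omega>))" for \<omega>
  define q where "q \<omega> = (\<Prod>i\<in>S. indicat_real (A i) (Y i \<omega>))" for \<omega>
  have [measurable]: "p \<in> borel_measurable M" "q \<in> borel_measurable N"
    unfolding p_def q_def by measurable
  have p: "0 \<le> p \<omega>" "p \<omega> \<le> 1" "norm (p \<omega>) \<le> 1" for \<omega>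
    unfolding p_def by (auto intro!: prod_nonneg prod_le_1 simp: abs_prod)
  have q: "0 \<le> q \<omega>" "q \<omega> \<le> 1" "norm (q \<omega>) \<le> 1" for \<omega>
    unfolding q_def by (auto intro!: prod_nonneg prod_le_1 simp: abs_prod)
  define \<theta> where "\<theta> \<omega> = (\<Sum>i\<in>?R. u i * X i \<omega>)" for \<omega>
  define \<eta> where "\<eta> \<omega> = (\<Sum>i\<in>?R. u i * Y i \<omega>)" for \<omega>
  have [measurable]: "\<theta> \<in> borel_measurable M" "\<eta> \<in> borel_measurable N"
    unfolding \<theta>_def \<eta>_def by measurable
  \<comment> \<open>The frequencies in the induction hypothesis are arbitrary: that of coordinate s
    is left free as t, and those still to be treated are scaled by c, which will be 0, 1 or
    -1.\<close>
  have IH: "(\<integral>\<omega>. p \<omega> *\<^sub>R iexp (t * X s \<omega> + c * \<theta> \<omega>) \<partial>M)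
      = (\<integral>\<omega>. q \<omega> *\<^sub>R iexp (t * Y s \<omega> + c * \<eta> \<omega>) \<partial>N)" for t c
  proof -
    have "(\<Sum>i\<in>I - S. ((\<lambda>i. c * u i)(s := t)) i * f i) = t * f s + c * (\<Sum>i\<in>?R. u i * f i)" for f
    proof -
      have "(\<Sum>i\<in>?R. ((\<lambda>i. c * u i)(s := t)) i * f i) = (\<Sum>i\<in>?R. c * (u i * f i))"
        using s(1) by (intro sum.cong) auto
      then show ?thesis
        unfolding s(3) using s(1,4) by (simp add: sum_distrib_left)
    qed
    then show ?thesis
      using insert.IH[of "(\<lambda>i. c * u i)(s := t)"] insert.prems
      by (simp only: p_def q_def \<theta>_def \<eta>_def) auto
  qed
  have IH0: "(\<integral>\<omega>. p \<omega> *\<^sub>R iexp (t * X s \<omega>) \<partial>M) = (\<integral>\<omega>. q \<omega> *\<^sub>R iexp (t * Y s \<omega>) \<partial>N)" for t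
    using IH[of t 0] by simp
  note IH1 = IH0 IH[of _ 1, unfolded mult_1] IH[of _ "-1", unfolded mult_minus_left mult_1]
  have X: "(\<lambda>\<omega>. t * X s \<omega>) \<in> borel_measurable M" "(\<lambda>\<omega>. t * Y s \<omega>) \<in> borel_measurable N" for t
    by measurable
  have bounds: "0 \<le> 1 + cos x" "1 + cos x \<le> 2" "0 \<le> 1 + sin x" "1 + sin x \<le> 2" for x :: real
    using cos_ge_minus_one[of x] cos_le_one[of x] sin_ge_minus_one[of x] sin_le_one[of x] by linarith+
  have le2: "a * b \<le> 2" if "0 \<le> a" "a \<le> 1" "0 \<le> b" "b \<le> 2" for a b :: real
    using mult_mono[of a 1 b 2] that by simp
  have cs: "(\<integral>\<omega>. (p \<omega> * (1 + cos (\<theta> \<omega>))) *\<^sub>R iexp (t * X s \<omega>) \<partial>M)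
      = (\<integral>\<omega>. (q \<omega> * (1 + cos (\<eta> \<omega>))) *\<^sub>R iexp (t * Y s \<omega>) \<partial>N)"
    "(\<integral>\<omega>. (p \<omega> * (1 + sin (\<theta> \<omega>))) *\<^sub>R iexp (t * X s \<omega>) \<partial>M)
        = (\<integral>\<omega>. (q \<omega> * (1 + sin (\<eta> \<omega>))) *\<^sub>R iexp (t * Y s \<omega>) \<partial>N)" for t
    using weighted_cos_sin_iexp[OF M(1) \<open>p \<in> borel_measurable M\<close> X(1) \<open>\<theta> \<in> borel_measurable M\<close> p(3), of t]
      weighted_cos_sin_iexp[OF N(1) \<open>q \<in> borel_measurable N\<close> X(2) \<open>\<eta> \<in> borel_measurable N\<close> q(3), of t]
    unfolding IH1 by argo+
  have c1: "(\<integral>\<omega>. (p \<omega> * (1 + cos (\<theta> \<omega>))) * indicator (A s) (X s \<omega>) \<partial>M)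
      = (\<integral>\<omega>. (q \<omega> * (1 + cos (\<eta> \<omega>))) * indicator (A s) (Y s \<omega>) \<partial>N)"
    using p q bounds
    by (intro weighted_char_unique[OF M _ _ _ N, where K = 2] cs)
      (auto simp: le2)
  have c2: "(\<integral>\<omega>. (p \<omega> * (1 + sin (\<theta> \<omega>))) * indicator (A s) (X s \<omega>) \<partial>M)
      = (\<integral>\<omega>. (q \<omega> * (1 + sin (\<eta> \<omega>))) * indicator (A s) (Y s \<omega>) \<partial>N)"
    using p q bounds
    by (intro weighted_char_unique[OF M _ _ _ N, where K = 2] cs)
      (auto simp: le2)
  have c0: "(\<integral>\<omega>. p \<omega> * indicator (A s) (X s \<omega>) \<partial>M) = (\<integral>\<omega>. q \<omega> * indicator (A s) (Y s \<omega>) \<partial>N)"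
    using p q
    by (intro weighted_char_unique[OF M _ _ _ N, where K = 1] IH0) auto
  define p' where "p' \<omega> = p \<omega> * indicator (A s) (X s \<omega>)" for \<omega>
  define q' where "q' \<omega> = q \<omega> * indicator (A s) (Y s \<omega>)" for \<omega>
  have [measurable]: "p' \<in> borel_measurable M" "q' \<in> borel_measurable N"
    unfolding p'_def q'_def by measurable
  have p': "norm (p' x) \<le> 1" for x
    using p(3)[of x] unfolding p'_def by (cases "X s x \<in> A s") auto
  have q': "norm (q' x) \<le> 1" for x
    using q(3)[of x] unfolding q'_def by (cases "Y s x \<in> A s") auto
  have iM: "integrable M (\<lambda>\<omega>. p' \<omega> *\<^sub>R iexp (\<theta> \<omega>))" "integrable M (\<lambda>\<omega>. p' \<omega> * cos (\<theta> \<omega>))"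
      "integrable M (\<lambda>\<omega>. p' \<omega> * sin (\<theta> \<omega>))" "integrable M p'"
    by (rule M.integrable_bounded_iexp[OF \<open>p' \<in> borel_measurable M\<close> \<open>\<theta> \<in> borel_measurable M\<close> p'])+
  have iN: "integrable N (\<lambda>\<omega>. q' \<omega> *\<^sub>R iexp (\<eta> \<omega>))" "integrable N (\<lambda>\<omega>. q' \<omega> * cos (\<eta> \<omega>))"
      "integrable N (\<lambda>\<omega>. q' \<omega> * sin (\<eta> \<omega>))" "integrable N q'"
    by (rule N.integrable_bounded_iexp[OF \<open>q' \<in> borel_measurable N\<close> \<open>\<eta> \<in> borel_measurable N\<close> q'])+
  have e: "(p \<omega> * (1 + x)) * indicator (A s) (X s \<omega>) = p' \<omega> + p' \<omega> * x"
    "(q \<eta> * (1 + x)) * indicator (A s) (Y s \<eta>) = q' \<eta> + q' \<eta> * x" for x \<omega> \<eta>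
    by (simp_all add: p'_def q'_def algebra_simps)
  \<comment> \<open>Subtracting the identity for the weight p alone removes the summand 1 that had
    ensured nonnegativity, so cosine and sine, and hence the exponential, are recovered
    separately.\<close>
  have "(\<integral>\<omega>. p' \<omega> * cos (\<theta> \<omega>) \<partial>M) = (\<integral>\<omega>. q' \<omega> * cos (\<eta> \<omega>) \<partial>N)"
      "(\<integral>\<omega>. p' \<omega> * sin (\<theta> \<omega>) \<partial>M) = (\<integral>\<omega>. q' \<omega> * sin (\<eta> \<omega>) \<partial>N)"
    using c0 c1 c2 unfolding e p'_def[symmetric] q'_def[symmetric]
      Bochner_Integration.integral_add[OF iM(4) iM(2)] Bochner_Integration.integral_add[OF iM(4) iM(3)]
      Bochner_Integration.integral_add[OF iN(4) iN(2)] Bochner_Integration.integral_add[OF iN(4) iN(3)]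
    by linarith+
  then have "(\<integral>\<omega>. p' \<omega> *\<^sub>R iexp (\<theta> \<omega>) \<partial>M) = (\<integral>\<omega>. q' \<omega> *\<^sub>R iexp (\<eta> \<omega>) \<partial>N)"
    using iM(1) iN(1)
    by (intro complex_eqI) (simp_all add: cis_conv_exp[symmetric] integral_Re[symmetric]
        integral_Im[symmetric])
  then show ?case
    using s(2) insert.hyps(1) by (simp add: p'_def q'_def p_def q_def \<theta>_def \<eta>_def mult.commute)
qed

text \<open>The case S = I of the preceding lemma: all exponentials have become indicators, so the
  two laws agree on boxes, which generate the product sigma-algebra and are closed under
  intersection.\<close>

lemma char_eq_imp_distr_PiM_eq:
  fixes X :: "'i \<Rightarrow> 'a \<Rightarrow> real" and Y :: "'i \<Rightarrow> 'b \<Rightarrow> real"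
  assumes M: "prob_space M" "\<And>i. X i \<in> borel_measurable M"
    and N: "prob_space N" "\<And>i. Y i \<in> borel_measurable N"
    and I: "finite I"
    and eq: "\<And>u. (\<integral>\<omega>. iexp (\<Sum>i\<in>I. u i * X i \<omega>) \<partial>M) = (\<integral>\<omega>. iexp (\<Sum>i\<in>I. u i * Y i \<omega>) \<partial>N)"
  shows "distr M (PiM I (\<lambda>_. borel)) (\<lambda>\<omega>. \<lambda>i\<in>I. X i \<omega>) = distr N (PiM I (\<lambda>_. borel)) (\<lambda>\<omega>. \<lambda>i\<in>I. Y i \<omega>)"
proof -
  interpret M: prob_space M by (rule M(1))
  interpret N: prob_space N by (rule N(1))
  note [measurable] = M(2) N(2)
  let ?P = "distr M (PiM I (\<lambda>_. borel)) (\<lambda>\<omega>. \<lambda>i\<in>I. X i \<omega>)"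
  let ?Q = "distr N (PiM I (\<lambda>_. borel)) (\<lambda>\<omega>. \<lambda>i\<in>I. Y i \<omega>)"
  \<comment> \<open>The empty exponent over I - I is kept so that the expression matches
    \<open>char_eq_imp_indicator_eq\<close> with S = I and zero frequencies.\<close>
  have box: "emeasure (distr M' (PiM I (\<lambda>_. borel)) (\<lambda>\<omega>. \<lambda>i\<in>I. Z i \<omega>)) (Pi\<^sub>E I A)
      = ennreal (Re (\<integral>\<omega>. (\<Prod>i\<in>I. indicator (A i) (Z i \<omega>)) *\<^sub>R iexp (\<Sum>i\<in>I - I. 0 * Z i \<omega>) \<partial>M'))"
    if "prob_space M'" and [measurable]: "\<And>i. Z i \<in> borel_measurable M'" and A [measurable]:
        "\<And>i. A i \<in> sets borel"
    for M' :: "'c measure" and Z :: "'i \<Rightarrow> 'c \<Rightarrow> real" and A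
  proof -
    interpret M': prob_space M' by (rule that(1))
    let ?E = "(\<lambda>\<omega>. \<lambda>i\<in>I. Z i \<omega>) -` Pi\<^sub>E I A \<inter> space M'"
    have "?E \<in> sets M'"
      by (rule measurable_sets[where A = "PiM I (\<lambda>_. borel)"]) (use I A in \<open>auto intro!: sets_PiM_I_finite\<close>)
    moreover have "(\<Prod>i\<in>I. indicat_real (A i) (Z i \<omega>)) = indicat_real ?E \<omega>" if "\<omega> \<in> space M'" for \<omega>
    proof (cases "\<forall>i\<in>I. Z i \<omega> \<in> A i")
      case True
      then show ?thesis using that by (auto simp: indicator_def PiE_def)
    next
      case False
      then have "(\<Prod>i\<in>I. indicat_real (A i) (Z i \<omega>)) = 0"
        using I by (force simp: prod_zero_iff indicator_def)
      then show ?thesis using False by (auto simp: indicator_def)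
    qed
    ultimately have "(\<integral>\<omega>. (\<Prod>i\<in>I. indicator (A i) (Z i \<omega>)) *\<^sub>R iexp (\<Sum>i\<in>I - I. 0 * Z i \<omega>) \<partial>M')
        = complex_of_real (measure M' ?E)"
      by (simp add: scaleR_conv_of_real cong: Bochner_Integration.integral_cong)
    then show ?thesis
      using I A by (simp add: emeasure_distr M'.emeasure_eq_measure sets_PiM_I_finite)
  qed
  show ?thesis
  proof (rule measure_eqI_PiM_finite[where I = I and M = "\<lambda>_. borel"])
    fix A :: "'i \<Rightarrow> real set" assume "\<And>i. i \<in> I \<Longrightarrow> A i \<in> sets borel"
    \<comment> \<open>Outside I the given sets are unconstrained. They are replaced by the empty
      set, which \<open>Pi\<^sub>E I\<close> does not see, to have measurable sets at every
      index.\<close>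
    then have A: "(if i \<in> I then A i else {}) \<in> sets borel" for i by auto
    have PiE: "Pi\<^sub>E I A = Pi\<^sub>E I (\<lambda>i. if i \<in> I then A i else {})"
      by (auto simp: PiE_def Pi_def)
    show "emeasure ?P (Pi\<^sub>E I A) = emeasure ?Q (Pi\<^sub>E I A)"
      unfolding PiE box[OF M A] box[OF N A]
      using char_eq_imp_indicator_eq[where A = "\<lambda>i. if i \<in> I then A i else {}" and S = I and u = "\<lambda>_. 0",
          OF M N I A eq order_refl] by simp
  next
    show "range (\<lambda>_ :: nat. space (PiM I (\<lambda>_. borel :: real measure))) \<subseteq> prod_algebra I (\<lambda>_. borel)"
      unfolding space_PiM by (auto intro!: prod_algebraI_finite I)
    show "emeasure ?P (space (PiM I (\<lambda>_. borel))) \<noteq> \<infinity>"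
      by (subst emeasure_distr) auto
  qed (use I in auto)
qed

text \<open>The vectors are flattened to real coordinates indexed by J x Basis; the law of the
  vectors is the image of the law of the coordinates under reassembly.\<close>

lemma fdd_eq_charI:
  fixes X :: "'i \<Rightarrow> 'a \<Rightarrow> 'v::euclidean_space" and Y :: "'i \<Rightarrow> 'b \<Rightarrow> 'v"
  assumes M: "prob_space M" "\<And>i. X i \<in> borel_measurable M"
    and N: "prob_space N" "\<And>i. Y i \<in> borel_measurable N"
    and eq: "\<And>J c. finite J \<Longrightarrow>
      (\<integral>\<omega>. iexp (\<Sum>t\<in>J. c t \<bullet> X t \<omega>) \<partial>M) = (\<integral>\<omega>. iexp (\<Sum>t\<in>J. c t \<bullet> Y t \<omega>) \<partial>N)"
  shows "fdd_eq M X N Y"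
  unfolding fdd_eq_def
proof (intro conjI allI impI M N)
  note [measurable] = M(2) N(2)
  fix J :: "'i set" assume J: "finite J"
  let ?I = "J \<times> (Basis :: 'v set)"
  have comb: "(\<Sum>i\<in>?I. u i * (Z (fst i) \<bullet> snd i)) = (\<Sum>t\<in>J. (\<Sum>b\<in>Basis. u (t, b) *\<^sub>R b) \<bullet> Z t)"
    for u and Z :: "'i \<Rightarrow> 'v"
    using J by (simp add: sum.cartesian_product' inner_sum_right inner_commute)
  let ?P = "PiM ?I (\<lambda>_. borel :: real measure)"
  let ?f = "\<lambda>x. \<lambda>t\<in>J. \<Sum>b\<in>Basis. x (t, b) *\<^sub>R b :: 'v"
  have f [measurable]: "?f \<in> measurable ?P (PiM J (\<lambda>_. borel))"
  proof (rule measurable_restrict)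
    fix t assume "t \<in> J"
    then have "(\<lambda>x. x (t, b)) \<in> borel_measurable ?P" if "b \<in> Basis" for b
      using that by (intro measurable_component_singleton) auto
    then show "(\<lambda>x. \<Sum>b\<in>Basis. x (t, b) *\<^sub>R b :: 'v) \<in> borel_measurable ?P"
      by (intro borel_measurable_sum borel_measurable_scaleR) auto
  qed
  have f_eq: "?f (\<lambda>i\<in>?I. Z (fst i) \<bullet> snd i) = (\<lambda>t\<in>J. Z t)" for Z :: "'i \<Rightarrow> 'v"
  proof (rule ext)
    fix t
    have "(\<Sum>b\<in>Basis. (\<lambda>i\<in>?I. Z (fst i) \<bullet> snd i) (t, b) *\<^sub>R b) = (\<Sum>b\<in>Basis. (Z t \<bullet> b) *\<^sub>R b)" if "t \<in> J"
      using that by (intro sum.cong) auto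
    then show "?f (\<lambda>i\<in>?I. Z (fst i) \<bullet> snd i) t = (\<lambda>t\<in>J. Z t) t"
      by (simp add: euclidean_representation)
  qed
  have mX: "(\<lambda>\<omega>. \<lambda>i\<in>?I. X (fst i) \<omega> \<bullet> snd i) \<in> measurable M ?P"
    and mY: "(\<lambda>\<omega>. \<lambda>i\<in>?I. Y (fst i) \<omega> \<bullet> snd i) \<in> measurable N ?P"
    by measurable
  have "(\<integral>\<omega>. iexp (\<Sum>i\<in>?I. u i * (X (fst i) \<omega> \<bullet> snd i)) \<partial>M)
      = (\<integral>\<omega>. iexp (\<Sum>i\<in>?I. u i * (Y (fst i) \<omega> \<bullet> snd i)) \<partial>N)" for u
    unfolding comb[of u "\<lambda>t. X t _"] comb[of u "\<lambda>t. Y t _"] by (rule eq[OF J])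
  then have "distr M ?P (\<lambda>\<omega>. \<lambda>i\<in>?I. X (fst i) \<omega> \<bullet> snd i) = distr N ?P (\<lambda>\<omega>. \<lambda>i\<in>?I. Y (fst i) \<omega> \<bullet> snd i)"
    using J by (intro char_eq_imp_distr_PiM_eq M(1) N(1)) simp_all
  then have "distr (distr M ?P (\<lambda>\<omega>. \<lambda>i\<in>?I. X (fst i) \<omega> \<bullet> snd i)) (PiM J (\<lambda>_. borel)) ?f
      = distr (distr N ?P (\<lambda>\<omega>. \<lambda>i\<in>?I. Y (fst i) \<omega> \<bullet> snd i)) (PiM J (\<lambda>_. borel)) ?f"
    by simp
  then show "distr M (PiM J (\<lambda>_. borel)) (\<lambda>\<omega>. \<lambda>t\<in>J. X t \<omega>) = distr N (PiM J (\<lambda>_. borel)) (\<lambda>\<omega>. \<lambda>t\<in>J. Y t \<omega>)"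
    unfolding distr_distr[OF f mX] distr_distr[OF f mY] o_def f_eq[of "\<lambda>t. X t _"] f_eq[of "\<lambda>t. Y t _"] .
qed


section \<open>Gaussian processes and their closed linear span\<close>

lemma square_integrable_rv_coordinates:
  fixes X :: "'a \<Rightarrow> 'v::euclidean_space"
  assumes "\<And>b. b \<in> Basis \<Longrightarrow> square_integrable_rv M (\<lambda>\<omega>. b \<bullet> X \<omega>)"
  shows "square_integrable_rv M X"
proof -
  have "square_integrable_rv M (\<lambda>\<omega>. \<Sum>b\<in>Basis. (b \<bullet> X \<omega>) *\<^sub>R b)"
    by (intro square_integrable_rv_sum square_integrable_rv_linear[OF bounded_linear_scaleR_left] assms)
  then show ?thesis
    by (simp add: inner_commute[of _ "X _"] euclidean_representation)
qed

lemma square_integrable_rv_inner: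
  "square_integrable_rv M X \<Longrightarrow> square_integrable_rv M (\<lambda>\<omega>. c \<bullet> X \<omega>)"
  by (rule square_integrable_rv_linear) (simp add: bounded_linear_inner_right)

lemma (in prob_space) gaussian_rv_square_integrable:
  assumes "gaussian_rv M V"
  shows "square_integrable_rv M V"
proof -
  have [measurable]: "V \<in> borel_measurable M"
    using assms by (simp add: gaussian_rv_def)
  consider (normal) \<mu> \<sigma> where "\<sigma> > 0" "distributed M lborel V (normal_density \<mu> \<sigma>)"
    | (point) \<mu> where "AE \<omega> in M. V \<omega> = \<mu>"
    using assms by (auto simp: gaussian_rv_def)
  then show ?thesis
  proof cases
    case normal
    have "integrable lborel (\<lambda>x. normal_density \<mu> \<sigma> x * (x - \<mu>) ^ 2)"
      using integrable_normal_moment[OF normal(1)] by simp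
    then have "integrable M (\<lambda>\<omega>. (V \<omega> - \<mu>)\<^sup>2)"
      by (subst (asm) distributed_integrable[OF normal(2)]) auto
    then have "square_integrable_rv M (\<lambda>\<omega>. V \<omega> - \<mu>)"
      by (simp add: square_integrable_rv_def)
    from square_integrable_rv_add[OF this, of "\<lambda>_. \<mu>"] show ?thesis
      by (simp add: square_integrable_rv_def)
  next
    case point
    have "integrable M (\<lambda>\<omega>. (norm (V \<omega>))\<^sup>2) \<longleftrightarrow> integrable M (\<lambda>\<omega>. \<mu>\<^sup>2)"
      using point by (intro integrable_cong_AE) auto
    then show ?thesis by (simp add: square_integrable_rv_def)
  qed
qed

text \<open>At mean 0 a point mass has variance 0, so both kinds of Gaussian law obey one formula.
  Frequency 1 is enough because linear combinations absorb the frequency.\<close>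

lemma (in prob_space) gaussian_rv_char:
  assumes "gaussian_rv M V" and mean: "expectation V = 0"
  shows "expectation (\<lambda>\<omega>. iexp (V \<omega>)) = exp (- (ms_norm M V)\<^sup>2 / 2)"
proof -
  have [measurable]: "V \<in> borel_measurable M"
    using assms by (simp add: gaussian_rv_def)
  consider (normal) \<mu> \<sigma> where "\<sigma> > 0" "distributed M lborel V (normal_density \<mu> \<sigma>)"
    | (point) \<mu> where "AE \<omega> in M. V \<omega> = \<mu>"
    using assms by (auto simp: gaussian_rv_def)
  then show ?thesis
  proof cases
    case normal
    have "\<mu> = 0"
      using normal_distributed_expectation[OF normal] mean by simp
    then have \<sigma>: "(ms_norm M V)\<^sup>2 = \<sigma>\<^sup>2"
      using normal_distributed_variance[OF normal] mean by (simp add: ms_norm_square)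
    have "distributed M lborel (\<lambda>\<omega>. V \<omega> / \<sigma>) std_normal_density"
      using normal normal_standard_normal_convert[OF normal(1), of V \<mu>] \<open>\<mu> = 0\<close> by simp
    then have d: "distr M lborel (\<lambda>\<omega>. V \<omega> / \<sigma>) = std_normal_distribution"
      by (simp add: distributed_def)
    have "expectation (\<lambda>\<omega>. iexp (V \<omega>)) = expectation (\<lambda>\<omega>. iexp (\<sigma> * (V \<omega> / \<sigma>)))"
      using normal(1) by simp
    also have "\<dots> = char (distr M lborel (\<lambda>\<omega>. V \<omega> / \<sigma>)) \<sigma>"
      unfolding char_def by (subst integral_distr) auto
    finally show ?thesis
      unfolding d char_std_normal_distribution \<sigma> by simp
  next
    case point
    have "expectation V = expectation (\<lambda>_. \<mu>)"
      using point by (intro integral_cong_AE) auto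
    then have 0: "AE \<omega> in M. V \<omega> = 0"
      using mean point by (simp add: prob_space)
    then have "expectation (\<lambda>\<omega>. iexp (V \<omega>)) = expectation (\<lambda>_. 1)"
      by (intro integral_cong_AE) auto
    moreover have "expectation (\<lambda>\<omega>. (V \<omega>)\<^sup>2) = expectation (\<lambda>_. 0)"
      using 0 by (intro integral_cong_AE) auto
    ultimately show ?thesis
      by (simp add: ms_norm_square prob_space)
  qed
qed

lemma (in prob_space) gaussian_process_square_integrable:
  fixes X :: "'i \<Rightarrow> 'a \<Rightarrow> 'v::euclidean_space"
  assumes "gaussian_process M T X" "t \<in> T"
  shows "square_integrable_rv M (X t)"
proof (rule square_integrable_rv_coordinates)
  fix b :: 'v assume "b \<in> Basis"
  have "\<forall>J c. finite J \<and> J \<subseteq> T \<longrightarrow> gaussian_rv M (\<lambda>\<omega>. \<Sum>s\<in>J. c s \<bullet> X s \<omega>)"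
    using assms(1) by (simp add: gaussian_process_def)
  from this[rule_format, of "{t}" "\<lambda>_. b"] assms(2)
  show "square_integrable_rv M (\<lambda>\<omega>. b \<bullet> X t \<omega>)"
    using gaussian_rv_square_integrable by simp
qed

section \<open>The Gaussian Hilbert space of a process\<close>

definition linear_functionals ::
    "('i \<Rightarrow> 'a \<Rightarrow> 'v::euclidean_space) \<Rightarrow> ('a \<Rightarrow> real) set" where
  "linear_functionals X = {V. \<exists>J c. finite J \<and> V = (\<lambda>\<omega>. \<Sum>t\<in>J. c t \<bullet> X t \<omega>)}"

text \<open>For a centered Gaussian process this is its first-order Gaussian Hilbert space, as a set
  of functions rather than of almost sure classes. Variables defined by mean-square limits lie in it
  without being finite combinations.\<close>

definition closed_linear_span ::
    "'a measure \<Rightarrow> ('i \<Rightarrow> 'a \<Rightarrow> 'v::euclidean_space) \<Rightarrow> ('a \<Rightarrow> real) set" where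
  "closed_linear_span M X = {V. square_integrable_rv M V \<and>
     (\<exists>Vn. (\<forall>n::nat. Vn n \<in> linear_functionals X) \<and> (\<lambda>n. ms_norm M (\<lambda>\<omega>. V \<omega> - Vn n \<omega>)) \<longlonglongrightarrow> 0)}"

lemma linear_functionals_component: "(\<lambda>\<omega>. c \<bullet> X t \<omega>) \<in> linear_functionals X"
  unfolding linear_functionals_def by (intro CollectI exI[of _ "{t}"] exI[of _ "\<lambda>_. c"]) simp

lemma linear_functionals_add:
  assumes "V \<in> linear_functionals X" "V' \<in> linear_functionals X"
  shows "(\<lambda>\<omega>. V \<omega> + V' \<omega>) \<in> linear_functionals X"
proof -
  obtain J c J' c' where J: "finite J" "V = (\<lambda>\<omega>. \<Sum>t\<in>J. c t \<bullet> X t \<omega>)"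
    and J': "finite J'" "V' = (\<lambda>\<omega>. \<Sum>t\<in>J'. c' t \<bullet> X t \<omega>)"
    using assms by (auto simp: linear_functionals_def)
  have 1: "V \<omega> = (\<Sum>t\<in>J \<union> J'. (if t \<in> J then c t else 0) \<bullet> X t \<omega>)" for \<omega>
    unfolding J(2) using J(1) J'(1) by (intro sum.mono_neutral_cong_left) auto
  have 2: "V' \<omega> = (\<Sum>t\<in>J \<union> J'. (if t \<in> J' then c' t else 0) \<bullet> X t \<omega>)" for \<omega>
    unfolding J'(2) using J(1) J'(1) by (intro sum.mono_neutral_cong_left) auto
  have "(\<lambda>\<omega>. V \<omega> + V' \<omega>) = (\<lambda>\<omega>. \<Sum>t\<in>J \<union> J'. ((if t \<in> J then c t else 0) + (if t
      \<in> J' then c' t else 0)) \<bullet> X t \<omega>)"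
    unfolding 1 2 inner_add_left sum.distrib ..
  moreover have "finite (J \<union> J')"
    using J(1) J'(1) by simp
  ultimately show ?thesis
    unfolding linear_functionals_def by (intro CollectI exI conjI) assumption+
qed

lemma linear_functionals_sum:
  assumes "\<And>i. i \<in> I \<Longrightarrow> V i \<in> linear_functionals X"
  shows "(\<lambda>\<omega>. \<Sum>i\<in>I. V i \<omega>) \<in> linear_functionals X"
proof -
  have "(\<lambda>\<omega>. 0) \<in> linear_functionals X"
    unfolding linear_functionals_def by (intro CollectI exI[of _ "{}"]) simp
  then show ?thesis
    using assms by (induction I rule: infinite_finite_induct) (auto intro: linear_functionals_add)
qed

lemma linear_functionals_square_integrable:
  assumes "\<And>t. square_integrable_rv M (X t)" "V \<in> linear_functionals X"
  shows "square_integrable_rv M V"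
  using assms by (auto simp: linear_functionals_def intro!: square_integrable_rv_sum
      square_integrable_rv_inner)

lemma closed_linear_span_square_integrable:
  "V \<in> closed_linear_span M X \<Longrightarrow> square_integrable_rv M V"
  by (simp add: closed_linear_span_def)

lemma closed_linear_span_add:
  assumes X: "\<And>t. square_integrable_rv M (X t)"
    and V: "V \<in> closed_linear_span M X" and W: "W \<in> closed_linear_span M X"
  shows "(\<lambda>\<omega>. V \<omega> + W \<omega>) \<in> closed_linear_span M X"
proof -
  obtain Vn Wn where Vn: "\<And>n::nat. Vn n \<in> linear_functionals X" "(\<lambda>n. ms_norm M (\<lambda>\<omega>. V \<omega> - Vn n \<omega>)) \<longlonglongrightarrow> 0"
    and Wn: "\<And>n::nat. Wn n \<in> linear_functionals X" "(\<lambda>n. ms_norm M (\<lambda>\<omega>. W \<omega> - Wn n \<omega>)) \<longlonglongrightarrow> 0"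
    using V W by (auto simp: closed_linear_span_def)
  note sq = closed_linear_span_square_integrable[OF V] closed_linear_span_square_integrable[OF W]
    linear_functionals_square_integrable[OF X Vn(1)] linear_functionals_square_integrable[OF X Wn(1)]
  have "ms_norm M (\<lambda>\<omega>. V \<omega> + W \<omega> - (Vn n \<omega> + Wn n \<omega>)) \<le>
      ms_norm M (\<lambda>\<omega>. V \<omega> - Vn n \<omega>) + ms_norm M (\<lambda>\<omega>. W \<omega> - Wn n \<omega>)" for n
    using ms_norm_triangle[OF square_integrable_rv_diff[OF sq(1) sq(3)[of n]]
        square_integrable_rv_diff[OF sq(2) sq(4)[of n]]]
    by (simp add: algebra_simps)
  then have le: "\<forall>\<^sub>F n in sequentially. ms_norm M (\<lambda>\<omega>. V \<omega> + W \<omega> - (Vn n \<omega> + Wn n \<omega>)) \<le>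
      ms_norm M (\<lambda>\<omega>. V \<omega> - Vn n \<omega>) + ms_norm M (\<lambda>\<omega>. W \<omega> - Wn n \<omega>)"
    by (intro always_eventually allI)
  have "(\<lambda>n. ms_norm M (\<lambda>\<omega>. V \<omega> + W \<omega> - (Vn n \<omega> + Wn n \<omega>))) \<longlonglongrightarrow> 0"
    using tendsto_add[OF Vn(2) Wn(2)]
    by (intro tendsto_sandwich[OF _ le tendsto_const[of 0]]) simp_all
  then show ?thesis
    unfolding closed_linear_span_def
    using square_integrable_rv_add[OF sq(1,2)] linear_functionals_add[OF Vn(1) Wn(1)]
    by (intro CollectI conjI exI[of _ "\<lambda>n \<omega>. Vn n \<omega> + Wn n \<omega>"]) auto
qed

lemma closed_linear_span_zero: "(\<lambda>\<omega>. 0) \<in> closed_linear_span M X"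
proof -
  have "(\<lambda>\<omega>. 0) \<in> linear_functionals X"
    unfolding linear_functionals_def by (intro CollectI exI[of _ "{}"]) simp
  then show ?thesis
    unfolding closed_linear_span_def by (auto intro!: exI[of _ "\<lambda>_ \<omega>. 0"] simp: ms_norm_def)
qed

lemma closed_linear_span_sum:
  assumes "\<And>t. square_integrable_rv M (X t)" "\<And>i. i \<in> I \<Longrightarrow> V i \<in> closed_linear_span M X"
  shows "(\<lambda>\<omega>. \<Sum>i\<in>I. V i \<omega>) \<in> closed_linear_span M X"
  using assms(2)
  by (induction I rule: infinite_finite_induct) (auto intro: closed_linear_span_add assms(1)
      closed_linear_span_zero)

text \<open>The limit is not shown to satisfy \<open>gaussian_rv\<close>; the formula for the
  characteristic function is all that is used later. It is preserved because exp(ix) is 1-Lipschitz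
  in x and mean-square norms converge.\<close>

lemma (in prob_space) char_gaussian_limit:
  assumes V: "square_integrable_rv M V" and Vn: "\<And>n::nat. square_integrable_rv M (Vn n)"
    and lim: "(\<lambda>n. ms_norm M (\<lambda>\<omega>. V \<omega> - Vn n \<omega>)) \<longlonglongrightarrow> 0"
    and char: "\<And>n. expectation (\<lambda>\<omega>. iexp (Vn n \<omega>)) = exp (- (ms_norm M (Vn n))\<^sup>2 / 2)"
  shows "expectation (\<lambda>\<omega>. iexp (V \<omega>)) = exp (- (ms_norm M V)\<^sup>2 / 2)"
proof (rule LIMSEQ_unique)
  note [measurable] = square_integrable_rvD(1)[OF V] square_integrable_rvD(1)[OF Vn]
  have lip: "norm (iexp a - iexp b) \<le> \<bar>a - b\<bar>" for a b :: real
  proof -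
    have "iexp a - iexp b = iexp b * (iexp (a - b) - 1)"
      by (simp add: algebra_simps flip: exp_add)
    then show ?thesis
      using iexp_approx1[of "a - b" 0] by (simp add: norm_mult)
  qed
  have "norm (expectation (\<lambda>\<omega>. iexp (Vn n \<omega>)) - expectation (\<lambda>\<omega>. iexp (V \<omega>)))
      \<le> ms_norm M (\<lambda>\<omega>. V \<omega> - Vn n \<omega>)" for n
  proof -
    note d = square_integrable_rv_diff[OF V Vn[of n]]
    have "expectation (\<lambda>\<omega>. iexp (Vn n \<omega>)) - expectation (\<lambda>\<omega>. iexp (V \<omega>))
        = expectation (\<lambda>\<omega>. iexp (Vn n \<omega>) - iexp (V \<omega>))"
      by (intro Bochner_Integration.integral_diff[symmetric] integrable_iexp) auto
    also have "norm \<dots> \<le> expectation (\<lambda>\<omega>. norm (V \<omega> - Vn n \<omega>))"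
      using integral_norm_le_ms_norm(1)[OF d]
      by (intro norm_integral_le) (auto simp: norm_minus_commute[of
          "iexp (Vn n _)"] lip simp del: of_real_mult)
    also have "\<dots> \<le> ms_norm M (\<lambda>\<omega>. V \<omega> - Vn n \<omega>)"
      by (rule integral_norm_le_ms_norm(2)[OF d])
    finally show ?thesis .
  qed
  then show "(\<lambda>n. expectation (\<lambda>\<omega>. iexp (Vn n \<omega>))) \<longlonglongrightarrow> expectation (\<lambda>\<omega>. iexp (V \<omega>))"
    by (intro LIM_zero_cancel[OF Lim_null_comparison[OF always_eventually lim]]) auto
  have "(\<lambda>n. (ms_norm M (Vn n))\<^sup>2) \<longlonglongrightarrow> (ms_norm M V)\<^sup>2"
    using bilinear_integral_tendsto[OF bounded_bilinear_inner Vn V Vn V lim lim]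
    unfolding ms_norm_square by (simp add: power2_eq_square)
  then show "(\<lambda>n. expectation (\<lambda>\<omega>. iexp (Vn n \<omega>))) \<longlonglongrightarrow> exp (- (ms_norm M V)\<^sup>2 / 2)"
    unfolding char
    by (intro tendsto_of_real tendsto_exp tendsto_divide tendsto_minus tendsto_const) (assumption, simp)
qed

lemma (in prob_space) closed_linear_span_char:
  assumes X: "gaussian_process M UNIV X" "\<And>t. expectation (X t) = 0"
    and V: "V \<in> closed_linear_span M X"
  shows "expectation (\<lambda>\<omega>. iexp (V \<omega>)) = exp (- (ms_norm M V)\<^sup>2 / 2)"
proof -
  have sq: "square_integrable_rv M (X t)" for t
    using gaussian_process_square_integrable[OF X(1)] by simp
  obtain Vn where Vn: "\<And>n::nat. Vn n \<in> linear_functionals X" "(\<lambda>n. ms_norm M (\<lambda>\<omega>. V \<omega> - Vn n \<omega>)) \<longlonglongrightarrow> 0"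
    using V by (auto simp: closed_linear_span_def)
  have char: "expectation (\<lambda>\<omega>. iexp (W \<omega>)) = exp (- (ms_norm M W)\<^sup>2 / 2)" if W: "W
      \<in> linear_functionals X" for W
  proof (rule gaussian_rv_char)
    obtain J c where J: "finite J" "W = (\<lambda>\<omega>. \<Sum>t\<in>J. c t \<bullet> X t \<omega>)"
      using W by (auto simp: linear_functionals_def)
    then show "gaussian_rv M W"
      using X(1) by (auto simp: gaussian_process_def)
    show "expectation W = 0"
      unfolding J(2) using integral_norm_le_ms_norm(1)[OF sq] X(2)
      by (subst Bochner_Integration.integral_sum) auto
  qed
  show ?thesis
    by (rule char_gaussian_limit[OF closed_linear_span_square_integrable[OF V]
          linear_functionals_square_integrable[OF sq Vn(1)] Vn(2) char[OF Vn(1)]])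
qed

text \<open>The variance of a finite linear combination is a double sum of covariances, and in the
  closed span of a centered Gaussian process the variance determines the characteristic
  function.\<close>

lemma (in prob_space) fdd_eq_gaussianI:
  fixes Y :: "'i \<Rightarrow> 'a \<Rightarrow> 'v::euclidean_space" and Z :: "'i \<Rightarrow> 'a \<Rightarrow> 'v"
  assumes X: "gaussian_process M UNIV X" "\<And>t. expectation (X t) = 0"
    and Y: "\<And>t. Y t \<in> borel_measurable M" "\<And>t c. (\<lambda>\<omega>. c \<bullet> Y t \<omega>) \<in> closed_linear_span M X"
    and Z: "\<And>t. Z t \<in> borel_measurable M" "\<And>t c. (\<lambda>\<omega>. c \<bullet> Z t \<omega>) \<in> closed_linear_span M X"
    and cov: "\<And>s t c d. expectation (\<lambda>\<omega>. (c \<bullet> Y s \<omega>) * (d \<bullet> Y t \<omega>))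
        = expectation (\<lambda>\<omega>. (c \<bullet> Z s \<omega>) * (d \<bullet> Z t \<omega>))"
  shows "fdd_eq M Y M Z"
proof (rule fdd_eq_charI[OF prob_space_axioms Y(1) prob_space_axioms Z(1)])
  fix J :: "'i set" and c assume J: "finite J"
  have sq: "square_integrable_rv M (X t)" for t
    using gaussian_process_square_integrable[OF X(1)] by simp
  have ms: "(ms_norm M (\<lambda>\<omega>. \<Sum>t\<in>J. c t \<bullet> U t \<omega>))\<^sup>2
      = (\<Sum>s\<in>J. \<Sum>t\<in>J. expectation (\<lambda>\<omega>. (c s \<bullet> U s \<omega>) * (c t \<bullet> U t \<omega>)))"
    if "\<And>t c. (\<lambda>\<omega>. c \<bullet> U t \<omega>) \<in> closed_linear_span M X" for U :: "'i \<Rightarrow> 'a \<Rightarrow> 'v"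
  proof -
    have "integrable M (\<lambda>\<omega>. (c s \<bullet> U s \<omega>) * (c t \<bullet> U t \<omega>))" for s t
      using inner_integrable[OF closed_linear_span_square_integrable[OF that]
          closed_linear_span_square_integrable[OF that]]
      by simp
    then show ?thesis
      unfolding ms_norm_square by (simp add: power2_eq_square sum_product)
  qed
  show "expectation (\<lambda>\<omega>. iexp (\<Sum>t\<in>J. c t \<bullet> Y t \<omega>)) = expectation (\<lambda>\<omega>. iexp (\<Sum>t\<in>J. c t \<bullet> Z t \<omega>))"
    unfolding closed_linear_span_char[OF X closed_linear_span_sum[OF sq Y(2)]]
      closed_linear_span_char[OF X closed_linear_span_sum[OF sq Z(2)]] ms[OF Y(2)] ms[OF Z(2)] cov ..
qed


section \<open>Mean-square integrals\<close>

text \<open>For step functions the exchange of expectation and time integral is an exchange with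
  finite sums; the general case is a limit of this one.\<close>

lemma ms_step_pairing:
  assumes E: "\<And>l. l < m \<Longrightarrow> E l \<in> finite_borel_sets" and Z: "\<And>l. l < m \<Longrightarrow> square_integrable_rv M (Z l)"
    and V: "square_integrable_rv M V"
  shows "integrable lborel (\<lambda>z. \<integral>\<omega>. (\<Sum>l<m. indicator (E l) z *\<^sub>R Z l \<omega>) \<bullet> V \<omega> \<partial>M)"
    and "(\<integral>\<omega>. (\<Sum>l<m. measure lborel (E l) *\<^sub>R Z l \<omega>) \<bullet> V \<omega> \<partial>M) =
      (\<integral>z. (\<integral>\<omega>. (\<Sum>l<m. indicator (E l) z *\<^sub>R Z l \<omega>) \<bullet> V \<omega> \<partial>M) \<partial>lborel)"
proof -
  have eq: "(\<integral>\<omega>. (\<Sum>l<m. c l *\<^sub>R Z l \<omega>) \<bullet> V \<omega> \<partial>M) = (\<Sum>l<m. c l * (\<integral>\<omega>. Z l \<omega> \<bullet> V \<omega> \<partial>M))" for c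
    using Z V by (simp add: inner_sum_left inner_integrable)
  have ind: "integrable lborel (\<lambda>z. indicator (E l) z * (\<integral>\<omega>. Z l \<omega> \<bullet> V \<omega> \<partial>M))"
    "(\<integral>z. indicator (E l) z * (\<integral>\<omega>. Z l \<omega> \<bullet> V \<omega> \<partial>M) \<partial>lborel) = measure lborel (E l) * (\<integral>\<omega>. Z l \<omega> \<bullet> V \<omega> \<partial>M)"
    if "l < m" for l
    using E[OF that] by (auto simp: finite_borel_sets_def)
  show "integrable lborel (\<lambda>z. \<integral>\<omega>. (\<Sum>l<m. indicator (E l) z *\<^sub>R Z l \<omega>) \<bullet> V \<omega> \<partial>M)"
    unfolding eq using ind(1) by auto
  show "(\<integral>\<omega>. (\<Sum>l<m. measure lborel (E l) *\<^sub>R Z l \<omega>) \<bullet> V \<omega> \<partial>M) =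
      (\<integral>z. (\<integral>\<omega>. (\<Sum>l<m. indicator (E l) z *\<^sub>R Z l \<omega>) \<bullet> V \<omega> \<partial>M) \<partial>lborel)"
    unfolding eq using ind by (subst Bochner_Integration.integral_sum) auto
qed

lemma square_integrable_rv_step:
  assumes "\<And>l. l < m \<Longrightarrow> square_integrable_rv M (Z l)"
  shows "square_integrable_rv M (\<lambda>\<omega>. \<Sum>l<m. c l *\<^sub>R Z l \<omega>)"
  using assms by (intro square_integrable_rv_sum square_integrable_rv_scaleR) auto

text \<open>The mean-square integral is also a weak integral; this gives its uniqueness, its mean and
  its covariances.\<close>

lemma has_ms_integral_pairing:
  assumes f: "has_ms_integral M f Y" and V: "square_integrable_rv M V"
    and [measurable]: "(\<lambda>z. \<integral>\<omega>. f z \<omega> \<bullet> V \<omega> \<partial>M) \<in> borel_measurable borel"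
  shows "integrable lborel (\<lambda>z. \<integral>\<omega>. f z \<omega> \<bullet> V \<omega> \<partial>M)"
    and "(\<integral>\<omega>. Y \<omega> \<bullet> V \<omega> \<partial>M) = (\<integral>z. (\<integral>\<omega>. f z \<omega> \<bullet> V \<omega> \<partial>M) \<partial>lborel)"
proof -
  have sq: "\<And>z. square_integrable_rv M (f z)" "square_integrable_rv M Y"
    using f by (auto simp: has_ms_integral_def)
  obtain m :: "nat \<Rightarrow> nat" and E Z where E: "\<And>i l. l < m i \<Longrightarrow> E i l \<in> finite_borel_sets"
    and Z: "\<And>i l. l < m i \<Longrightarrow> square_integrable_rv M (Z i l)"
    and meas [measurable]: "\<And>i. (\<lambda>z. ms_norm M (\<lambda>\<omega>. f z \<omega>
        - (\<Sum>l<m i. indicator (E i l) z *\<^sub>R Z i l \<omega>))) \<in> borel_measurable borel"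
    and lim: "(\<lambda>i. \<integral>\<^sup>+ z. ennreal (ms_norm M (\<lambda>\<omega>. f z \<omega>
        - (\<Sum>l<m i. indicator (E i l) z *\<^sub>R Z i l \<omega>))) \<partial>lborel) \<longlonglongrightarrow> 0"
    and limY: "(\<lambda>i. ms_norm M (\<lambda>\<omega>. Y \<omega> - (\<Sum>l<m i. measure lborel (E i l) *\<^sub>R Z i l \<omega>))) \<longlonglongrightarrow> 0"
    using f unfolding has_ms_integral_def by (elim conjE exE) (rule that; simp only: simp_thms)
  define S where "S i z \<omega> = (\<Sum>l<m i. indicator (E i l) z *\<^sub>R Z i l \<omega>)" for i z \<omega>
  define T where "T i \<omega> = (\<Sum>l<m i. measure lborel (E i l) *\<^sub>R Z i l \<omega>)" for i \<omega>
  define g where "g i z = ms_norm M (\<lambda>\<omega>. f z \<omega> - S i z \<omega>)" for i z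
  have [measurable]: "g i \<in> borel_measurable borel" for i
    unfolding g_def S_def by (rule meas)
  have gnn: "0 \<le> g i z" for i z
    by (simp add: g_def)
  have sqS: "square_integrable_rv M (S i z)" "square_integrable_rv M (T i)" for i z
    unfolding S_def[abs_def] T_def[abs_def] by (rule square_integrable_rv_step[OF Z]; assumption)+
  have SV: "integrable lborel (\<lambda>z. \<integral>\<omega>. S i z \<omega> \<bullet> V \<omega> \<partial>M)"
    "(\<integral>\<omega>. T i \<omega> \<bullet> V \<omega> \<partial>M) = (\<integral>z. (\<integral>\<omega>. S i z \<omega> \<bullet> V \<omega> \<partial>M) \<partial>lborel)" for i
    unfolding S_def T_def
    by (rule ms_step_pairing[where E = "E i" and Z = "Z i" and m = "m i", OF E Z V]; assumption)+
  have diff: "\<bar>(\<integral>\<omega>. f z \<omega> \<bullet> V \<omega> \<partial>M) - (\<integral>\<omega>. S i z \<omega> \<bullet> V \<omega> \<partial>M)\<bar> \<le> g i z * ms_norm M V" for i z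
  proof -
    have "(\<integral>\<omega>. f z \<omega> \<bullet> V \<omega> \<partial>M) - (\<integral>\<omega>. S i z \<omega> \<bullet> V \<omega> \<partial>M) = (\<integral>\<omega>. (f z \<omega> - S i z \<omega>) \<bullet> V \<omega> \<partial>M)"
      using inner_integrable[OF sq(1) V, of z] inner_integrable[OF sqS(1) V, of i z]
      by (simp add: inner_diff_left)
    then show ?thesis
      unfolding g_def using inner_integral_le[OF square_integrable_rv_diff[OF sq(1) sqS(1)] V] by simp
  qed
  have lim_g: "(\<lambda>i. \<integral>\<^sup>+ z. ennreal (g i z) \<partial>lborel) \<longlonglongrightarrow> 0"
    using lim by (simp add: g_def S_def)
  \<comment> \<open>The L^1 errors may be infinite for finitely many i, so integrability of
    \<open>g i\<close> is only available eventually.\<close>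
  have ev: "\<forall>\<^sub>F i in sequentially. integrable lborel (g i)"
    using order_tendstoD(2)[OF lim_g zero_less_one]
  proof eventually_elim
    case (elim i)
    moreover have "norm (g i z) = g i z" for z
      by (simp add: g_def)
    ultimately have "(\<integral>\<^sup>+ z. ennreal (norm (g i z)) \<partial>lborel) < 1"
      by simp
    then have "(\<integral>\<^sup>+ z. ennreal (norm (g i z)) \<partial>lborel) < \<infinity>"
      by (rule order.strict_trans) simp
    then show ?case
      by (simp add: integrable_iff_bounded)
  qed
  then obtain i where i: "integrable lborel (g i)"
    by (auto dest: eventually_happens)
  \<comment> \<open>One approximant with integrable error suffices: the pairing is that of the step
    function plus a difference dominated by the error.\<close>
  have "integrable lborel (\<lambda>z. ((\<integral>\<omega>. f z \<omega> \<bullet> V \<omega> \<partial>M) - (\<integral>\<omega>. S i z \<omega> \<bullet> V \<omega> \<partial>M)) + (\<integral>\<omega>. S i z \<omega> \<bullet> V \<omega> \<partial>M))"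
  proof (rule Bochner_Integration.integrable_add[OF Bochner_Integration.integrable_bound SV(1)])
    show "integrable lborel (\<lambda>z. g i z * ms_norm M V)"
      using i by simp
    show "(\<lambda>z. (\<integral>\<omega>. f z \<omega> \<bullet> V \<omega> \<partial>M) - (\<integral>\<omega>. S i z \<omega> \<bullet> V \<omega> \<partial>M)) \<in> borel_measurable lborel"
      using borel_measurable_integrable[OF SV(1)] by simp
    show "AE z in lborel. norm ((\<integral>\<omega>. f z \<omega> \<bullet> V \<omega> \<partial>M) - (\<integral>\<omega>. S i z \<omega> \<bullet> V \<omega> \<partial>M)) \<le> norm (g i z * ms_norm M V)"
      using diff[of _ i] by (intro AE_I2) (simp add: g_def)
  qed
  then show int: "integrable lborel (\<lambda>z. \<integral>\<omega>. f z \<omega> \<bullet> V \<omega> \<partial>M)"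
    by simp
  have g_lim: "(\<lambda>i. \<integral>z. g i z \<partial>lborel) \<longlonglongrightarrow> 0"
  proof -
    have "\<forall>\<^sub>F i in sequentially. (\<integral>\<^sup>+ z. ennreal (g i z) \<partial>lborel) = ennreal (\<integral>z. g i z \<partial>lborel)"
      using ev by eventually_elim (intro nn_integral_eq_integral AE_I2, simp_all add: gnn)
    from Lim_transform_eventually[OF lim_g this] have "(\<lambda>i. ennreal (\<integral>z. g i z \<partial>lborel)) \<longlonglongrightarrow> ennreal 0"
      by simp
    then show ?thesis
      by (subst (asm) tendsto_ennreal_iff) (auto simp: gnn)
  qed
  have "(\<lambda>i. \<integral>\<omega>. T i \<omega> \<bullet> V \<omega> \<partial>M) \<longlonglongrightarrow> (\<integral>z. (\<integral>\<omega>. f z \<omega> \<bullet> V \<omega> \<partial>M) \<partial>lborel)"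
  proof (rule LIM_zero_cancel, rule Lim_null_comparison)
    show "(\<lambda>i. (\<integral>z. g i z \<partial>lborel) * ms_norm M V) \<longlonglongrightarrow> 0"
      using tendsto_mult_right[OF g_lim, of "ms_norm M V"] by (simp add: mult.commute)
    show "\<forall>\<^sub>F i in sequentially. norm ((\<integral>\<omega>. T i \<omega> \<bullet> V \<omega> \<partial>M) - (\<integral>z. (\<integral>\<omega>. f z \<omega> \<bullet> V \<omega> \<partial>M) \<partial>lborel))
        \<le> (\<integral>z. g i z \<partial>lborel) * ms_norm M V"
      using ev
    proof eventually_elim
      case (elim i)
      have "(\<integral>\<omega>. T i \<omega> \<bullet> V \<omega> \<partial>M) - (\<integral>z. (\<integral>\<omega>. f z \<omega> \<bullet> V \<omega> \<partial>M) \<partial>lborel)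
          = (\<integral>z. (\<integral>\<omega>. S i z \<omega> \<bullet> V \<omega> \<partial>M) - (\<integral>\<omega>. f z \<omega> \<bullet> V \<omega> \<partial>M) \<partial>lborel)"
        unfolding SV(2) by (rule Bochner_Integration.integral_diff[OF SV(1) int, symmetric])
      also have "norm \<dots> \<le> (\<integral>z. g i z * ms_norm M V \<partial>lborel)"
        using elim diff by (intro norm_integral_le) (auto simp: abs_minus_commute)
      finally show ?case by simp
    qed
  qed
  moreover have "(\<lambda>i. \<integral>\<omega>. T i \<omega> \<bullet> V \<omega> \<partial>M) \<longlonglongrightarrow> (\<integral>\<omega>. Y \<omega> \<bullet> V \<omega> \<partial>M)"
    using limY by (intro bilinear_integral_tendsto[OF bounded_bilinear_inner] sq sqS V)
        (auto simp: T_def ms_norm_def)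
  ultimately show "(\<integral>\<omega>. Y \<omega> \<bullet> V \<omega> \<partial>M) = (\<integral>z. (\<integral>\<omega>. f z \<omega> \<bullet> V \<omega> \<partial>M) \<partial>lborel)"
    by (rule LIMSEQ_unique[rotated])
qed

text \<open>Joint continuity of the covariance is mean-square continuity of the process. The scalar
  covariance, which is the trace of the matrix one, suffices because only mean-square norms of
  differences enter.\<close>

locale ms_continuous_process = prob_space M
  for M :: "'a measure" and X :: "real \<Rightarrow> 'a \<Rightarrow> 'v::euclidean_space" +
  assumes sq: "\<And>t. square_integrable_rv M (X t)"
    and cov_continuous: "continuous_on UNIV (\<lambda>(s, t). expectation (\<lambda>\<omega>. X s \<omega> \<bullet> X t \<omega>))"
begin

definition cov :: "real \<Rightarrow> real \<Rightarrow> real" where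
  "cov s t = expectation (\<lambda>\<omega>. X s \<omega> \<bullet> X t \<omega>)"

lemma cov_tendsto:
  assumes "(f \<longlongrightarrow> s) F" "(g \<longlongrightarrow> t) F"
  shows "((\<lambda>x. cov (f x) (g x)) \<longlongrightarrow> cov s t) F"
proof -
  have "continuous (at (s, t)) (\<lambda>(s, t). cov s t)"
    using cov_continuous by (simp add: continuous_on_eq_continuous_at cov_def)
  from isCont_tendsto_compose[OF this tendsto_Pair[OF assms]] show ?thesis
    by simp
qed

lemma cov_measurable [measurable]:
  "f \<in> borel_measurable N \<Longrightarrow> g \<in> borel_measurable N \<Longrightarrow> (\<lambda>x. cov (f x) (g x)) \<in> borel_measurable N"
  by (rule borel_measurable_continuous_Pair[where H = cov])
    (use cov_continuous in \<open>auto simp: cov_def case_prod_beta\<close>)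

text \<open>Writes the error of a sampling approximation in terms of \<open>cov\<close>, which makes
  it a measurable function of the time and gives its pointwise convergence.\<close>

lemma ms_norm_diff_eq:
  "ms_norm M (\<lambda>\<omega>. c *\<^sub>R X s \<omega> - d *\<^sub>R X t \<omega>) = sqrt (c\<^sup>2 * cov s s - 2 * c * d * cov s t + d\<^sup>2 * cov t t)"
proof -
  have "(norm (c *\<^sub>R X s \<omega> - d *\<^sub>R X t \<omega>))\<^sup>2 =
      c\<^sup>2 * (X s \<omega> \<bullet> X s \<omega>) - 2 * c * d * (X s \<omega> \<bullet> X t \<omega>) + d\<^sup>2 * (X t \<omega> \<bullet> X t \<omega>)" for \<omega>
    unfolding power2_norm_eq_inner
    by (simp add: inner_diff_left inner_diff_right inner_commute power2_eq_square algebra_simps)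
  then show ?thesis
    unfolding ms_norm_def cov_def using inner_integrable[OF sq sq] by simp
qed

lemma ms_norm_X: "ms_norm M (X t) = sqrt (cov t t)"
  using ms_norm_diff_eq[of 1 t 0 t] by simp

text \<open>Pairings with an arbitrary V, not only with values of X, are continuous by
  Cauchy-Schwarz; this supplies the measurability that the weak integral requires.\<close>

lemma pairing_continuous:
  assumes V: "square_integrable_rv M V"
  shows "continuous_on UNIV (\<lambda>z. expectation (\<lambda>\<omega>. X z \<omega> \<bullet> V \<omega>))"
  unfolding continuous_on_def
proof safe
  fix z
  have "((\<lambda>w. sqrt (1\<^sup>2 * cov w w - 2 * 1 * 1 * cov w z + 1\<^sup>2 * cov z z)) \<longlongrightarrow>
      sqrt (1\<^sup>2 * cov z z - 2 * 1 * 1 * cov z z + 1\<^sup>2 * cov z z)) (at z within UNIV)"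
    by (intro tendsto_intros cov_tendsto)
  then have lim: "((\<lambda>w. ms_norm M (\<lambda>\<omega>. X w \<omega> - X z \<omega>) * ms_norm M V) \<longlongrightarrow> 0) (at z within UNIV)"
    using ms_norm_diff_eq[of 1 _ 1 z] by (auto intro: tendsto_mult_left_zero)
  show "((\<lambda>z. expectation (\<lambda>\<omega>. X z \<omega> \<bullet> V \<omega>)) \<longlongrightarrow> expectation (\<lambda>\<omega>. X z \<omega> \<bullet> V \<omega>)) (at z within UNIV)"
  proof (rule LIM_zero_cancel, rule Lim_null_comparison[OF always_eventually lim], rule allI)
    fix w
    have "expectation (\<lambda>\<omega>. X w \<omega> \<bullet> V \<omega>) - expectation (\<lambda>\<omega>. X z \<omega> \<bullet> V \<omega>)
        = expectation (\<lambda>\<omega>. (X w \<omega> - X z \<omega>) \<bullet> V \<omega>)"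
      using inner_integrable[OF sq V] by (simp add: inner_diff_left)
    then show "norm (expectation (\<lambda>\<omega>. X w \<omega> \<bullet> V \<omega>) - expectation (\<lambda>\<omega>. X z \<omega> \<bullet> V \<omega>))
        \<le> ms_norm M (\<lambda>\<omega>. X w \<omega> - X z \<omega>) * ms_norm M V"
      using inner_integral_le[OF square_integrable_rv_diff[OF sq sq] V] by simp
  qed
qed

lemma weighted_pairing:
  assumes Y: "has_ms_integral M (\<lambda>z \<omega>. \<psi> z *\<^sub>R X z \<omega>) Y" and V: "square_integrable_rv M V"
    and [measurable]: "\<psi> \<in> borel_measurable borel"
  shows "integrable lborel (\<lambda>z. \<psi> z * expectation (\<lambda>\<omega>. X z \<omega> \<bullet> V \<omega>))"
    and "expectation (\<lambda>\<omega>. Y \<omega> \<bullet> V \<omega>) = (\<integral>z. \<psi> z * expectation (\<lambda>\<omega>. X z \<omega> \<bullet> V \<omega>) \<partial>lborel)"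
proof -
  have [measurable]: "(\<lambda>z. expectation (\<lambda>\<omega>. X z \<omega> \<bullet> V \<omega>)) \<in> borel_measurable borel"
    by (rule borel_measurable_continuous_onI[OF pairing_continuous[OF V]])
  have "(\<lambda>z. expectation (\<lambda>\<omega>. (\<psi> z *\<^sub>R X z \<omega>) \<bullet> V \<omega>)) \<in> borel_measurable borel"
    by simp
  from has_ms_integral_pairing[OF Y V this]
  show "integrable lborel (\<lambda>z. \<psi> z * expectation (\<lambda>\<omega>. X z \<omega> \<bullet> V \<omega>))"
    "expectation (\<lambda>\<omega>. Y \<omega> \<bullet> V \<omega>) = (\<integral>z. \<psi> z * expectation (\<lambda>\<omega>. X z \<omega> \<bullet> V \<omega>) \<partial>lborel)"
    by simp_all
qed

text \<open>Both candidates have the same pairing with every square-integrable V; the choice V = Y -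
  Y' gives mean-square distance 0.\<close>

lemma weighted_ms_integral_unique:
  assumes Y: "has_ms_integral M (\<lambda>z \<omega>. \<psi> z *\<^sub>R X z \<omega>) Y" and Y':
      "has_ms_integral M (\<lambda>z \<omega>. \<psi> z *\<^sub>R X z \<omega>) Y'"
    and \<psi>: "\<psi> \<in> borel_measurable borel"
  shows "AE \<omega> in M. Y \<omega> = Y' \<omega>"
proof -
  have sqY: "square_integrable_rv M Y" "square_integrable_rv M Y'"
    using Y Y' by (auto simp: has_ms_integral_def)
  note d = square_integrable_rv_diff[OF sqY]
  have "(ms_norm M (\<lambda>\<omega>. Y \<omega> - Y' \<omega>))\<^sup>2 =
      expectation (\<lambda>\<omega>. Y \<omega> \<bullet> (Y \<omega> - Y' \<omega>)) - expectation (\<lambda>\<omega>. Y' \<omega> \<bullet> (Y \<omega> - Y' \<omega>))"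
    unfolding ms_norm_square power2_norm_eq_inner
    using inner_integrable[OF sqY(1) d] inner_integrable[OF sqY(2) d] by (simp add: inner_diff_left)
  also have "\<dots> = 0"
    unfolding weighted_pairing(2)[OF Y d \<psi>] weighted_pairing(2)[OF Y' d \<psi>] by simp
  finally show ?thesis
    using ms_norm_eq_0_iff[OF d] by simp
qed

text \<open>The approximants are \<open>s n z *\<^sub>R X (\<tau> n z)\<close>: \<psi> is replaced
  by a simple function and the time by the nearest grid point to the left, so that for each n only
  finitely many random variables occur on the bounded support.\<close>

lemma weighted_ms_integral_exists:
  assumes \<psi>: "integrable lborel \<psi>" and supp: "\<And>z. z \<notin> {a..b} \<Longrightarrow> \<psi> z = 0"
  obtains Y where "has_ms_integral M (\<lambda>z \<omega>. \<psi> z *\<^sub>R X z \<omega>) Y"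
    "\<And>c. (\<lambda>\<omega>. c \<bullet> Y \<omega>) \<in> closed_linear_span M X"
proof -
  have [measurable]: "\<psi> \<in> borel_measurable borel"
    using \<psi> by auto
  obtain s where s: "\<And>i. simple_function borel (s i)" "\<And>z. (\<lambda>i. s i z) \<longlonglongrightarrow> \<psi> z"
    "\<And>i z. \<bar>s i z\<bar> \<le> 2 * \<bar>\<psi> z\<bar>"
    using borel_measurable_implies_sequence_metric[OF \<open>\<psi> \<in> borel_measurable borel\<close>, of 0] by auto
  have [measurable]: "s i \<in> borel_measurable borel" for i
    using s(1) by (rule borel_measurable_simple_function)
  have s0: "s i z = 0" if "z \<notin> {a..b}" for i z
    using s(3)[of i z] supp[OF that] by simp
  \<comment> \<open>\<kappa> numbers the cells of a grid of mesh 1/(n+1), and \<tau> is the left end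
    of the cell of z.\<close>
  define \<kappa> where "\<kappa> n z = \<lfloor>real (Suc n) * z\<rfloor>" for n :: nat and z :: real
  define \<tau> where "\<tau> n z = real_of_int (\<kappa> n z) / real (Suc n)" for n z
  have \<tau>: "z - inverse (real (Suc n)) \<le> \<tau> n z" "\<tau> n z \<le> z" for n z
  proof -
    have \<kappa>: "real (Suc n) * z - 1 \<le> real_of_int (\<kappa> n z)" "real_of_int (\<kappa> n z) \<le> real (Suc n) * z"
      unfolding \<kappa>_def by linarith+
    from divide_right_mono[OF \<kappa>(1), of "real (Suc n)"] show "z - inverse (real (Suc n)) \<le> \<tau> n z"
      by (simp add: \<tau>_def diff_divide_distrib inverse_eq_divide del: of_nat_Suc)
    from divide_right_mono[OF \<kappa>(2), of "real (Suc n)"] show "\<tau> n z \<le> z"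
      by (simp add: \<tau>_def del: of_nat_Suc)
  qed
  have \<tau>_lim: "(\<lambda>n. \<tau> n z) \<longlonglongrightarrow> z" for z
  proof (rule tendsto_sandwich[OF _ _ _ tendsto_const])
    show "(\<lambda>n. z - inverse (real (Suc n))) \<longlonglongrightarrow> z"
      using tendsto_diff[OF tendsto_const LIMSEQ_inverse_real_of_nat, of z] by simp
  qed (use \<tau> in auto)
  have [measurable]: "\<tau> n \<in> borel_measurable borel" "\<kappa> n \<in> measurable borel (count_space UNIV)" for n
    unfolding \<tau>_def \<kappa>_def by measurable
  \<comment> \<open>The pairs of a value of \<open>s n\<close> and a cell index; on the level set
    \<open>E n p\<close> the approximant is the fixed random variable \<open>Z n p\<close>.\<close>
  define P where "P n = (\<lambda>z. (s n z, \<kappa> n z)) ` {a..b}" for n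
  define E where "E n p = {z\<in>{a..b}. s n z = fst p \<and> \<kappa> n z = snd p}" for n p
  define Z where "Z n p \<omega> = fst p *\<^sub>R X (real_of_int (snd p) / real (Suc n)) \<omega>" for n and p ::
      "real \<times> int" and \<omega>
  have finP: "finite (P n)" for n
  proof (rule finite_subset)
    have "\<kappa> n ` {a..b} \<subseteq> {\<kappa> n a..\<kappa> n b}"
      unfolding \<kappa>_def by (auto intro!: floor_mono mult_left_mono)
    then show "P n \<subseteq> range (s n) \<times> {\<kappa> n a..\<kappa> n b}"
      by (auto simp: P_def)
    show "finite (range (s n) \<times> {\<kappa> n a..\<kappa> n b})"
      using s(1)[of n] by (auto simp: simple_function_def)
  qed
  have E: "E n p \<in> finite_borel_sets" for n p
  proof -
    have "E n p \<in> sets borel"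
      unfolding E_def by measurable
    moreover have "emeasure lborel (E n p) \<le> emeasure lborel {a..b}"
      by (rule emeasure_mono) (auto simp: E_def)
    ultimately show ?thesis
      by (auto simp: finite_borel_sets_def emeasure_lborel_Icc_eq intro: order.strict_trans1 split:
          if_splits)
  qed
  have sqZ: "square_integrable_rv M (Z n p)" for n p
    unfolding Z_def[abs_def] by (intro square_integrable_rv_scaleR sq)
  have step: "(\<Sum>p\<in>P n. indicator (E n p) z *\<^sub>R Z n p \<omega>) = s n z *\<^sub>R X (\<tau> n z) \<omega>" for n z \<omega>
  proof (cases "z \<in> {a..b}")
    case True
    have "(\<Sum>p\<in>P n. indicator (E n p) z *\<^sub>R Z n p \<omega>)
        = (\<Sum>p\<in>{(s n z, \<kappa> n z)}. indicator (E n p) z *\<^sub>R Z n p \<omega>)"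
      using True finP by (intro sum.mono_neutral_right) (auto simp: P_def E_def indicator_def)
    then show ?thesis
      using True by (simp add: E_def Z_def \<tau>_def)
  next
    case False
    then show ?thesis
      using s0[OF False] by (auto simp: E_def)
  qed
  \<comment> \<open>\<open>has_ms_integral\<close> numbers its summands by an initial segment of the
    naturals, so the finite set \<open>P n\<close> is enumerated.\<close>
  have "\<forall>n. \<exists>h. bij_betw h {..<card (P n)} (P n)"
    using finP by (auto simp: ex_bij_betw_nat_finite lessThan_atLeast0)
  then obtain h where h: "\<And>n. bij_betw (h n) {..<card (P n)} (P n)"
    by metis
  define T where "T n \<omega> = (\<Sum>l<card (P n). measure lborel (E n (h n l)) *\<^sub>R Z n (h n l) \<omega>)" for n \<omega>
  have step': "(\<Sum>l<card (P n). indicator (E n (h n l)) z *\<^sub>R Z n (h n l) \<omega>)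
      = s n z *\<^sub>R X (\<tau> n z) \<omega>" for n z \<omega>
    unfolding step[symmetric] using h[of n] by (rule sum.reindex_bij_betw)
  have sqT: "square_integrable_rv M (T n)" for n
    unfolding T_def[abs_def] by (rule square_integrable_rv_step[OF sqZ])
  define g where "g n z = ms_norm M (\<lambda>\<omega>. \<psi> z *\<^sub>R X z \<omega> - s n z *\<^sub>R X (\<tau> n z) \<omega>)" for n z
  have g_eq: "g n z = sqrt ((\<psi> z)\<^sup>2 * cov z z - 2 * \<psi> z * s n z * cov z (\<tau> n z)
      + (s n z)\<^sup>2 * cov (\<tau> n z) (\<tau> n z))" for n z
    unfolding g_def ms_norm_diff_eq ..
  have [measurable]: "g n \<in> borel_measurable borel" for n
    unfolding g_eq[abs_def] by measurable
  have g_lim: "(\<lambda>n. g n z) \<longlonglongrightarrow> 0" for z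
  proof -
    have "(\<lambda>n. g n z) \<longlonglongrightarrow> sqrt ((\<psi> z)\<^sup>2 * cov z z - 2 * \<psi> z * \<psi> z * cov z z + (\<psi> z)\<^sup>2 * cov z z)"
      unfolding g_eq by (intro tendsto_intros cov_tendsto s(2) \<tau>_lim)
    then show ?thesis by (simp add: power2_eq_square)
  qed
  \<comment> \<open>The interval starts at a - 1 because the left grid point of z may lie up to 1
    before a.\<close>
  have "compact ((\<lambda>t. sqrt (cov t t)) ` {a - 1..b})"
    by (intro compact_continuous_image compact_Icc continuous_on_real_sqrt)
      (auto simp: continuous_on_def intro!: cov_tendsto tendsto_ident_at)
  from compact_imp_bounded[OF this] obtain C0 where "\<forall>t\<in>{a - 1..b}. \<bar>sqrt (cov t t)\<bar> \<le> C0"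
    unfolding bounded_iff by auto
  then have C0: "\<bar>sqrt (cov t t)\<bar> \<le> C0" if "t \<in> {a - 1..b}" for t
    using that by blast
  define C where "C = max 0 C0"
  have C: "ms_norm M (X t) \<le> C" if "t \<in> {a - 1..b}" for t
    using C0[OF that] by (simp add: ms_norm_X C_def)
  have "C \<ge> 0" by (simp add: C_def)
  \<comment> \<open>3 = 1 + 2: one C for the term with \<psi> itself and two for the simple
    function, which is bounded by twice the absolute value of \<psi>.\<close>
  have g_le: "g n z \<le> 3 * C * \<bar>\<psi> z\<bar>" for n z
  proof (cases "z \<in> {a..b}")
    case True
    have "inverse (real (Suc n)) \<le> 1"
      by (simp add: inverse_le_1_iff)
    then have t: "z \<in> {a - 1..b}" "\<tau> n z \<in> {a - 1..b}"
      using \<tau>(1)[of z n] \<tau>(2)[of n z] True by auto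
    have "g n z \<le> ms_norm M (\<lambda>\<omega>. \<psi> z *\<^sub>R X z \<omega>) + ms_norm M (\<lambda>\<omega>. (- s n z) *\<^sub>R X (\<tau> n z) \<omega>)"
      using ms_norm_triangle[OF square_integrable_rv_scaleR[where c = "\<psi> z", OF sq[of z]]
          square_integrable_rv_scaleR[where c = "- s n z", OF sq[of "\<tau> n z"]]]
      by (simp add: g_def)
    also have "\<dots> = \<bar>\<psi> z\<bar> * ms_norm M (X z) + \<bar>s n z\<bar> * ms_norm M (X (\<tau> n z))"
      unfolding ms_norm_scaleR by simp
    also have "\<dots> \<le> \<bar>\<psi> z\<bar> * C + (2 * \<bar>\<psi> z\<bar>) * C"
      by (intro add_mono mult_mono C t s(3)) auto
    finally show ?thesis by (simp add: algebra_simps)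
  next
    case False
    then show ?thesis
      using supp[OF False] s0[OF False] by (simp add: g_eq)
  qed
  have gnn: "0 \<le> g n z" for n z
    by (simp add: g_def)
  have int_g: "integrable lborel (g n)" for n
  proof (rule Bochner_Integration.integrable_bound)
    show "integrable lborel (\<lambda>z. 3 * C * \<bar>\<psi> z\<bar>)"
      using \<psi> by (intro integrable_mult_right integrable_abs)
    show "AE z in lborel. norm (g n z) \<le> norm (3 * C * \<bar>\<psi> z\<bar>)"
      using g_le gnn \<open>C \<ge> 0\<close> by (intro AE_I2) (simp add: abs_mult)
  qed simp
  have g_int_lim: "(\<lambda>n. \<integral>z. g n z \<partial>lborel) \<longlonglongrightarrow> 0"
  proof -
    have "(\<lambda>n. \<integral>z. g n z \<partial>lborel) \<longlonglongrightarrow> (\<integral>z. 0 \<partial>(lborel :: real measure))"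
    proof (rule integral_dominated_convergence[where s = g and w = "\<lambda>z. 3 * C * \<bar>\<psi> z\<bar>"])
      show "integrable lborel (\<lambda>z. 3 * C * \<bar>\<psi> z\<bar>)"
        using \<psi> by (intro integrable_mult_right integrable_abs)
      show "AE z in lborel. norm (g n z) \<le> 3 * C * \<bar>\<psi> z\<bar>" for n
        using g_le gnn by (intro AE_I2) simp
    qed (use g_lim in auto)
    then show ?thesis by simp
  qed
  have g_nn_lim: "(\<lambda>n. \<integral>\<^sup>+z. ennreal (g n z) \<partial>lborel) \<longlonglongrightarrow> 0"
  proof -
    have "(\<integral>\<^sup>+z. ennreal (g n z) \<partial>lborel) = ennreal (\<integral>z. g n z \<partial>lborel)" for n
      using int_g gnn by (intro nn_integral_eq_integral) auto
    then show ?thesis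
      using tendsto_ennrealI[OF g_int_lim] by simp
  qed
  \<comment> \<open>The difference of two integrals is paired with itself: its squared norm is at
    most the integral of the two errors times the norm, and one factor of the norm cancels. This
    stands in for a triangle inequality for integrals with values in L^2(M).\<close>
  have T_diff: "ms_norm M (\<lambda>\<omega>. T n \<omega> - T k \<omega>) \<le> (\<integral>z. g n z \<partial>lborel) + (\<integral>z. g k z \<partial>lborel)" for n k
  proof -
    let ?D = "\<lambda>\<omega>. T n \<omega> - T k \<omega>"
    let ?S = "\<lambda>n z \<omega>. s n z *\<^sub>R X (\<tau> n z) \<omega>"
    note sqD = square_integrable_rv_diff[OF sqT[of n] sqT[of k]]
    have sqS: "square_integrable_rv M (?S n z)" for n z
      by (intro square_integrable_rv_scaleR sq)
    have TD: "integrable lborel (\<lambda>z. expectation (\<lambda>\<omega>. ?S n z \<omega> \<bullet> ?D \<omega>))"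
      "expectation (\<lambda>\<omega>. T n \<omega> \<bullet> ?D \<omega>) = (\<integral>z. expectation (\<lambda>\<omega>. ?S n z \<omega> \<bullet> ?D \<omega>) \<partial>lborel)" for n
      using ms_step_pairing[where E = "\<lambda>l. E n (h n l)" and m = "card (P n)" and Z
          = "\<lambda>l. Z n (h n l)", OF E sqZ sqD]
      unfolding step' T_def[symmetric] by simp_all
    have "(ms_norm M ?D)\<^sup>2 = expectation (\<lambda>\<omega>. T n \<omega> \<bullet> ?D \<omega>) - expectation (\<lambda>\<omega>. T k \<omega> \<bullet> ?D \<omega>)"
      unfolding ms_norm_square power2_norm_eq_inner
      using inner_integrable[OF sqT sqD] by (simp add: inner_diff_left)
    also have "\<dots> = (\<integral>z. expectation (\<lambda>\<omega>. ?S n z \<omega> \<bullet> ?D \<omega>) - expectation (\<lambda>\<omega>. ?S k z \<omega> \<bullet> ?D \<omega>) \<partial>lborel)"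
      unfolding TD(2) by (rule Bochner_Integration.integral_diff[OF TD(1) TD(1), symmetric])
    also have "\<dots> \<le> (\<integral>z. (g n z + g k z) * ms_norm M ?D \<partial>lborel)"
    proof (rule integral_mono)
      fix z
      have "expectation (\<lambda>\<omega>. ?S n z \<omega> \<bullet> ?D \<omega>) - expectation (\<lambda>\<omega>. ?S k z \<omega> \<bullet> ?D \<omega>)
          = expectation (\<lambda>\<omega>. (?S n z \<omega> - ?S k z \<omega>) \<bullet> ?D \<omega>)"
        using inner_integrable[OF sqS sqD] by (simp add: inner_diff_left)
      also have "\<dots> \<le> ms_norm M (\<lambda>\<omega>. ?S n z \<omega> - ?S k z \<omega>) * ms_norm M ?D"
        using inner_integral_le[OF square_integrable_rv_diff[OF sqS sqS] sqD] by (rule abs_le_D1)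
      also have "\<dots> \<le> (g n z + g k z) * ms_norm M ?D"
      proof (rule mult_right_mono)
        show "ms_norm M (\<lambda>\<omega>. ?S n z \<omega> - ?S k z \<omega>) \<le> g n z + g k z"
          using ms_norm_triangle_diff[OF sqS[of n z] square_integrable_rv_scaleR[where c
              = "\<psi> z", OF sq[of z]] sqS[of k z]]
          by (simp add: g_def ms_norm_minus_commute[of M "?S n z"])
      qed simp
      finally show "expectation (\<lambda>\<omega>. ?S n z \<omega> \<bullet> ?D \<omega>) - expectation (\<lambda>\<omega>. ?S k z \<omega> \<bullet> ?D \<omega>)
          \<le> (g n z + g k z) * ms_norm M ?D" .
    qed (use int_g TD(1) in \<open>auto intro!: Bochner_Integration.integrable_diff\<close>)
    also have "\<dots> = ((\<integral>z. g n z \<partial>lborel) + (\<integral>z. g k z \<partial>lborel)) * ms_norm M ?D"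
      using int_g by simp
    finally have le: "ms_norm M ?D * ms_norm M ?D
        \<le> ((\<integral>z. g n z \<partial>lborel) + (\<integral>z. g k z \<partial>lborel)) * ms_norm M ?D"
      by (simp add: power2_eq_square)
    have "0 \<le> (\<integral>z. g n z \<partial>lborel) + (\<integral>z. g k z \<partial>lborel)"
      using gnn by simp
    then show ?thesis
      using le by (cases "ms_norm M ?D = 0") (auto simp: less_le)
  qed
  obtain Y where Y: "square_integrable_rv M Y" "(\<lambda>n. ms_norm M (\<lambda>\<omega>. Y \<omega> - T n \<omega>)) \<longlonglongrightarrow> 0"
  proof (rule ms_complete[OF sqT])
    fix e :: real assume "e > 0"
    then obtain N where N: "\<And>n. n \<ge> N \<Longrightarrow> (\<integral>z. g n z \<partial>lborel) < e / 2"
      using order_tendstoD(2)[OF g_int_lim, of "e / 2"] by (auto simp: eventually_sequentially)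
    have "ms_norm M (\<lambda>\<omega>. T n \<omega> - T k \<omega>) < e" if "n \<ge> N" "k \<ge> N" for n k
      using T_diff[of n k] N[OF that(1)] N[OF that(2)] by linarith
    then show "\<exists>N. \<forall>m\<ge>N. \<forall>n\<ge>N. ms_norm M (\<lambda>\<omega>. T m \<omega> - T n \<omega>) < e"
      by blast
  qed
  show ?thesis
  proof (rule that)
    show "has_ms_integral M (\<lambda>z \<omega>. \<psi> z *\<^sub>R X z \<omega>) Y"
      unfolding has_ms_integral_def
    proof (intro conjI allI exI)
      show "square_integrable_rv M (\<lambda>\<omega>. \<psi> z *\<^sub>R X z \<omega>)" for z
        by (intro square_integrable_rv_scaleR sq)
      show "square_integrable_rv M Y" by fact
      show "l < card (P i) \<longrightarrow> E i (h i l) \<in> finite_borel_sets \<and> square_integrable_rv M (Z i (h i l))" for i l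
        using E sqZ by simp
      show "(\<lambda>z. ms_norm M (\<lambda>\<omega>. \<psi> z *\<^sub>R X z \<omega>
          - (\<Sum>l<card (P i). indicator (E i (h i l)) z *\<^sub>R Z i (h i l) \<omega>)))
          \<in> borel_measurable borel" for i
        unfolding step' g_def[symmetric] by measurable
      show "(\<lambda>i. \<integral>\<^sup>+ z. ennreal (ms_norm M (\<lambda>\<omega>. \<psi> z *\<^sub>R X z \<omega> -
          (\<Sum>l<card (P i). indicator (E i (h i l)) z *\<^sub>R Z i (h i l) \<omega>))) \<partial>lborel) \<longlonglongrightarrow> 0"
        unfolding step' g_def[symmetric] by (rule g_nn_lim)
      show "(\<lambda>i. ms_norm M (\<lambda>\<omega>. Y \<omega> - (\<Sum>l<card (P i). measure lborel (E i (h i l)) *\<^sub>R Z i (h i l) \<omega>))) \<longlonglongrightarrow> 0"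
        unfolding T_def[symmetric] by (rule Y(2))
    qed
    fix c
    show "(\<lambda>\<omega>. c \<bullet> Y \<omega>) \<in> closed_linear_span M X"
      unfolding closed_linear_span_def
    proof (intro CollectI conjI exI allI)
      show "square_integrable_rv M (\<lambda>\<omega>. c \<bullet> Y \<omega>)"
        using Y(1) by (rule square_integrable_rv_inner)
      show "(\<lambda>\<omega>. c \<bullet> T n \<omega>) \<in> linear_functionals X" for n
      proof -
        have eq: "(\<lambda>\<omega>. c \<bullet> T n \<omega>) = (\<lambda>\<omega>. \<Sum>l<card (P n).
            ((measure lborel (E n (h n l)) * fst (h n l)) *\<^sub>R c) \<bullet>
            X (real_of_int (snd (h n l)) / real (Suc n)) \<omega>)"
          by (simp add: T_def Z_def inner_sum_right mult.assoc)
        show ?thesis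
          unfolding eq by (rule linear_functionals_sum, rule linear_functionals_component)
      qed
      show "(\<lambda>n. ms_norm M (\<lambda>\<omega>. c \<bullet> Y \<omega> - c \<bullet> T n \<omega>)) \<longlonglongrightarrow> 0"
      proof (rule Lim_null_comparison[OF always_eventually])
        show "(\<lambda>n. norm c * ms_norm M (\<lambda>\<omega>. Y \<omega> - T n \<omega>)) \<longlonglongrightarrow> 0"
          using tendsto_mult_right_zero[OF Y(2)] .
        show "\<forall>n. norm (ms_norm M (\<lambda>\<omega>. c \<bullet> Y \<omega> - c \<bullet> T n \<omega>)) \<le> norm c * ms_norm M (\<lambda>\<omega>. Y \<omega> - T n \<omega>)"
        proof
          fix n
          note d = square_integrable_rv_diff[OF Y(1) sqT[of n]]
          have "(ms_norm M (\<lambda>\<omega>. c \<bullet> (Y \<omega> - T n \<omega>)))\<^sup>2 \<le> (norm c * ms_norm M (\<lambda>\<omega>. Y \<omega> - T n \<omega>))\<^sup>2"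
            unfolding ms_norm_square power_mult_distrib integral_mult_right_zero[symmetric]
          proof (rule integral_mono)
            show "integrable M (\<lambda>\<omega>. (norm (c \<bullet> (Y \<omega> - T n \<omega>)))\<^sup>2)"
              using square_integrable_rv_inner[OF d] by (simp add: square_integrable_rv_def)
            show "integrable M (\<lambda>\<omega>. (norm c)\<^sup>2 * (norm (Y \<omega> - T n \<omega>))\<^sup>2)"
              using d by (simp add: square_integrable_rv_def)
            show "(norm (c \<bullet> (Y \<omega> - T n \<omega>)))\<^sup>2 \<le> (norm c)\<^sup>2 * (norm (Y \<omega> - T n \<omega>))\<^sup>2" for \<omega>
              using power_mono[OF Cauchy_Schwarz_ineq2[of c "Y \<omega> - T n \<omega>"], of 2]
              by (simp add: power_mult_distrib)
          qed
          then have "ms_norm M (\<lambda>\<omega>. c \<bullet> (Y \<omega> - T n \<omega>)) \<le> norm c * ms_norm M (\<lambda>\<omega>. Y \<omega> - T n \<omega>)"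
            by (rule power2_le_imp_le) simp
          then show "norm (ms_norm M (\<lambda>\<omega>. c \<bullet> Y \<omega> - c \<bullet> T n \<omega>)) \<le> norm c * ms_norm M (\<lambda>\<omega>. Y \<omega> - T n \<omega>)"
            by (simp add: inner_diff_right)
        qed
      qed
    qed
  qed
qed

end


section \<open>The isometry of the Wiener integral\<close>

lemma matrix_mult_component: "(P ** Q) $ i $ j = (\<Sum>k\<in>UNIV. P $ i $ k * Q $ k $ j)"
  by (simp add: matrix_matrix_mult_def)

lemma hermitian_transpose_component [simp]: "hermitian_transpose C $ i $ j = cnj (C $ j $ i)"
  by (simp add: hermitian_transpose_def mat_cnj_def transpose_def map_matrix_def)

lemma vec_cnj_component [simp]: "vec_cnj v $ i = cnj (v $ i)"
  by (simp add: vec_cnj_def)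

lemma outer_component [simp]: "outer v w $ i $ j = v $ i * w $ j"
  by (simp add: outer_def)

lemma bounded_bilinear_outer_cnj:
  "bounded_bilinear (\<lambda>v w. outer v (vec_cnj w) :: complex^'n^'m)"
  unfolding bilinear_conv_bounded_bilinear[symmetric] bilinear_def
  by (auto intro!: linearI simp: vec_eq_iff algebra_simps)

lemma bounded_bilinear_mult_hermitian:
  "bounded_bilinear (\<lambda>C D. C ** hermitian_transpose D :: complex^'n^'m)"
  unfolding bilinear_conv_bounded_bilinear[symmetric] bilinear_def
  by (auto intro!: linearI simp: vec_eq_iff matrix_mult_component algebra_simps sum.distrib
      scaleR_sum_right)

lemma outer_matrix_vector:
  "outer (C *v v) (vec_cnj (D *v w)) = C ** outer v (vec_cnj w) ** hermitian_transpose D"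
  by (simp add: vec_eq_iff matrix_mult_component matrix_vector_mult_def sum_product sum_distrib_left
      sum_distrib_right mult.assoc mult.left_commute) (simp add: ac_simps)

text \<open>The covariance of the random measure and the integral of a product of indicators are
  both given by the measure of the intersection. As this holds for arbitrary pairs of sets,
  overlapping sets are allowed and no common refinement arises.\<close>

lemma wiener_simple_isometry:
  fixes C D :: "nat \<Rightarrow> complex^'n^'n"
  assumes Bt: "hermitian_gaussian_random_measure N Bt"
    and E: "\<And>l. l < m \<Longrightarrow> E l \<in> finite_borel_sets" and F: "\<And>l. l < k \<Longrightarrow> F l \<in> finite_borel_sets"
  shows "(\<integral>\<omega>. outer (\<Sum>l<m. C l *v Bt (E l) \<omega>) (vec_cnj (\<Sum>l<k. D l *v Bt (F l) \<omega>)) \<partial>N) =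
    (\<integral>x. (\<Sum>l<m. indicator (E l) x *\<^sub>R C l) ** hermitian_transpose (\<Sum>l<k. indicator (F l) x *\<^sub>R D l)
        \<partial>lborel)"
proof -
  interpret outer: bounded_bilinear "\<lambda>v w. outer v (vec_cnj w) :: complex^'n^'n"
    by (rule bounded_bilinear_outer_cnj)
  interpret mult: bounded_bilinear "\<lambda>C D. C ** hermitian_transpose D :: complex^'n^'n"
    by (rule bounded_bilinear_mult_hermitian)
  interpret N: prob_space N
    using Bt by (simp add: hermitian_gaussian_random_measure_def)
  have sq: "square_integrable_rv N (Bt A)" if "A \<in> finite_borel_sets" for A
    using Bt that N.gaussian_process_square_integrable by (auto simp: hermitian_gaussian_random_measure_def)
  have cov: "(\<integral>\<omega>. outer (P *v Bt A \<omega>) (vec_cnj (Q *v Bt B \<omega>)) \<partial>N)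
      = measure lborel (A \<inter> B) *\<^sub>R (P ** hermitian_transpose Q)"
    "integrable N (\<lambda>\<omega>. outer (P *v Bt A \<omega>) (vec_cnj (Q *v Bt B \<omega>)))"
    if A: "A \<in> finite_borel_sets" and B: "B \<in> finite_borel_sets" for A B and P Q :: "complex^'n^'n"
  proof -
    have T: "bounded_linear (\<lambda>R. P ** R ** hermitian_transpose Q)"
      unfolding linear_conv_bounded_linear[symmetric]
      by (auto intro!: linearI simp: vec_eq_iff matrix_mult_component algebra_simps sum.distrib
          scaleR_sum_right
          sum_distrib_left sum_distrib_right)
    have int: "integrable N (\<lambda>\<omega>. outer (Bt A \<omega>) (vec_cnj (Bt B \<omega>)))"
      by (rule bilinear_integrable[OF bounded_bilinear_outer_cnj sq[OF A] sq[OF B]])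
    show "integrable N (\<lambda>\<omega>. outer (P *v Bt A \<omega>) (vec_cnj (Q *v Bt B \<omega>)))"
      unfolding outer_matrix_vector by (rule integrable_bounded_linear[OF T int])
    have "(\<integral>\<omega>. outer (P *v Bt A \<omega>) (vec_cnj (Q *v Bt B \<omega>)) \<partial>N)
        = P ** mat (complex_of_real (measure lborel (A \<inter> B))) ** hermitian_transpose Q"
      unfolding outer_matrix_vector integral_bounded_linear[OF T int]
      using Bt A B by (simp add: hermitian_gaussian_random_measure_def)
    then show "(\<integral>\<omega>. outer (P *v Bt A \<omega>) (vec_cnj (Q *v Bt B \<omega>)) \<partial>N)
        = measure lborel (A \<inter> B) *\<^sub>R (P ** hermitian_transpose Q)"
      by (simp add: vec_eq_iff matrix_mult_component mat_def if_distrib[of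
          "\<lambda>x. _ * x"] scaleR_conv_of_real[where 'a = complex]
          sum_distrib_left ac_simps cong: if_cong)
  qed
  have ind: "integrable lborel (\<lambda>x. (indicator (E l) x * indicator (F l') x) *\<^sub>R (P :: complex^'n^'n))"
    "(\<integral>x. (indicator (E l) x * indicator (F l') x) *\<^sub>R P \<partial>lborel) = measure lborel (E l \<inter> F l') *\<^sub>R P"
    if "l < m" "l' < k" for l l' P
  proof -
    have "E l \<inter> F l' \<in> sets lborel" "emeasure lborel (E l \<inter> F l') < \<infinity>"
      using E[OF that(1)] F[OF that(2)] emeasure_mono[of "E l \<inter> F l'" "E l" lborel]
      by (auto simp: finite_borel_sets_def intro: order.strict_trans1)
    then show "integrable lborel (\<lambda>x. (indicator (E l) x * indicator (F l') x) *\<^sub>R P)"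
      "(\<integral>x. (indicator (E l) x * indicator (F l') x) *\<^sub>R P \<partial>lborel) = measure lborel (E l \<inter> F l') *\<^sub>R P"
      unfolding indicator_inter_arith[symmetric] by simp_all
  qed
  have sums: "outer (\<Sum>l<m. C l *v Bt (E l) \<omega>) (vec_cnj (\<Sum>l<k. D l *v Bt (F l) \<omega>))
      = (\<Sum>l<m. \<Sum>l'<k. outer (C l *v Bt (E l) \<omega>) (vec_cnj (D l' *v Bt (F l') \<omega>)))" for \<omega>
    by (simp only: outer.sum_left, simp only: outer.sum_right)
  have "(\<integral>\<omega>. outer (\<Sum>l<m. C l *v Bt (E l) \<omega>) (vec_cnj (\<Sum>l<k. D l *v Bt (F l) \<omega>)) \<partial>N)
      = (\<Sum>l<m. \<integral>\<omega>. (\<Sum>l'<k. outer (C l *v Bt (E l) \<omega>) (vec_cnj (D l' *v Bt (F l') \<omega>))) \<partial>N)"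
    unfolding sums
    by (intro Bochner_Integration.integral_sum Bochner_Integration.integrable_sum cov E F) auto
  also have "\<dots> = (\<Sum>l<m. \<Sum>l'<k. \<integral>\<omega>. outer (C l *v Bt (E l) \<omega>) (vec_cnj (D l' *v Bt (F l') \<omega>)) \<partial>N)"
    by (intro sum.cong refl Bochner_Integration.integral_sum cov E F) auto
  also have "\<dots> = (\<Sum>l<m. \<Sum>l'<k. measure lborel (E l \<inter> F l') *\<^sub>R (C l ** hermitian_transpose (D l')))"
    by (intro sum.cong refl cov E F) auto
  also have "\<dots> = (\<integral>x. (\<Sum>l<m. indicator (E l) x *\<^sub>R C l) ** hermitian_transpose
      (\<Sum>l<k. indicator (F l) x *\<^sub>R D l) \<partial>lborel)"
  proof -
    have "(\<Sum>l<m. indicator (E l) x *\<^sub>R C l) ** hermitian_transpose (\<Sum>l<k. indicator (F l) x *\<^sub>R D l)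
        = (\<Sum>l<m. \<Sum>l'<k. (indicator (E l) x * indicator (F l') x) *\<^sub>R
            (C l ** hermitian_transpose (D l')))" for x
      by (simp only: mult.sum_left, simp only: mult.sum_right, simp only: mult.scaleR_left,
          simp only: mult.scaleR_right scaleR_scaleR)
    then have "(\<integral>x. (\<Sum>l<m. indicator (E l) x *\<^sub>R C l) ** hermitian_transpose
        (\<Sum>l<k. indicator (F l) x *\<^sub>R D l) \<partial>lborel)
        = (\<integral>x. (\<Sum>l<m. \<Sum>l'<k. (indicator (E l) x * indicator (F l') x) *\<^sub>R
            (C l ** hermitian_transpose (D l'))) \<partial>lborel)"
      by (simp only:)
    also have "\<dots> = (\<Sum>l<m. \<integral>x. (\<Sum>l'<k. (indicator (E l) x * indicator (F l') x) *\<^sub>R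
        (C l ** hermitian_transpose (D l'))) \<partial>lborel)"
      by (intro Bochner_Integration.integral_sum Bochner_Integration.integrable_sum ind) auto
    also have "\<dots> = (\<Sum>l<m. \<Sum>l'<k. \<integral>x. (indicator (E l) x * indicator (F l') x) *\<^sub>R
        (C l ** hermitian_transpose (D l')) \<partial>lborel)"
      by (intro sum.cong refl Bochner_Integration.integral_sum ind) auto
    also have "\<dots> = (\<Sum>l<m. \<Sum>l'<k. measure lborel (E l \<inter> F l') *\<^sub>R (C l ** hermitian_transpose (D l')))"
      by (intro sum.cong refl ind) auto
    finally show ?thesis ..
  qed
  finally show ?thesis .
qed

text \<open>The polarised form, for two integrands with unrelated approximations: both sides are
  continuous bilinear pairings, in L^2 of N and of \<open>lborel\<close>, so the simple case passes
  to the limit.\<close>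

theorem wiener_isometry:
  fixes f g :: "real \<Rightarrow> complex^'n^'n"
  assumes Bt: "hermitian_gaussian_random_measure N Bt"
    and f: "has_wiener_integral N Bt f Y" and g: "has_wiener_integral N Bt g Z"
  shows "integrable lborel (\<lambda>x. f x ** hermitian_transpose (g x))"
    and "(\<integral>\<omega>. outer (Y \<omega>) (vec_cnj (Z \<omega>)) \<partial>N) = (\<integral>x. f x ** hermitian_transpose (g x) \<partial>lborel)"
proof -
  interpret N: prob_space N
    using Bt by (simp add: hermitian_gaussian_random_measure_def)
  have sqB: "square_integrable_rv N (Bt A)" if "A \<in> finite_borel_sets" for A
    using Bt that N.gaussian_process_square_integrable by (auto simp: hermitian_gaussian_random_measure_def)
  have sq: "square_integrable_rv lborel (\<lambda>x. \<Sum>l<m. indicator (E l) x *\<^sub>R C l)"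
    "square_integrable_rv N (\<lambda>\<omega>. \<Sum>l<m. C l *v Bt (E l) \<omega>)"
    if "\<And>l. l < m \<Longrightarrow> E l \<in> finite_borel_sets" for m E and C :: "nat \<Rightarrow> complex^'n^'n"
  proof -
    have "square_integrable_rv lborel (\<lambda>x. indicator (E l) x *\<^sub>R C l)" if "l < m" for l
    proof -
      have "(norm (indicator (E l) x *\<^sub>R C l))\<^sup>2 = indicator (E l) x *\<^sub>R (norm (C l))\<^sup>2" for x
        by (simp add: indicator_def)
      then show ?thesis
        using \<open>\<And>l. l < m \<Longrightarrow> E l \<in> finite_borel_sets\<close>[OF that]
        by (auto simp: square_integrable_rv_def finite_borel_sets_def)
    qed
    then show "square_integrable_rv lborel (\<lambda>x. \<Sum>l<m. indicator (E l) x *\<^sub>R C l)"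
      by (intro square_integrable_rv_sum) auto
    have "bounded_linear (\<lambda>v. C l *v v)" for l
      unfolding linear_conv_bounded_linear[symmetric]
      by (auto intro!: linearI simp: vec_eq_iff matrix_vector_mult_def algebra_simps sum.distrib
          scaleR_sum_right)
    then show "square_integrable_rv N (\<lambda>\<omega>. \<Sum>l<m. C l *v Bt (E l) \<omega>)"
      using that by (intro square_integrable_rv_sum square_integrable_rv_linear[of "(*v) (C _)"] sqB) auto
  qed
  have approx: "\<exists>(m :: nat \<Rightarrow> nat) (E :: nat \<Rightarrow> nat \<Rightarrow> real set) (C :: nat \<Rightarrow> nat \<Rightarrow> complex^'n^'n).
      (\<forall>i. \<forall>l<m i. E i l \<in> finite_borel_sets) \<and>
      (\<forall>i. square_integrable_rv lborel (\<lambda>x. \<Sum>l<m i. indicator (E i l) x *\<^sub>R C i l)) \<and>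
      (\<forall>i. square_integrable_rv N (\<lambda>\<omega>. \<Sum>l<m i. C i l *v Bt (E i l) \<omega>)) \<and>
      square_integrable_rv lborel f \<and> square_integrable_rv N Y \<and>
      (\<lambda>i. ms_norm lborel (\<lambda>x. f x - (\<Sum>l<m i. indicator (E i l) x *\<^sub>R C i l))) \<longlonglongrightarrow> 0 \<and>
      (\<lambda>i. ms_norm N (\<lambda>\<omega>. Y \<omega> - (\<Sum>l<m i. C i l *v Bt (E i l) \<omega>))) \<longlonglongrightarrow> 0"
    if wf: "has_wiener_integral N Bt f Y" for f :: "real \<Rightarrow> complex^'n^'n" and Y
  proof -
    obtain m :: "nat \<Rightarrow> nat" and E :: "nat \<Rightarrow> nat \<Rightarrow> real set" and C :: "nat \<Rightarrow> nat \<Rightarrow> complex^'n^'n"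
        where f: "f \<in> borel_measurable borel" and Y: "square_integrable_rv N Y"
      and E: "\<forall>i. \<forall>l<m i. E i l \<in> finite_borel_sets"
      and lim: "(\<lambda>i. \<integral>\<^sup>+ x. ennreal ((norm (f x - (\<Sum>l<m i. indicator (E i l) x *\<^sub>R C i l)))\<^sup>2) \<partial>lborel) \<longlonglongrightarrow> 0"
      and limY: "(\<lambda>i. ms_norm N (\<lambda>\<omega>. Y \<omega> - (\<Sum>l<m i. C i l *v Bt (E i l) \<omega>))) \<longlonglongrightarrow> 0"
      using wf unfolding has_wiener_integral_def by (elim conjE exE) (rule that; assumption)
    have s: "square_integrable_rv lborel (\<lambda>x. \<Sum>l<m i. indicator (E i l) x *\<^sub>R C i l)"
      "square_integrable_rv N (\<lambda>\<omega>. \<Sum>l<m i. C i l *v Bt (E i l) \<omega>)" for i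
      by (rule sq, simp add: E)+
    have "f \<in> borel_measurable lborel"
      using f by simp
    note f = square_integrable_rv_of_nn_limit[OF this s(1) lim]
    show ?thesis
      by (rule exI[of _ m], rule exI[of _ E], rule exI[of _ C], simp only: s f Y limY simp_thms, rule E)
  qed
  obtain m m' :: "nat \<Rightarrow> nat" and E E' :: "nat \<Rightarrow> nat \<Rightarrow> real set" and C C' :: "nat \<Rightarrow> nat \<Rightarrow> complex^'n^'n"
    where 1: "\<forall>i. \<forall>l<m i. E i l \<in> finite_borel_sets"
      "\<forall>i. square_integrable_rv lborel (\<lambda>x. \<Sum>l<m i. indicator (E i l) x *\<^sub>R C i l)"
      "\<forall>i. square_integrable_rv N (\<lambda>\<omega>. \<Sum>l<m i. C i l *v Bt (E i l) \<omega>)"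
      "square_integrable_rv lborel f" "square_integrable_rv N Y"
      "(\<lambda>i. ms_norm lborel (\<lambda>x. f x - (\<Sum>l<m i. indicator (E i l) x *\<^sub>R C i l))) \<longlonglongrightarrow> 0"
      "(\<lambda>i. ms_norm N (\<lambda>\<omega>. Y \<omega> - (\<Sum>l<m i. C i l *v Bt (E i l) \<omega>))) \<longlonglongrightarrow> 0"
    and 2: "\<forall>i. \<forall>l<m' i. E' i l \<in> finite_borel_sets"
      "\<forall>i. square_integrable_rv lborel (\<lambda>x. \<Sum>l<m' i. indicator (E' i l) x *\<^sub>R C' i l)"
      "\<forall>i. square_integrable_rv N (\<lambda>\<omega>. \<Sum>l<m' i. C' i l *v Bt (E' i l) \<omega>)"
      "square_integrable_rv lborel g" "square_integrable_rv N Z"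
      "(\<lambda>i. ms_norm lborel (\<lambda>x. g x - (\<Sum>l<m' i. indicator (E' i l) x *\<^sub>R C' i l))) \<longlonglongrightarrow> 0"
      "(\<lambda>i. ms_norm N (\<lambda>\<omega>. Z \<omega> - (\<Sum>l<m' i. C' i l *v Bt (E' i l) \<omega>))) \<longlonglongrightarrow> 0"
    using approx[OF f] approx[OF g] by (elim exE conjE) (rule that; assumption)
  show "integrable lborel (\<lambda>x. f x ** hermitian_transpose (g x))"
    using 1(4) 2(4) by (rule bilinear_integrable[OF bounded_bilinear_mult_hermitian])
  have "(\<lambda>i. \<integral>\<omega>. outer (\<Sum>l<m i. C i l *v Bt (E i l) \<omega>) (vec_cnj (\<Sum>l<m' i. C' i l *v Bt (E' i l) \<omega>)) \<partial>N)
      \<longlonglongrightarrow> (\<integral>\<omega>. outer (Y \<omega>) (vec_cnj (Z \<omega>)) \<partial>N)"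
    by (rule bilinear_integral_tendsto[OF bounded_bilinear_outer_cnj 1(3)[rule_format] 1(5)
        2(3)[rule_format] 2(5) 1(7) 2(7)])
  moreover have "(\<lambda>i. \<integral>x. (\<Sum>l<m i. indicator (E i l) x *\<^sub>R C i l) ** hermitian_transpose
      (\<Sum>l<m' i. indicator (E' i l) x *\<^sub>R C' i l) \<partial>lborel)
      \<longlonglongrightarrow> (\<integral>x. f x ** hermitian_transpose (g x) \<partial>lborel)"
    by (rule bilinear_integral_tendsto[OF bounded_bilinear_mult_hermitian 1(2)[rule_format] 1(4)
        2(2)[rule_format] 2(4) 1(6) 2(6)])
  moreover have "(\<integral>\<omega>. outer (\<Sum>l<m i. C i l *v Bt (E i l) \<omega>)
      (vec_cnj (\<Sum>l<m' i. C' i l *v Bt (E' i l) \<omega>)) \<partial>N) =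
      (\<integral>x. (\<Sum>l<m i. indicator (E i l) x *\<^sub>R C i l) ** hermitian_transpose
          (\<Sum>l<m' i. indicator (E' i l) x *\<^sub>R C' i l) \<partial>lborel)" for i
    using 1(1) 2(1) by (intro wiener_simple_isometry[OF Bt]) auto
  ultimately show "(\<integral>\<omega>. outer (Y \<omega>) (vec_cnj (Z \<omega>)) \<partial>N) = (\<integral>x. f x ** hermitian_transpose (g x) \<partial>lborel)"
    using LIMSEQ_unique by simp
qed


section \<open>Covariance of operator fractional Brownian motion\<close>

lemma mat_complex_component [simp]: "mat_complex P $ i $ j = complex_of_real (P $ i $ j)"
  by (simp add: mat_complex_def map_matrix_def)

lemma mat_cnj_component [simp]: "mat_cnj P $ i $ j = cnj (P $ i $ j)"
  by (simp add: mat_cnj_def map_matrix_def)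

lemma vec_complex_component [simp]: "vec_complex v $ i = complex_of_real (v $ i)"
  by (simp add: vec_complex_def)

lemma mat_complex_mult: "mat_complex (P ** Q) = mat_complex P ** mat_complex Q"
  by (simp add: vec_eq_iff matrix_mult_component)

lemma mat_complex_zero [simp]: "mat_complex 0 = 0"
  by (simp add: vec_eq_iff)

lemma mat_complex_scaleR: "mat_complex (c *\<^sub>R P) = c *\<^sub>R mat_complex P"
  by (simp add: vec_eq_iff scaleR_conv_of_real[where 'a = complex])

lemma mat_complex_add: "mat_complex (P + Q) = mat_complex P + mat_complex Q"
  by (simp add: vec_eq_iff)

lemma mat_complex_diff: "mat_complex (P - Q) = mat_complex P - mat_complex Q"
  by (simp add: vec_eq_iff)

lemma mat_complex_inject: "mat_complex P = mat_complex Q \<longleftrightarrow> P = Q"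
  by (simp add: vec_eq_iff)

lemma mat_complex_eq_0_iff: "mat_complex P = 0 \<longleftrightarrow> P = 0"
  by (simp add: vec_eq_iff)

lemma hermitian_transpose_mult: "hermitian_transpose (P ** Q)
    = hermitian_transpose Q ** hermitian_transpose P"
  by (simp add: vec_eq_iff matrix_mult_component mult.commute)

lemma hermitian_transpose_mat_complex: "hermitian_transpose (mat_complex P) = mat_complex (transpose P)"
  by (simp add: vec_eq_iff transpose_def)

lemma bounded_linear_sandwich: "bounded_linear (\<lambda>R. P ** R ** Q :: complex^'n^'m)"
  unfolding linear_conv_bounded_linear[symmetric]
  by (auto intro!: linearI simp: vec_eq_iff matrix_mult_component algebra_simps sum.distrib scaleR_sum_right
      sum_distrib_left sum_distrib_right)

lemma integral_matrix_component:
  fixes F :: "'a \<Rightarrow> 'c::euclidean_space^'n^'m"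
  assumes "integrable M F"
  shows "(\<integral>x. F x \<partial>M) $ i $ j = (\<integral>x. F x $ i $ j \<partial>M)" "integrable M (\<lambda>x. F x $ i $ j)"
proof -
  have T: "bounded_linear (\<lambda>P :: 'c^'n^'m. P $ i $ j)"
    by (rule bounded_linear_compose[OF bounded_linear_vec_nth bounded_linear_vec_nth])
  show "(\<integral>x. F x \<partial>M) $ i $ j = (\<integral>x. F x $ i $ j \<partial>M)" "integrable M (\<lambda>x. F x $ i $ j)"
    using integral_bounded_linear[OF T assms] integrable_bounded_linear[OF T assms] by simp_all
qed

lemma integrable_matrix:
  fixes F :: "'a \<Rightarrow> 'c::euclidean_space^'n^'m"
  assumes "\<And>i j. integrable M (\<lambda>x. F x $ i $ j)"
  shows "integrable M F"
proof -
  have T: "bounded_linear (\<lambda>c :: 'c. axis i (axis j c) :: 'c^'n^'m)" for i j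
    unfolding linear_conv_bounded_linear[symmetric]
    by (auto intro!: linearI simp: vec_eq_iff axis_def)
  have "integrable M (\<lambda>x. \<Sum>i\<in>UNIV. \<Sum>j\<in>UNIV. axis i (axis j (F x $ i $ j)) :: 'c^'n^'m)"
    by (intro Bochner_Integration.integrable_sum integrable_bounded_linear[OF T] assms)
  moreover have "(\<Sum>i\<in>UNIV. \<Sum>j\<in>UNIV. axis i (axis j (P $ i $ j))) = P" for P :: "'c^'n^'m"
  proof -
    have "(\<Sum>j\<in>UNIV. if a = i then h j else 0) = (if a = i then \<Sum>j\<in>UNIV. h j else 0)"
      for a i :: 'm and h :: "'n \<Rightarrow> 'c"
      by simp
    then have "(\<Sum>i\<in>UNIV. \<Sum>j\<in>UNIV. axis i (axis j (P $ i $ j)) :: 'c^'n^'m) $ a $ b = P $ a $ b" for a b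
      by (simp add: axis_def if_distrib[of "\<lambda>v. v $ b"] cong: if_cong)
    then show ?thesis by (simp add: vec_eq_iff)
  qed
  ultimately show ?thesis by simp
qed

lemma mat_complex_integral:
  fixes F :: "'a \<Rightarrow> real^'n^'m"
  assumes "integrable M F"
  shows "mat_complex (\<integral>x. F x \<partial>M) = (\<integral>x. mat_complex (F x) \<partial>M)" "integrable M (\<lambda>x. mat_complex (F x))"
proof -
  have T: "bounded_linear (mat_complex :: real^'n^'m \<Rightarrow> _)"
    unfolding linear_conv_bounded_linear[symmetric]
    by (auto intro!: linearI simp: mat_complex_add mat_complex_scaleR)
  show "mat_complex (\<integral>x. F x \<partial>M) = (\<integral>x. mat_complex (F x) \<partial>M)" "integrable M (\<lambda>x. mat_complex (F x))"
    using integral_bounded_linear[OF T assms] integrable_bounded_linear[OF T assms] by simp_all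
qed

lemma bounded_bilinear_outer_real: "bounded_bilinear (outer :: real^'m \<Rightarrow> real^'n \<Rightarrow> _)"
  unfolding bilinear_conv_bounded_bilinear[symmetric] bilinear_def
  by (auto intro!: linearI simp: vec_eq_iff algebra_simps)

text \<open>B and the Wiener integrals may be defined on different spaces; expectations of functions
  of two coordinates are all that has to be carried over to compare covariances.\<close>

lemma fdd_eq_integral_pair:
  fixes X :: "'i \<Rightarrow> 'a \<Rightarrow> 'v::second_countable_topology" and Y :: "'i \<Rightarrow> 'b \<Rightarrow> 'v"
    and h :: "'v \<times> 'v \<Rightarrow> 'w::{banach,second_countable_topology}"
  assumes "fdd_eq M X N Y" and h: "h \<in> borel_measurable borel"
  shows "(\<integral>\<omega>. h (X s \<omega>, X t \<omega>) \<partial>M) = (\<integral>\<omega>. h (Y s \<omega>, Y t \<omega>) \<partial>N)"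
proof -
  let ?J = "{s, t}" let ?P = "PiM ?J (\<lambda>_. borel :: 'v measure)"
  have [measurable]: "X i \<in> borel_measurable M" "Y i \<in> borel_measurable N" for i
    using assms(1) by (auto simp: fdd_eq_def)
  have eq: "distr M ?P (\<lambda>\<omega>. \<lambda>i\<in>?J. X i \<omega>) = distr N ?P (\<lambda>\<omega>. \<lambda>i\<in>?J. Y i \<omega>)"
    using assms(1) by (auto simp: fdd_eq_def)
  have [measurable]: "h \<in> borel_measurable (borel \<Otimes>\<^sub>M borel)"
    using h by (simp add: borel_prod)
  have H: "(\<lambda>x. h (x s, x t)) \<in> borel_measurable ?P"
    by measurable
  have X: "(\<lambda>\<omega>. \<lambda>i\<in>?J. X i \<omega>) \<in> measurable M ?P" and Y: "(\<lambda>\<omega>. \<lambda>i\<in>?J. Y i \<omega>) \<in> measurable N ?P"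
    by measurable
  show ?thesis
    using integral_distr[OF X H] integral_distr[OF Y H] eq by simp
qed

section \<open>The kernel as a scalar factor depending on t times a matrix factor\<close>

definition spectral_factor :: "real^'n^'n \<Rightarrow> complex^'n^'n \<Rightarrow> real \<Rightarrow> complex^'n^'n" where
  "spectral_factor H A x = mat_complex (mat_powr (max x 0) (- ofbm_exponent H)) ** A +
     mat_complex (mat_powr (max (- x) 0) (- ofbm_exponent H)) ** mat_cnj A"

text \<open>At \<open>x = 0\<close> the value is 0 (division by zero) and not the limit \<open>t\<close>; this concerns a null set
  only.\<close>

definition increment_kernel :: "real \<Rightarrow> real \<Rightarrow> complex" where
  "increment_kernel t x = (cis (t * x) - 1) / (\<i> * complex_of_real x)"

lemma ofbm_kernel_component:
  "ofbm_kernel H A t x $ i $ j = increment_kernel t x * spectral_factor H A x $ i $ j"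
  unfolding ofbm_kernel_def spectral_factor_def[symmetric] increment_kernel_def[symmetric]
  by (simp add: matrix_mult_component mat_def if_distrib[of "\<lambda>x. x * _"] cong: if_cong)

lemma ofbm_kernel_mult_component:
  "(ofbm_kernel H A s x ** hermitian_transpose (ofbm_kernel H A t x)) $ i $ j =
    increment_kernel s x * cnj (increment_kernel t x) *
      (spectral_factor H A x ** hermitian_transpose (spectral_factor H A x)) $ i $ j"
  by (simp add: matrix_mult_component ofbm_kernel_component sum_distrib_left ac_simps)

lemma mat_powr_zero [simp]: "mat_powr 0 P = 0"
  by (simp add: mat_powr_def)

lemma spectral_factor_zero [simp]: "spectral_factor H A 0 = 0"
  by (simp add: spectral_factor_def vec_eq_iff matrix_mult_component)

lemma increment_kernel_minus: "increment_kernel t (- x) = cnj (increment_kernel t x)"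
  by (simp add: increment_kernel_def cis_cnj)

lemma increment_kernel_scale: "c > 0 \<Longrightarrow> increment_kernel (c * t) x = c * increment_kernel t (c * x)"
  by (cases "x = 0") (simp_all add: increment_kernel_def field_simps)

lemma increment_kernel_add:
  "increment_kernel (s + h) x - increment_kernel h x = cis (h * x) * increment_kernel s x"
  by (simp add: increment_kernel_def diff_divide_distrib[symmetric] distrib_right
      cis_mult[symmetric] algebra_simps)

text \<open>Scaling by c > 0 keeps the sign of x, so both half-lines are multiplied by the same
  matrix. At base 0 the power law holds because \<open>mat_powr 0\<close> is the zero
  matrix.\<close>

lemma spectral_factor_scale:
  assumes "c > 0"
  shows "spectral_factor H A (c * x) = mat_complex (mat_powr c (- ofbm_exponent H)) **
      spectral_factor H A x"
proof -
  have "mat_powr (c * y) P = mat_powr c P ** mat_powr y P" if "y \<ge> 0" for y and P :: "real^'a^'a"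
    using that assms mat_powr_mult[of c y P] by (cases "y
        = 0") (auto simp: vec_eq_iff matrix_mult_component)
  moreover have "max (c * x) 0 = c * max x 0" "max (- (c * x)) 0 = c * max (- x) 0"
    using assms by (auto simp: max_def mult_le_0_iff zero_le_mult_iff)
  ultimately show ?thesis
    by (simp add: spectral_factor_def mat_complex_mult matrix_add_ldistrib matrix_mul_assoc)
qed

lemma spectral_factor_measurable [measurable]:
  fixes H :: "real^'n^'n"
  shows "spectral_factor H A \<in> borel_measurable borel"
proof -
  have "(\<lambda>x. mat_complex (mat_powr (max x 0) (- ofbm_exponent H)) ** P) \<in> borel_measurable borel"
    "(\<lambda>x. mat_complex (mat_powr (max (- x) 0) (- ofbm_exponent H)) ** P)
        \<in> borel_measurable borel" for P :: "complex^'n^'n"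
  proof -
    have "linear (\<lambda>R. mat_complex R ** P :: complex^'n^'n)"
      by (auto intro!: linearI simp: vec_eq_iff matrix_mult_component algebra_simps sum.distrib
          sum_distrib_left
        scaleR_conv_of_real[where 'a = complex])
    then have c: "continuous_on UNIV (\<lambda>R. mat_complex R ** P :: complex^'n^'n)"
      by (simp add: linear_continuous_on linear_conv_bounded_linear)
    show "(\<lambda>x. mat_complex (mat_powr (max x 0) (- ofbm_exponent H)) ** P) \<in> borel_measurable borel"
      "(\<lambda>x. mat_complex (mat_powr (max (- x) 0) (- ofbm_exponent H)) ** P) \<in> borel_measurable borel"
      by (rule borel_measurable_continuous_on[OF c], measurable)+
  qed
  then show ?thesis
    unfolding spectral_factor_def[abs_def] by (intro borel_measurable_add)
qed

lemma increment_kernel_measurable [measurable]: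
  assumes [measurable]: "f \<in> borel_measurable M" "g \<in> borel_measurable M"
  shows "(\<lambda>x. increment_kernel (f x) (g x)) \<in> borel_measurable M"
  unfolding increment_kernel_def cis_conv_exp by measurable

locale ofbm_process =
  fixes M :: "'a measure" and B :: "real \<Rightarrow> 'a \<Rightarrow> real^'n"
    and N :: "'b measure" and Bt :: "real set \<Rightarrow> 'b \<Rightarrow> complex^'n"
    and H :: "real^'n^'n" and A :: "complex^'n^'n"
  assumes ofbm: "ofbm M B N Bt H A"
begin

sublocale prob_space M
  using ofbm by (simp add: ofbm_def)

lemma gaussian: "gaussian_process M UNIV B" and centered: "expectation (B t) = 0"
  using ofbm by (simp_all add: ofbm_def)

lemma square_integrable: "square_integrable_rv M (B t)"
  by (rule gaussian_process_square_integrable[OF gaussian]) simp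

definition \<Gamma> :: "real \<Rightarrow> real \<Rightarrow> real^'n^'n" where
  "\<Gamma> s t = expectation (\<lambda>\<omega>. outer (B s \<omega>) (B t \<omega>))"

lemma outer_integrable: "integrable M (\<lambda>\<omega>. outer (B s \<omega>) (B t \<omega>))"
  by (rule bilinear_integrable[OF bounded_bilinear_outer_real square_integrable square_integrable])

lemma \<Gamma>_component: "\<Gamma> s t $ i $ j = expectation (\<lambda>\<omega>. B s \<omega> $ i * B t \<omega> $ j)"
  unfolding \<Gamma>_def integral_matrix_component(1)[OF outer_integrable] by simp

abbreviation "K \<equiv> ofbm_kernel H A"
abbreviation "\<kappa> \<equiv> increment_kernel"
abbreviation "S \<equiv> spectral_factor H A"

text \<open>The isometry on N, carried to M by the equality of finite-dimensional distributions. The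
  values of B are real, so the conjugation in the isometry is invisible on the side of
  \<Gamma>.\<close>

theorem spectral:
  "integrable lborel (\<lambda>x. K s x ** hermitian_transpose (K t x))"
  "mat_complex (\<Gamma> s t) = (\<integral>x. K s x ** hermitian_transpose (K t x) \<partial>lborel)"
proof -
  obtain I where I: "\<And>t. has_wiener_integral N Bt (K t) (I t)" and fdd:
      "fdd_eq M (\<lambda>t \<omega>. vec_complex (B t \<omega>)) N I"
    using ofbm by (auto simp: ofbm_def)
  have Bt: "hermitian_gaussian_random_measure N Bt"
    using ofbm by (simp add: ofbm_def)
  note iso = wiener_isometry[OF Bt I I, of s t]
  show "integrable lborel (\<lambda>x. K s x ** hermitian_transpose (K t x))"
    by (rule iso(1))
  have h: "(\<lambda>p. outer (fst p) (vec_cnj (snd p)) :: complex^'n^'n) \<in> borel_measurable borel"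
    by (intro borel_measurable_continuous_onI
        bounded_bilinear.continuous_on[OF bounded_bilinear_outer_cnj] continuous_intros)
  have "mat_complex (\<Gamma> s t) = expectation (\<lambda>\<omega>. mat_complex (outer (B s \<omega>) (B t \<omega>)))"
    unfolding \<Gamma>_def by (rule mat_complex_integral(1)[OF outer_integrable])
  also have "\<dots> = expectation (\<lambda>\<omega>. outer (vec_complex (B s \<omega>)) (vec_cnj (vec_complex (B t \<omega>))))"
    by (intro Bochner_Integration.integral_cong refl) (simp add: vec_eq_iff)
  also have "\<dots> = (\<integral>\<omega>. outer (I s \<omega>) (vec_cnj (I t \<omega>)) \<partial>N)"
    using fdd_eq_integral_pair[OF fdd h, of s t] by simp
  finally show "mat_complex (\<Gamma> s t) = (\<integral>x. K s x ** hermitian_transpose (K t x) \<partial>lborel)"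
    using iso(2) by simp
qed

lemma spectral_component:
  "integrable lborel (\<lambda>x. \<kappa> s x * cnj (\<kappa> t x) * (S x ** hermitian_transpose (S x)) $ i $ j)"
  "complex_of_real (\<Gamma> s t $ i $ j) =
    (\<integral>x. \<kappa> s x * cnj (\<kappa> t x) * (S x ** hermitian_transpose (S x)) $ i $ j \<partial>lborel)"
  using integral_matrix_component[OF spectral(1), of s t i j]
  by (simp_all only: ofbm_kernel_mult_component spectral(2)[symmetric] mat_complex_component)

lemma K_scale:
  assumes "c > 0"
  shows "K (c * t) x = c *\<^sub>R (mat_complex (mat_powr (inverse c) (- ofbm_exponent H)) ** K t (c * x))"
proof -
  have e: "inverse c * (c * x) = x"
    using assms by simp
  have "S x = mat_complex (mat_powr (inverse c) (- ofbm_exponent H)) ** S (c * x)"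
    using spectral_factor_scale[of "inverse c" H A "c * x"] assms unfolding e by simp
  then show ?thesis
    by (simp add: vec_eq_iff ofbm_kernel_component increment_kernel_scale[OF assms] matrix_mult_component
        sum_distrib_left scaleR_conv_of_real[where 'a = complex] ac_simps)
qed

text \<open>Substitution of c x for x in the spectral integral. The two kernels contribute c^2 and
  the change of variables 1/c; the remaining factor c is shared as sqrt c on each side, which
  \<open>mat_powr_ofbm_exponent\<close> absorbs.\<close>

theorem self_similar:
  assumes "c > 0"
  shows "\<Gamma> (c * s) (c * t) = mat_powr c H ** \<Gamma> s t ** mat_powr c (transpose H)"
proof -
  let ?P = "mat_powr (inverse c) (- ofbm_exponent H)"
  let ?F = "\<lambda>x. K s x ** hermitian_transpose (K t x)"
  have "K (c * s) x ** hermitian_transpose (K (c * t) x)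
      = c\<^sup>2 *\<^sub>R (mat_complex ?P ** ?F (c * x) ** mat_complex (transpose ?P))" for x
    unfolding K_scale[OF assms] bounded_bilinear.scaleR_left[OF bounded_bilinear_mult_hermitian]
      bounded_bilinear.scaleR_right[OF bounded_bilinear_mult_hermitian]
    by (simp add: hermitian_transpose_mult hermitian_transpose_mat_complex matrix_mul_assoc
        power2_eq_square)
  then have "mat_complex (\<Gamma> (c * s) (c * t)) =
      c\<^sup>2 *\<^sub>R (\<integral>x. mat_complex ?P ** ?F (c * x) ** mat_complex (transpose ?P) \<partial>lborel)"
    unfolding spectral(2) by simp
  also have "(\<integral>x. mat_complex ?P ** ?F (c * x) ** mat_complex (transpose ?P) \<partial>lborel)
      = mat_complex ?P ** (\<integral>x. ?F (c * x) \<partial>lborel) ** mat_complex (transpose ?P)"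
    using assms spectral(1)[of s t] lborel_integrable_real_affine_iff[of c ?F 0]
    by (intro integral_bounded_linear[OF bounded_linear_sandwich]) simp
  also have "(\<integral>x. ?F (c * x) \<partial>lborel) = (1 / c) *\<^sub>R mat_complex (\<Gamma> s t)"
    using lborel_integral_real_affine[of c ?F 0] assms unfolding spectral(2) by simp
  also have "c\<^sup>2 *\<^sub>R (mat_complex ?P ** (1 / c) *\<^sub>R mat_complex (\<Gamma> s t) ** mat_complex (transpose ?P))
      = c *\<^sub>R mat_complex (?P ** \<Gamma> s t ** transpose ?P)"
    using assms by (simp add: vec_eq_iff mat_complex_mult matrix_mult_component scaleR_sum_right
        power2_eq_square
        sum_distrib_left sum_distrib_right scaleR_conv_of_real[where 'a = complex] field_simps)
  also have "\<dots> = mat_complex ((sqrt c *\<^sub>R ?P) ** \<Gamma> s t ** transpose (sqrt c *\<^sub>R ?P))"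
  proof -
    have "c *\<^sub>R (?P ** \<Gamma> s t ** transpose ?P) = (sqrt c * sqrt c) *\<^sub>R (?P ** \<Gamma> s t ** transpose ?P)"
      using assms by simp
    then show ?thesis
      by (simp only: transpose_scalar matrix_scaleR_left matrix_scaleR_right scaleR_scaleR
          mat_complex_scaleR[symmetric])
  qed
  finally show ?thesis
    unfolding mat_complex_inject mat_powr_ofbm_exponent[OF assms] mat_powr_transpose .
qed

text \<open>The left side is the covariance of the increments from h. In the spectral domain a time
  shift by h multiplies the kernel of an increment by the phase cis(hx), and the phase meets its
  conjugate.\<close>

theorem stationary_increments: "\<Gamma> (s + h) (t + h) - \<Gamma> (s + h) h - \<Gamma> h (t + h) + \<Gamma> h h = \<Gamma> s t"
proof -
  have "mat_complex (\<Gamma> (s + h) (t + h) - \<Gamma> (s + h) h - \<Gamma> h (t + h) + \<Gamma> h h)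
      = (\<integral>x. K (s + h) x ** hermitian_transpose (K (t + h) x) - K (s + h) x ** hermitian_transpose (K h x)
          - K h x ** hermitian_transpose (K (t + h) x) + K h x ** hermitian_transpose (K h x) \<partial>lborel)"
    unfolding mat_complex_add mat_complex_diff spectral(2) using spectral(1) by simp
  also have "\<dots> = (\<integral>x. K s x ** hermitian_transpose (K t x) \<partial>lborel)"
  proof (intro Bochner_Integration.integral_cong refl)
    fix x
    have "(\<kappa> (s + h) x - \<kappa> h x) * cnj (\<kappa> (t + h) x - \<kappa> h x) = \<kappa> s x * cnj (\<kappa> t x)"
      unfolding increment_kernel_add by (simp add: cis_cnj cis_mult ac_simps)
    then have "\<kappa> (s + h) x * cnj (\<kappa> (t + h) x) - \<kappa> (s + h) x * cnj (\<kappa> h x) - \<kappa> h x * cnj (\<kappa> (t + h) x)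
        + \<kappa> h x * cnj (\<kappa> h x) = \<kappa> s x * cnj (\<kappa> t x)"
      by (simp add: algebra_simps)
    then show "K (s + h) x ** hermitian_transpose (K (t + h) x) - K (s + h) x ** hermitian_transpose (K h x)
          - K h x ** hermitian_transpose (K (t + h) x) + K h x ** hermitian_transpose (K h x)
        = K s x ** hermitian_transpose (K t x)"
      by (simp only: vec_eq_iff vector_add_component vector_minus_component ofbm_kernel_mult_component
          left_diff_distrib[symmetric] distrib_right[symmetric] simp_thms)
  qed
  finally show ?thesis
    unfolding spectral(2)[symmetric] mat_complex_inject .
qed

lemma \<Gamma>_zero [simp]: "\<Gamma> 0 t = 0" "\<Gamma> t 0 = 0"
proof -
  have "K 0 x = 0" for x
    by (simp add: vec_eq_iff ofbm_kernel_component increment_kernel_def)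
  then have "mat_complex (\<Gamma> 0 t) = 0" "mat_complex (\<Gamma> t 0) = 0"
    unfolding spectral(2) by (simp_all add: bounded_bilinear.zero_left[OF bounded_bilinear_mult_hermitian]
      bounded_bilinear.zero_right[OF bounded_bilinear_mult_hermitian])
  then show "\<Gamma> 0 t = 0" "\<Gamma> t 0 = 0"
    by (simp_all add: mat_complex_eq_0_iff)
qed

text \<open>Stationary increments with shift -u give equal variances at u and -u, as \<Gamma>
  vanishes when one time is 0; self-similarity then applies to the absolute value. At t = 0 both
  sides are 0 by the convention for base 0.\<close>

lemma \<Gamma>_diagonal: "\<Gamma> t t = mat_powr \<bar>t\<bar> H ** \<Gamma> 1 1 ** mat_powr \<bar>t\<bar> (transpose H)"
proof -
  have neg: "\<Gamma> (- u) (- u) = \<Gamma> u u" for u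
    using stationary_increments[of u "- u" u] by simp
  have abs: "\<Gamma> t t = \<Gamma> \<bar>t\<bar> \<bar>t\<bar>"
    using neg[of t] by (cases "t \<ge> 0") auto
  show ?thesis
  proof (cases "t = 0")
    case True
    then show ?thesis by (simp add: vec_eq_iff matrix_mult_component)
  next
    case False
    then show ?thesis
      unfolding abs using self_similar[of "\<bar>t\<bar>" 1 1] by simp
  qed
qed

text \<open>If A A^* is real, S S^* is an even function of the frequency; reflecting the frequency
  then only conjugates the scalar kernels, which exchanges s and t.\<close>

lemma \<Gamma>_symmetric_if_real:
  assumes "map_matrix Im (A ** hermitian_transpose A) = 0"
  shows "\<Gamma> s t = \<Gamma> t s"
proof -
  let ?G = "\<lambda>x. S x ** hermitian_transpose (S x)"
  have AA: "mat_cnj (A ** hermitian_transpose A) = A ** hermitian_transpose A"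
    using assms by (auto simp: vec_eq_iff map_matrix_def complex_eq_iff)
  have G: "?G x = (let P = mat_complex (mat_powr \<bar>x\<bar> (- ofbm_exponent H)) in
      P ** (A ** hermitian_transpose A) ** hermitian_transpose P)" for x
  proof -
    consider "x = 0" | "x > 0" | "x < 0" by linarith
    then show ?thesis
    proof cases
      case 1
      then show ?thesis by (simp add: vec_eq_iff matrix_mult_component Let_def)
    next
      case 2
      then have "S x = mat_complex (mat_powr \<bar>x\<bar> (- ofbm_exponent H)) ** A"
        by (simp add: spectral_factor_def max_def vec_eq_iff matrix_mult_component)
      then show ?thesis
        by (simp add: hermitian_transpose_mult Let_def matrix_mul_assoc)
    next
      case 3
      then have "S x = mat_complex (mat_powr \<bar>x\<bar> (- ofbm_exponent H)) ** mat_cnj A"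
        by (simp add: spectral_factor_def max_def vec_eq_iff matrix_mult_component)
      then have "?G x = mat_complex (mat_powr \<bar>x\<bar> (- ofbm_exponent H)) **
          (mat_cnj A ** hermitian_transpose (mat_cnj A)) **
          hermitian_transpose (mat_complex (mat_powr \<bar>x\<bar> (- ofbm_exponent H)))"
        by (simp add: hermitian_transpose_mult matrix_mul_assoc)
      moreover have "mat_cnj A ** hermitian_transpose (mat_cnj A) = mat_cnj (A ** hermitian_transpose A)"
        by (simp add: vec_eq_iff matrix_mult_component)
      ultimately show ?thesis
        by (simp only: AA Let_def)
    qed
  qed
  have even: "?G (- x) = ?G x" for x
    unfolding G by simp
  have "complex_of_real (\<Gamma> s t $ i $ j) = complex_of_real (\<Gamma> t s $ i $ j)" for i j
  proof -
    have "complex_of_real (\<Gamma> s t $ i $ j) = (\<integral>x. \<kappa> s (- x) * cnj (\<kappa> t (- x)) * ?G (- x) $ i $ j \<partial>lborel)"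
      unfolding spectral_component(2) by (subst lborel_integral_real_affine[where c = "-1" and t
          = 0]) simp_all
    also have "\<dots> = complex_of_real (\<Gamma> t s $ i $ j)"
      unfolding spectral_component(2) even increment_kernel_minus
      by (simp add: mult.commute[of "cnj (\<kappa> s _)"])
    finally show ?thesis .
  qed
  then show ?thesis
    by (simp add: vec_eq_iff)
qed

end


section \<open>Integrability of the spectral weight\<close>

text \<open>The bound is required only where \<psi> does not vanish. With compactly supported \<psi>
  it concerns a bounded range of times, for which one dominating function serves.\<close>

lemma integrable_weighted_pair:
  fixes k :: "real \<Rightarrow> real \<Rightarrow> 'v::{banach,second_countable_topology}"
  assumes \<psi>: "integrable lborel \<psi>" and k [measurable]: "(\<lambda>p. k (fst p) (snd p))
      \<in> borel_measurable (borel \<Otimes>\<^sub>M borel)"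
    and h: "integrable lborel h" and bound: "\<And>s x. \<psi> s \<noteq> 0 \<Longrightarrow> norm (k s x) \<le> h x"
  shows "integrable (lborel \<Otimes>\<^sub>M lborel) (\<lambda>(s, x). \<psi> s *\<^sub>R k s x)"
proof (rule lborel_pair.Fubini_integrable)
  have [measurable]: "\<psi> \<in> borel_measurable borel" "h \<in> borel_measurable borel"
    using \<psi> h by auto
  show [measurable]: "(\<lambda>(s, x). \<psi> s *\<^sub>R k s x) \<in> borel_measurable (lborel \<Otimes>\<^sub>M lborel)"
    unfolding split_beta' by measurable
  have le: "norm (\<psi> s *\<^sub>R k s x) \<le> \<bar>\<psi> s\<bar> * h x" for s x
    using bound[of s x] by (cases "\<psi> s = 0") (auto intro: mult_left_mono)
  have int: "integrable lborel (\<lambda>x. \<psi> s *\<^sub>R k s x)" for s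
  proof (rule Bochner_Integration.integrable_bound)
    show "integrable lborel (\<lambda>x. \<bar>\<psi> s\<bar> * h x)"
      using h by (rule integrable_mult_right)
    show "AE x in lborel. norm (\<psi> s *\<^sub>R k s x) \<le> norm (\<bar>\<psi> s\<bar> * h x)"
    proof (rule AE_I2)
      fix x show "norm (\<psi> s *\<^sub>R k s x) \<le> norm (\<bar>\<psi> s\<bar> * h x)"
        using order_trans[OF le[of s x] abs_ge_self] by (simp only: real_norm_def)
    qed
  qed measurable
  then show "AE s in lborel. integrable lborel (\<lambda>x. (\<lambda>(s, x). \<psi> s *\<^sub>R k s x) (s, x))"
    by simp
  show "integrable lborel (\<lambda>s. \<integral>x. norm ((\<lambda>(s, x). \<psi> s *\<^sub>R k s x) (s, x)) \<partial>lborel)"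
  proof (rule Bochner_Integration.integrable_bound)
    show "integrable lborel (\<lambda>s. \<psi> s * (\<integral>x. h x \<partial>lborel))"
      using \<psi> by (rule integrable_mult_left)
    have le': "(\<integral>x. norm (\<psi> s *\<^sub>R k s x) \<partial>lborel) \<le> \<bar>\<psi> s\<bar> * (\<integral>x. h x \<partial>lborel)" for s
      using integral_mono[OF integrable_norm[OF int] integrable_mult_right[OF h] le] by simp
    have nn: "0 \<le> (\<integral>x. norm (\<psi> s *\<^sub>R k s x) \<partial>lborel)" for s
      by simp
    show "AE s in lborel. norm (\<integral>x. norm ((\<lambda>(s, x). \<psi> s *\<^sub>R k s x) (s, x)) \<partial>lborel)
        \<le> norm (\<psi> s * (\<integral>x. h x \<partial>lborel))"
    proof (rule AE_I2)
      fix s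
      show "norm (\<integral>x. norm ((\<lambda>(s, x). \<psi> s *\<^sub>R k s x) (s, x)) \<partial>lborel) \<le> norm (\<psi> s * (\<integral>x. h x \<partial>lborel))"
        using order_trans[OF le'[of s] mult_left_mono[OF abs_ge_self[of
            "\<integral>x. h x \<partial>lborel"] abs_ge_zero[of "\<psi> s"]]] nn[of s]
        by (simp add: abs_mult)
    qed
  qed measurable
qed

lemma weighted_integral_swap:
  fixes k :: "real \<Rightarrow> real \<Rightarrow> 'v::{banach,second_countable_topology}"
  assumes \<psi>: "integrable lborel \<psi>" and k: "(\<lambda>p. k (fst p) (snd p)) \<in> borel_measurable (borel \<Otimes>\<^sub>M borel)"
    and h: "integrable lborel h" and bound: "\<And>s x. \<psi> s \<noteq> 0 \<Longrightarrow> norm (k s x) \<le> h x"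
  shows "(\<integral>s. \<psi> s *\<^sub>R (\<integral>x. k s x \<partial>lborel) \<partial>lborel) = (\<integral>x. (\<integral>s. \<psi> s *\<^sub>R k s x \<partial>lborel) \<partial>lborel)"
    and "integrable lborel (\<lambda>x. \<integral>s. \<psi> s *\<^sub>R k s x \<partial>lborel)"
proof -
  note int = integrable_weighted_pair[OF assms]
  have "(\<integral>s. \<psi> s *\<^sub>R (\<integral>x. k s x \<partial>lborel) \<partial>lborel) = (\<integral>s. (\<integral>x. \<psi> s *\<^sub>R k s x \<partial>lborel) \<partial>lborel)"
    by simp
  also have "\<dots> = (\<integral>x. (\<integral>s. \<psi> s *\<^sub>R k s x \<partial>lborel) \<partial>lborel)"
    using lborel_pair.Fubini_integral[OF int] by simp
  finally show "(\<integral>s. \<psi> s *\<^sub>R (\<integral>x. k s x \<partial>lborel) \<partial>lborel) = (\<integral>x. (\<integral>s. \<psi> s *\<^sub>R k s x \<partial>lborel) \<partial>lborel)" .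
  show "integrable lborel (\<lambda>x. \<integral>s. \<psi> s *\<^sub>R k s x \<partial>lborel)"
    using lborel_pair.integrable_snd[OF int] by simp
qed

section \<open>Upper and lower bounds for the scalar kernel\<close>

lemma norm_cis_diff_le: "cmod (cis a - cis b) \<le> \<bar>a - b\<bar>"
proof -
  have "cis a - cis b = cis b * (iexp (a - b) - 1)"
    by (simp add: cis_conv_exp algebra_simps flip: exp_add)
  then show ?thesis
    using iexp_approx1[of "a - b" 0] by (simp add: norm_mult)
qed

lemma cmod_cis_minus_1_square: "(cmod (cis y - 1))\<^sup>2 = 2 - 2 * cos y"
  unfolding cmod_power2 using sin_cos_squared_add[of y] by (simp add: power2_diff)

lemma cmod_increment_kernel_square: "(cmod (increment_kernel t x))\<^sup>2 = (2 - 2 * cos (t * x)) / x\<^sup>2"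
  by (simp add: increment_kernel_def norm_divide norm_mult power_divide cmod_cis_minus_1_square)

text \<open>Combines the two bounds t^2 and 4/x^2 of the squared kernel, one for small and one for
  large frequencies. At x = 0 the kernel is 0 through division by zero.\<close>

lemma cmod_increment_kernel_le: "(cmod (increment_kernel t x))\<^sup>2 \<le> (4 + t\<^sup>2) / (1 + x\<^sup>2)"
proof (cases "x = 0")
  case True
  then show ?thesis by (simp add: increment_kernel_def)
next
  case False
  have "(cmod (cis (t * x) - cis 0))\<^sup>2 \<le> (t * x)\<^sup>2"
    using power_mono[OF norm_cis_diff_le[of "t * x" 0] norm_ge_zero, of 2] by simp
  then have 1: "(2 - 2 * cos (t * x)) / x\<^sup>2 \<le> t\<^sup>2"
    using False by (simp add: cmod_cis_minus_1_square divide_le_eq power_mult_distrib)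
  have "2 - 2 * cos (t * x) \<le> 4"
    using cos_ge_minus_one[of "t * x"] by linarith
  with 1 have "(2 - 2 * cos (t * x)) / x\<^sup>2 * (1 + x\<^sup>2) \<le> 4 + t\<^sup>2"
    using False by (simp add: distrib_left)
  moreover have "0 < 1 + x\<^sup>2"
    by (simp add: add_pos_nonneg)
  ultimately show ?thesis
    by (simp add: cmod_increment_kernel_square le_divide_eq)
qed

lemma cmod_increment_kernel_mult_le:
  assumes "\<bar>s\<bar> \<le> R" "\<bar>t\<bar> \<le> R"
  shows "cmod (increment_kernel s x) * cmod (increment_kernel t x) \<le> (4 + R\<^sup>2) / (1 + x\<^sup>2)"
proof -
  have *: "(cmod (increment_kernel u x))\<^sup>2 \<le> (4 + R\<^sup>2) / (1 + x\<^sup>2)" if "\<bar>u\<bar> \<le> R" for u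
  proof -
    have "u\<^sup>2 \<le> R\<^sup>2"
      using power_mono[OF that, of 2] by simp
    then have "(4 + u\<^sup>2) / (1 + x\<^sup>2) \<le> (4 + R\<^sup>2) / (1 + x\<^sup>2)"
      by (intro divide_right_mono) auto
    then show ?thesis
      using cmod_increment_kernel_le[of u x] by linarith
  qed
  show ?thesis
    using sum_squares_bound[of "cmod (increment_kernel s x)"
        "cmod (increment_kernel t x)"] *[OF assms(1)] *[OF assms(2)]
    by linarith
qed

text \<open>The low frequencies. With y = x/4 the squared kernel is 4 sin(y)^2 / x^2, and the
  absolute value of sin y is at least 5/6 of that of y as long as the latter is at most 1; this
  gives 25/144, slightly above 1/6.\<close>

lemma increment_kernel_half_ge:
  assumes "\<bar>x\<bar> \<le> 4" "x \<noteq> 0"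
  shows "1 / 6 \<le> (cmod (increment_kernel (1 / 2) x))\<^sup>2"
proof -
  define y where "y = x / 4"
  have y: "y\<^sup>2 \<le> 1" "y \<noteq> 0"
    using assms by (auto simp: y_def abs_square_le_1)
  have "\<bar>sin y - y\<bar> \<le> \<bar>y\<bar> ^ 3 / 6"
    using Maclaurin_sin_bound[of y 3] by (simp add: numeral_3_eq_3 sin_coeff_def fact_numeral)
  moreover have "\<bar>y\<bar> ^ 3 \<le> \<bar>y\<bar>"
    using y(1) mult_left_mono[of "y\<^sup>2" 1 "\<bar>y\<bar>"] by (simp add: power3_eq_cube power2_eq_square)
  ultimately have "5 / 6 * \<bar>y\<bar> \<le> \<bar>sin y\<bar>"
    by linarith
  then have "(5 / 6 * \<bar>y\<bar>)\<^sup>2 \<le> \<bar>sin y\<bar>\<^sup>2"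
    by (intro power_mono) auto
  then have "25 / 36 * y\<^sup>2 \<le> (sin y)\<^sup>2"
    by (simp add: power_mult_distrib power2_eq_square)
  moreover have "2 - 2 * cos (1 / 2 * x) = 4 * (sin y)\<^sup>2"
    using cos_double_sin[of y] by (simp add: y_def)
  moreover have "x\<^sup>2 = 16 * y\<^sup>2"
    by (simp add: y_def power_divide)
  ultimately have "x\<^sup>2 / 6 \<le> 2 - 2 * cos (1 / 2 * x)"
    using zero_le_power2[of y] by linarith
  then show ?thesis
    using assms(2) by (simp add: cmod_increment_kernel_square le_divide_eq)
qed

text \<open>The high frequencies. Integrating 2 - 2 cos(tx) over t from 1 to 2 gives 2 - 2 (sin 2x -
  sin x)/x, and beyond 4 the oscillating part is at most 1 in absolute value.\<close>

lemma increment_kernel_average_ge: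
  assumes "4 < \<bar>x\<bar>"
  shows "ennreal (1 / (1 + x\<^sup>2)) \<le> (\<integral>\<^sup>+t. ennreal ((cmod (increment_kernel t x))\<^sup>2)
      * indicator {1..2} t \<partial>lborel)"
proof -
  have x: "x \<noteq> 0" using assms by auto
  let ?F = "\<lambda>t. (2 * t - 2 * sin (t * x) / x) / x\<^sup>2"
  have "(\<integral>\<^sup>+t. ennreal ((cmod (increment_kernel t x))\<^sup>2) * indicator {1..2} t \<partial>lborel)
      = ennreal (?F 2 - ?F 1)"
  proof (rule nn_integral_FTC_Icc)
    show "(\<lambda>t. (cmod (increment_kernel t x))\<^sup>2) \<in> borel_measurable borel"
      unfolding cmod_increment_kernel_square by measurable
    show "(?F has_real_derivative (cmod (increment_kernel t x))\<^sup>2) (at t)" for t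
      unfolding cmod_increment_kernel_square using x
      by (auto intro!: derivative_eq_intros simp: field_simps)
  qed auto
  also have "?F 2 - ?F 1 = (2 - 2 * (sin (2 * x) - sin x) / x) / x\<^sup>2"
    using x by (simp add: field_simps)
  finally have eq: "(\<integral>\<^sup>+t. ennreal ((cmod (increment_kernel t x))\<^sup>2) * indicator {1..2} t \<partial>lborel)
      = ennreal ((2 - 2 * (sin (2 * x) - sin x) / x) / x\<^sup>2)" .
  have "\<bar>sin (2 * x) - sin x\<bar> \<le> 2"
    using abs_sin_le_one[of x] abs_sin_le_one[of "2 * x"] by linarith
  then have "\<bar>2 * (sin (2 * x) - sin x) / x\<bar> \<le> 4 / \<bar>x\<bar>"
    by (simp add: abs_mult divide_right_mono)
  also have "4 / \<bar>x\<bar> \<le> 1"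
    using assms by simp
  finally have "1 \<le> 2 - 2 * (sin (2 * x) - sin x) / x"
    by linarith
  then have "1 / x\<^sup>2 \<le> (2 - 2 * (sin (2 * x) - sin x) / x) / x\<^sup>2"
    by (rule divide_right_mono) simp
  moreover have "1 / (1 + x\<^sup>2) \<le> 1 / x\<^sup>2"
    using x by (intro divide_left_mono) (auto simp: add_pos_nonneg)
  ultimately show ?thesis
    unfolding eq by (intro ennreal_leI) linarith
qed

lemma norm_matrix_square: "(norm P)\<^sup>2 = (\<Sum>i\<in>UNIV. \<Sum>j\<in>UNIV. (cmod (P $ i $ j))\<^sup>2)" for P :: "complex^'n^'m"
  by (simp add: power2_norm_eq_inner inner_vec_def)

lemma cmod_mult_hermitian_le: "cmod ((P ** hermitian_transpose P) $ i $ j)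
    \<le> (norm P)\<^sup>2" for P :: "complex^'n^'m"
proof -
  have row: "(\<Sum>k\<in>UNIV. (cmod (P $ i $ k))\<^sup>2) \<le> (norm P)\<^sup>2" for i
    unfolding norm_matrix_square by (rule member_le_sum[where f
        = "\<lambda>i. \<Sum>k\<in>UNIV. (cmod (P $ i $ k))\<^sup>2"]) (auto intro: sum_nonneg)
  have "cmod ((P ** hermitian_transpose P) $ i $ j) \<le> (\<Sum>k\<in>UNIV. cmod (P $ i $ k) * cmod (P $ j $ k))"
    unfolding matrix_mult_component by (rule order_trans[OF norm_sum]) (simp add: norm_mult)
  also have "\<dots> \<le> (\<Sum>k\<in>UNIV. ((cmod (P $ i $ k))\<^sup>2 + (cmod (P $ j $ k))\<^sup>2) / 2)"
  proof (rule sum_mono)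
    fix k
    show "cmod (P $ i $ k) * cmod (P $ j $ k) \<le> ((cmod (P $ i $ k))\<^sup>2 + (cmod (P $ j $ k))\<^sup>2) / 2"
      using sum_squares_bound[of "cmod (P $ i $ k)" "cmod (P $ j $ k)"] by simp
  qed
  also have "\<dots> = ((\<Sum>k\<in>UNIV. (cmod (P $ i $ k))\<^sup>2) + (\<Sum>k\<in>UNIV. (cmod (P $ j $ k))\<^sup>2)) / 2"
    by (simp add: sum.distrib flip: sum_divide_distrib)
  also have "\<dots> \<le> (norm P)\<^sup>2"
    using row[of i] row[of j] by simp
  finally show ?thesis .
qed

context ofbm_process
begin

text \<open>The trace turns S S^* into the squared norm of S, hence the matrix spectral integral
  into one with a nonnegative integrand, to which Tonelli's theorem applies.\<close>

lemma trace_\<Gamma>: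
  "integrable lborel (\<lambda>x. (cmod (\<kappa> t x))\<^sup>2 * (norm (S x))\<^sup>2)"
  "(\<Sum>i\<in>UNIV. \<Gamma> t t $ i $ i) = (\<integral>x. (cmod (\<kappa> t x))\<^sup>2 * (norm (S x))\<^sup>2 \<partial>lborel)"
proof -
  have eq: "(\<Sum>i\<in>UNIV. \<kappa> t x * cnj (\<kappa> t x) * (S x ** hermitian_transpose (S x)) $ i $ i)
      = complex_of_real ((cmod (\<kappa> t x))\<^sup>2 * (norm (S x))\<^sup>2)" for x
    by (simp add: norm_matrix_square matrix_mult_component complex_norm_square sum_distrib_left ac_simps
        del: of_real_power)
  have "integrable lborel (\<lambda>x. \<Sum>i\<in>UNIV. \<kappa> t x * cnj (\<kappa> t x) * (S x ** hermitian_transpose (S x)) $ i $ i)"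
    by (intro Bochner_Integration.integrable_sum spectral_component)
  then show int: "integrable lborel (\<lambda>x. (cmod (\<kappa> t x))\<^sup>2 * (norm (S x))\<^sup>2)"
    unfolding eq complex_of_real_integrable_eq .
  have "complex_of_real (\<Sum>i\<in>UNIV. \<Gamma> t t $ i $ i)
      = (\<integral>x. complex_of_real ((cmod (\<kappa> t x))\<^sup>2 * (norm (S x))\<^sup>2) \<partial>lborel)"
    unfolding eq[symmetric] using spectral_component by (subst Bochner_Integration.integral_sum) auto
  then show "(\<Sum>i\<in>UNIV. \<Gamma> t t $ i $ i) = (\<integral>x. (cmod (\<kappa> t x))\<^sup>2 * (norm (S x))\<^sup>2 \<partial>lborel)"
    unfolding integral_complex_of_real of_real_eq_iff .
qed

text \<open>By self-similarity the variance at t is t^H times the one at 1 times the transpose of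
  t^H, and for t in [1,2] the entries of t^H are bounded by exp of the operator norm of H because ln
  t lies in [0,1].\<close>

lemma trace_\<Gamma>_bounded:
  obtains C where "\<And>t. t \<in> {1..2} \<Longrightarrow> (\<Sum>i\<in>UNIV. \<Gamma> t t $ i $ i) \<le> C"
proof
  fix t :: real assume t: "t \<in> {1..2}"
  let ?P = "mat_powr t H" and ?a = "exp (onorm ((*v) H))"
  have bl: "bounded_linear ((*v) H)"
    by simp
  have P: "\<bar>?P $ i $ j\<bar> \<le> ?a" for i j
  proof -
    have "\<bar>ln t\<bar> \<le> 1"
      using t ln_bound[of t] ln_le_minus_one[of t] by (auto simp: ln_ge_zero)
    moreover have "onorm ((*v) (ln t *\<^sub>R H)) = \<bar>ln t\<bar> * onorm ((*v) H)"
      using onorm_scaleR[OF bl, of "ln t"] by (simp add: scaleR_matrix_vector_assoc)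
    ultimately have "onorm ((*v) (ln t *\<^sub>R H)) \<le> onorm ((*v) H)"
      using onorm_pos_le[OF bl] by (simp add: mult_left_le_one_le)
    then show ?thesis
      using mat_exp_component_le[of "ln t *\<^sub>R H" i j] t
      by (simp add: mat_powr_def) (meson exp_le_cancel_iff order_trans)
  qed
  have "\<Gamma> t t $ i $ i \<le> (\<Sum>l\<in>UNIV. \<Sum>k\<in>UNIV. ?a * \<bar>\<Gamma> 1 1 $ k $ l\<bar> * ?a)" for i
  proof -
    have "\<Gamma> t t $ i $ i = (\<Sum>l\<in>UNIV. \<Sum>k\<in>UNIV. ?P $ i $ k * \<Gamma> 1 1 $ k $ l * ?P $ i $ l)"
      using t by (subst \<Gamma>_diagonal) (simp add: matrix_mult_component mat_powr_transpose
          sum_distrib_right, simp add: transpose_def)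
    also have "\<dots> \<le> (\<Sum>l\<in>UNIV. \<Sum>k\<in>UNIV. ?a * \<bar>\<Gamma> 1 1 $ k $ l\<bar> * ?a)"
    proof (intro sum_mono)
      fix k l
      have "?P $ i $ k * \<Gamma> 1 1 $ k $ l * ?P $ i $ l \<le> \<bar>?P $ i $ k\<bar> * \<bar>\<Gamma> 1 1 $ k $ l\<bar> * \<bar>?P $ i $ l\<bar>"
        by (metis abs_ge_self abs_mult)
      also have "\<dots> \<le> ?a * \<bar>\<Gamma> 1 1 $ k $ l\<bar> * ?a"
        by (intro mult_mono P) auto
      finally show "?P $ i $ k * \<Gamma> 1 1 $ k $ l * ?P $ i $ l \<le> ?a * \<bar>\<Gamma> 1 1 $ k $ l\<bar> * ?a" .
    qed
    finally show ?thesis .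
  qed
  then show "(\<Sum>i\<in>UNIV. \<Gamma> t t $ i $ i) \<le> (\<Sum>i\<in>(UNIV :: 'n set). \<Sum>l\<in>UNIV. \<Sum>k\<in>UNIV. ?a * \<bar>\<Gamma> 1 1 $ k $ l\<bar> * ?a)"
    by (rule sum_mono)
qed

text \<open>Averaging the self-similar variances over \<open>t\<close> between 1 and 2 removes the zeros of
  the factor $|e^{itx} - 1|^2$ for large \<open>x\<close>.\<close>

lemma spectral_weight_integrable: "integrable lborel (\<lambda>x. (norm (S x))\<^sup>2 / (1 + x\<^sup>2))"
proof -
  obtain C where C: "\<And>t. t \<in> {1..2} \<Longrightarrow> (\<Sum>i\<in>UNIV. \<Gamma> t t $ i $ i) \<le> C"
    using trace_\<Gamma>_bounded by blast
  let ?w = "\<lambda>x. (norm (S x))\<^sup>2"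
  let ?f = "\<lambda>t x. ennreal ((cmod (\<kappa> t x))\<^sup>2 * ?w x)"
  have nn: "(\<integral>\<^sup>+x. ?f t x \<partial>lborel) = ennreal (\<Sum>i\<in>UNIV. \<Gamma> t t $ i $ i)" for t
    unfolding trace_\<Gamma>(2) by (intro nn_integral_eq_integral trace_\<Gamma>) simp
  \<comment> \<open>Tonelli: the integral of the bounded variances over t in [1,2] is finite, so the
    averaged squared kernel times the weight is integrable in x.\<close>
  have "(\<integral>\<^sup>+x. (\<integral>\<^sup>+t. ?f t x * indicator {1..2} t \<partial>lborel) \<partial>lborel) =
      (\<integral>\<^sup>+t. (\<integral>\<^sup>+x. ?f t x * indicator {1..2} t \<partial>lborel) \<partial>lborel)"
    by (rule lborel_pair.Fubini') measurable
  also have "\<dots> = (\<integral>\<^sup>+t. ennreal (\<Sum>i\<in>UNIV. \<Gamma> t t $ i $ i) * indicator {1..2} t \<partial>lborel)"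
    by (simp add: nn_integral_multc nn)
  also have "\<dots> \<le> (\<integral>\<^sup>+t. ennreal C * indicator {1..2 :: real} t \<partial>lborel)"
    using C by (intro nn_integral_mono) (auto simp: indicator_def intro!: ennreal_leI)
  also have "\<dots> < \<infinity>"
    by (simp add: nn_integral_cmult ennreal_mult_less_top)
  finally have average: "(\<integral>\<^sup>+x. (\<integral>\<^sup>+t. ?f t x * indicator {1..2} t \<partial>lborel) \<partial>lborel) < \<infinity>" .
  have "(\<integral>\<^sup>+x. ennreal (?w x / (1 + x\<^sup>2)) \<partial>lborel)
      \<le> (\<integral>\<^sup>+x. 6 * ?f (1 / 2) x + (\<integral>\<^sup>+t. ?f t x * indicator {1..2} t \<partial>lborel) \<partial>lborel)"
  proof (rule nn_integral_mono)
    fix x :: real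
    \<comment> \<open>At 0 the weight vanishes because S does; near 0 the single time 1/2 controls
      the weight, with 6 inverting the lower bound 1/6; beyond 4 the average over t takes
      over.\<close>
    consider "x = 0" | "x \<noteq> 0" "\<bar>x\<bar> \<le> 4" | "4 < \<bar>x\<bar>" by linarith
    then show "ennreal (?w x / (1 + x\<^sup>2)) \<le> 6 * ?f (1 / 2) x + (\<integral>\<^sup>+t. ?f t x * indicator {1..2} t \<partial>lborel)"
    proof cases
      case 1
      then show ?thesis by simp
    next
      case 2
      have "1 / (1 + x\<^sup>2) \<le> 1"
        by (simp add: add_pos_nonneg divide_le_eq)
      then have "1 / (1 + x\<^sup>2) \<le> 6 * (cmod (\<kappa> (1 / 2) x))\<^sup>2"
        using increment_kernel_half_ge[OF 2(2,1)] by linarith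
      then have "1 / (1 + x\<^sup>2) * ?w x \<le> 6 * (cmod (\<kappa> (1 / 2) x))\<^sup>2 * ?w x"
        by (rule mult_right_mono) simp
      then have "ennreal (?w x / (1 + x\<^sup>2)) \<le> ennreal (6 * ((cmod (\<kappa> (1 / 2) x))\<^sup>2 * ?w x))"
        by (intro ennreal_leI) simp
      also have "\<dots> = 6 * ?f (1 / 2) x"
        by (subst ennreal_mult) auto
      also have "\<dots> \<le> 6 * ?f (1 / 2) x + (\<integral>\<^sup>+t. ?f t x * indicator {1..2} t \<partial>lborel)"
        by simp
      finally show ?thesis .
    next
      case 3
      have "ennreal (?w x / (1 + x\<^sup>2)) = ennreal (1 / (1 + x\<^sup>2)) * ennreal (?w x)"
        by (simp flip: ennreal_mult')
      also have "\<dots> \<le> (\<integral>\<^sup>+t. ennreal ((cmod (\<kappa> t x))\<^sup>2) * indicator {1..2} t \<partial>lborel) * ennreal (?w x)"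
        by (rule mult_right_mono[OF increment_kernel_average_ge[OF 3]]) simp
      also have "\<dots> = (\<integral>\<^sup>+t. ennreal ((cmod (\<kappa> t x))\<^sup>2) * indicator {1..2} t * ennreal (?w x) \<partial>lborel)"
        unfolding cmod_increment_kernel_square by (rule nn_integral_multc[symmetric]) measurable
      also have "\<dots> = (\<integral>\<^sup>+t. ?f t x * indicator {1..2} t \<partial>lborel)"
        by (intro nn_integral_cong) (simp add: ennreal_mult ac_simps)
      finally show ?thesis
        by (simp add: add_increasing)
    qed
  qed
  also have "\<dots> = 6 * (\<integral>\<^sup>+x. ?f (1 / 2) x \<partial>lborel)
      + (\<integral>\<^sup>+x. (\<integral>\<^sup>+t. ?f t x * indicator {1..2} t \<partial>lborel) \<partial>lborel)"
    by (subst nn_integral_add) (auto simp: nn_integral_cmult)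
  also have "\<dots> < \<infinity>"
    unfolding nn using average by (simp add: ennreal_mult_less_top)
  finally have "(\<integral>\<^sup>+x. ennreal (?w x / (1 + x\<^sup>2)) \<partial>lborel) < \<infinity>" .
  then show ?thesis
    by (intro integrableI_nonneg) auto
qed

text \<open>The dominating function depends on the times only through R; it serves for the
  continuity of \<Gamma> and for both exchanges of integrals in the wavelet spectrum.\<close>

lemma spectral_integrand_le:
  assumes "\<bar>s\<bar> \<le> R" "\<bar>t\<bar> \<le> R"
  shows "cmod (\<kappa> s x * cnj (\<kappa> t x) * (S x ** hermitian_transpose (S x)) $ i $ j)
    \<le> (4 + R\<^sup>2) * ((norm (S x))\<^sup>2 / (1 + x\<^sup>2))"
proof -
  have "cmod (\<kappa> s x * cnj (\<kappa> t x) * (S x ** hermitian_transpose (S x)) $ i $ j)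
      = (cmod (\<kappa> s x) * cmod (\<kappa> t x)) * cmod ((S x ** hermitian_transpose (S x)) $ i $ j)"
    by (simp add: norm_mult)
  also have "\<dots> \<le> (4 + R\<^sup>2) / (1 + x\<^sup>2) * (norm (S x))\<^sup>2"
    by (intro mult_mono cmod_increment_kernel_mult_le cmod_mult_hermitian_le assms)
        (auto intro!: divide_nonneg_nonneg)
  finally show ?thesis by simp
qed

text \<open>Dominated convergence in the spectral representation: a convergent sequence of times is
  bounded, so \<open>spectral_integrand_le\<close> applies with one R.\<close>

lemma \<Gamma>_continuous: "continuous_on UNIV (\<lambda>p. \<Gamma> (fst p) (snd p))"
proof -
  have "((\<lambda>n. \<Gamma> (fst (u n)) (snd (u n)) $ i $ j) \<longlongrightarrow> \<Gamma> (fst l) (snd l) $ i $ j) sequentially"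
    if u: "u \<longlonglongrightarrow> l" for u :: "nat \<Rightarrow> real \<times> real" and l i j
  proof -
    let ?f = "\<lambda>p x. \<kappa> (fst p) x * cnj (\<kappa> (snd p) x) * (S x ** hermitian_transpose (S x)) $ i $ j"
    obtain R where R: "\<And>n. norm (u n) \<le> R"
      using convergent_imp_Bseq[OF convergentI[OF u]] by (auto simp: Bseq_def)
    have R': "\<bar>fst (u n)\<bar> \<le> R" "\<bar>snd (u n)\<bar> \<le> R" for n
      using R[of n] norm_fst_le[of "fst (u n)" "snd (u n)"] norm_snd_le[of "snd (u n)" "fst (u n)"] by auto
    have "(\<lambda>n. \<integral>x. ?f (u n) x \<partial>lborel) \<longlonglongrightarrow> (\<integral>x. ?f l x \<partial>lborel)"
    proof (rule integral_dominated_convergence[where w = "\<lambda>x. (4 + R\<^sup>2) * ((norm (S x))\<^sup>2 / (1 + x\<^sup>2))"])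
      show "integrable lborel (\<lambda>x. (4 + R\<^sup>2) * ((norm (S x))\<^sup>2 / (1 + x\<^sup>2)))"
        by (rule integrable_mult_right[OF spectral_weight_integrable])
      show "AE x in lborel. norm (?f (u n) x) \<le> (4 + R\<^sup>2) * ((norm (S x))\<^sup>2 / (1 + x\<^sup>2))" for n
        by (intro AE_I2 spectral_integrand_le R')
      show "AE x in lborel. (\<lambda>n. ?f (u n) x) \<longlonglongrightarrow> ?f l x"
        unfolding increment_kernel_def cis_conv_exp divide_inverse
        by (intro AE_I2 tendsto_intros tendsto_fst tendsto_snd u)
    qed (intro borel_measurable_integrable spectral_component(1))+
    then have "(\<lambda>n. complex_of_real (\<Gamma> (fst (u n)) (snd (u n)) $ i $ j))
        \<longlonglongrightarrow> complex_of_real (\<Gamma> (fst l) (snd l) $ i $ j)"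
      unfolding spectral_component(2) .
    then show ?thesis
      by (simp add: tendsto_of_real_iff)
  qed
  then have "((\<lambda>n. \<Gamma> (fst (u n)) (snd (u n))) \<longlongrightarrow> \<Gamma> (fst l) (snd l)) sequentially"
    if "u \<longlonglongrightarrow> l" for u :: "nat \<Rightarrow> real \<times> real" and l
    using that by (intro vec_tendstoI)
  then show ?thesis
    by (auto simp: continuous_on_sequentially o_def)
qed

lemma \<Gamma>_measurable [measurable]:
  assumes [measurable]: "f \<in> borel_measurable L" "g \<in> borel_measurable L"
  shows "(\<lambda>x. \<Gamma> (f x) (g x)) \<in> borel_measurable L"
  using \<Gamma>_continuous by (intro borel_measurable_continuous_Pair[where H = \<Gamma>]) auto

text \<open>A wavelet coefficient integrates B along the affine times 2^j z + 2^j k, so the general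
  theory is applied to these reparametrised processes.\<close>

lemma sampled_process: "ms_continuous_process M (\<lambda>z. B (a * z + b))"
proof unfold_locales
  show "square_integrable_rv M (B (a * t + b))" for t
    by (rule square_integrable)
  have "expectation (\<lambda>\<omega>. B s \<omega> \<bullet> B t \<omega>) = (\<Sum>i\<in>UNIV. \<Gamma> s t $ i $ i)" for s t
    unfolding \<Gamma>_component inner_vec_def inner_real_def
    using integral_matrix_component(2)[OF outer_integrable]
    by (intro Bochner_Integration.integral_sum) simp
  moreover have "continuous_on UNIV (\<lambda>p. \<Sum>i\<in>UNIV. \<Gamma> (a * fst p + b) (a * snd p + b) $ i $ i)"
    by (intro continuous_intros continuous_on_compose2[OF \<Gamma>_continuous, of _
        "\<lambda>p. (a * fst p + b, a * snd p + b)", simplified])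
  ultimately show "continuous_on UNIV (\<lambda>(s, t). expectation (\<lambda>\<omega>. B (a * s + b) \<omega> \<bullet> B (a * t + b) \<omega>))"
    by (simp add: case_prod_beta)
qed

lemma linear_functionals_sampled:
  "linear_functionals (\<lambda>z. B (g z)) \<subseteq> linear_functionals B"
proof
  fix V assume "V \<in> linear_functionals (\<lambda>z. B (g z))"
  then obtain J c where V: "V = (\<lambda>\<omega>. \<Sum>z\<in>J. c z \<bullet> B (g z) \<omega>)"
    by (auto simp: linear_functionals_def)
  show "V \<in> linear_functionals B"
    unfolding V by (rule linear_functionals_sum, rule linear_functionals_component)
qed

lemma closed_linear_span_sampled:
  "closed_linear_span M (\<lambda>z. B (g z)) \<subseteq> closed_linear_span M B"
proof
  fix V assume V: "V \<in> closed_linear_span M (\<lambda>z. B (g z))"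
  then obtain Vn where "\<And>n::nat. Vn n \<in> linear_functionals (\<lambda>z. B (g z))"
      and lim: "(\<lambda>n. ms_norm M (\<lambda>\<omega>. V \<omega> - Vn n \<omega>)) \<longlonglongrightarrow> 0"
    by (auto simp: closed_linear_span_def)
  then have "Vn n \<in> linear_functionals B" for n
    using linear_functionals_sampled by blast
  with lim closed_linear_span_square_integrable[OF V] show "V \<in> closed_linear_span M B"
    unfolding closed_linear_span_def by (intro CollectI conjI exI[of _ Vn] allI)
qed

end


section \<open>Covariance of the wavelet coefficients\<close>

lemma mat_powr_power: "mat_powr 2 (real j *\<^sub>R P) = mat_powr (2 ^ j) P"
  by (simp add: mat_powr_def ln_realpow mult.commute)

text \<open>For every x one of x_+ and x_- is 0, and its power is the zero matrix by convention; so
  S S^* has no mixed terms.\<close>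

lemma spectral_factor_mult_hermitian:
  "spectral_factor H A x ** hermitian_transpose (spectral_factor H A x) =
    mat_complex (mat_powr (max x 0) (- ofbm_exponent H)) ** (A ** hermitian_transpose A) **
      mat_complex (mat_powr (max x 0) (- transpose (ofbm_exponent H))) +
    mat_complex (mat_powr (max (- x) 0) (- ofbm_exponent H)) ** mat_cnj (A ** hermitian_transpose A) **
      mat_complex (mat_powr (max (- x) 0) (- transpose (ofbm_exponent H)))"
proof -
  have T: "mat_powr c (- transpose (ofbm_exponent H)) = transpose (mat_powr c (- ofbm_exponent H))" for c
    using mat_powr_transpose[of c "- ofbm_exponent H"]
    by (simp add: transpose_def uminus_vec_def vec_eq_iff)
  have Z: "P ** 0 = 0" "0 ** P = 0" for P :: "complex^'a^'a"
    by (simp_all add: vec_eq_iff matrix_mult_component)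
  have cnj: "mat_cnj A ** hermitian_transpose (mat_cnj A) = mat_cnj (A ** hermitian_transpose A)"
    by (simp add: vec_eq_iff matrix_mult_component)
  consider "x \<ge> 0" "max (- x) 0 = 0" | "x \<le> 0" "max x 0 = 0" by linarith
  then show ?thesis
  proof cases
    case 1
    then show ?thesis
      unfolding spectral_factor_def 1(2) T
      by (simp add: hermitian_transpose_mult hermitian_transpose_mat_complex matrix_mul_assoc Z)
  next
    case 2
    have "mat_complex P ** mat_cnj A ** hermitian_transpose (mat_complex P ** mat_cnj A)
        = mat_complex P ** (mat_cnj A ** hermitian_transpose (mat_cnj A)) ** mat_complex
            (transpose P)" for P
      by (simp add: hermitian_transpose_mult hermitian_transpose_mat_complex matrix_mul_assoc)
    then show ?thesis
      unfolding spectral_factor_def 2(2) T cnj by (simp add: Z)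
  qed
qed

locale ofbm_wavelet = ofbm_process M B N Bt H A
  for M :: "'a measure" and B :: "real \<Rightarrow> 'a \<Rightarrow> real^'n"
    and N :: "'b measure" and Bt :: "real set \<Rightarrow> 'b \<Rightarrow> complex^'n"
    and H :: "real^'n^'n" and A :: "complex^'n^'n" +
  fixes \<psi> :: "real \<Rightarrow> real" and N\<^sub>\<psi> :: nat and \<alpha> :: real
  assumes wavelet: "wavelet \<psi> N\<^sub>\<psi> \<alpha>"
begin

lemma \<psi>_integrable: "integrable lborel \<psi>"
  using wavelet by (simp add: wavelet_def)

lemma \<psi>_measurable [measurable]: "\<psi> \<in> borel_measurable borel"
  using \<psi>_integrable by auto

lemma \<psi>_mean: "(\<integral>t. \<psi> t \<partial>lborel) = 0"
proof -
  have "\<forall>q<N\<^sub>\<psi>. (\<integral>t. t ^ q * \<psi> t \<partial>lborel) = 0" "N\<^sub>\<psi> \<ge> 2"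
    using wavelet by (auto simp: wavelet_def)
  then have "(\<integral>t. t ^ 0 * \<psi> t \<partial>lborel) = 0"
    by (metis less_le_trans pos2)
  then show ?thesis by simp
qed

lemma \<psi>_support: obtains R where "R \<ge> 0" "\<And>t. \<psi> t \<noteq> 0 \<Longrightarrow> \<bar>t\<bar> \<le> R"
proof -
  obtain a b where ab: "closure {t. \<psi> t \<noteq> 0} = {a..b}"
    using wavelet by (auto simp: wavelet_def)
  show ?thesis
  proof
    show "0 \<le> max \<bar>a\<bar> \<bar>b\<bar>" by simp
    fix t assume "\<psi> t \<noteq> 0"
    then have "t \<in> closure {t. \<psi> t \<noteq> 0}"
      by (intro subsetD[OF closure_subset]) simp
    then have "a \<le> t" "t \<le> b"
      unfolding ab by auto
    then show "\<bar>t\<bar> \<le> max \<bar>a\<bar> \<bar>b\<bar>" by linarith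
  qed
qed

section \<open>Double integrals against the wavelet in both variables\<close>

definition double_integral :: "(real \<Rightarrow> real \<Rightarrow> real^'n^'n) \<Rightarrow> real^'n^'n" where
  "double_integral F = (\<integral>t'. (\<integral>t. (\<psi> t * \<psi> t') *\<^sub>R F t t' \<partial>lborel) \<partial>lborel)"

text \<open>F is bounded on the compact square outside of which \<psi>(t) \<psi>(t') vanishes, so
  integrability of \<psi> suffices.\<close>

lemma double_integral_integrable:
  assumes F: "continuous_on UNIV (\<lambda>p. F (fst p) (snd p) :: real^'n^'n)"
  shows "integrable (lborel \<Otimes>\<^sub>M lborel) (\<lambda>(t, t'). (\<psi> t * \<psi> t') *\<^sub>R F t t')"
proof -
  obtain R where R: "R \<ge> 0" "\<And>t. \<psi> t \<noteq> 0 \<Longrightarrow> \<bar>t\<bar> \<le> R"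
    by (rule \<psi>_support) blast
  have "compact ((\<lambda>p. F (fst p) (snd p)) ` ({-R..R} \<times> {-R..R}))"
    by (intro compact_continuous_image compact_Times compact_Icc continuous_on_subset[OF F]) auto
  from compact_imp_bounded[OF this]
  obtain C where C: "\<forall>p\<in>{-R..R} \<times> {-R..R}. norm (F (fst p) (snd p)) \<le> C"
    unfolding bounded_iff by auto
  have [measurable]: "(\<lambda>p. F (fst p) (snd p)) \<in> borel_measurable (borel \<Otimes>\<^sub>M borel)"
    using borel_measurable_continuous_onI[OF F] by (simp add: borel_prod)
  have "integrable (lborel \<Otimes>\<^sub>M lborel) (\<lambda>(t, t'). \<psi> t *\<^sub>R (\<psi> t' *\<^sub>R F t t'))"
  proof (rule integrable_weighted_pair[OF \<psi>_integrable])
    show "integrable lborel (\<lambda>t'. \<bar>\<psi> t'\<bar> * C)"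
      using \<psi>_integrable by simp
    show "(\<lambda>p. \<psi> (snd p) *\<^sub>R F (fst p) (snd p)) \<in> borel_measurable (borel \<Otimes>\<^sub>M borel)"
      by measurable
    fix t t' assume t: "\<psi> t \<noteq> 0"
    show "norm (\<psi> t' *\<^sub>R F t t') \<le> \<bar>\<psi> t'\<bar> * C"
    proof (cases "\<psi> t' = 0")
      case False
      have "(t, t') \<in> {-R..R} \<times> {-R..R}"
        using R(2)[OF t] R(2)[OF False] by auto
      with C have "norm (F t t') \<le> C" by fastforce
      then show ?thesis by (simp add: mult_left_mono)
    qed simp
  qed
  then show ?thesis by simp
qed

lemma double_integral_eq_product:
  assumes "continuous_on UNIV (\<lambda>p. F (fst p) (snd p))"
  shows "double_integral F = (\<integral>p. (\<psi> (fst p) * \<psi> (snd p)) *\<^sub>R F (fst p) (snd p) \<partial>(lborel \<Otimes>\<^sub>M lborel))"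
  using lborel_pair.integral_snd[OF double_integral_integrable[OF assms]]
  by (simp add: double_integral_def case_prod_unfold)

lemma double_integral_add:
  assumes "continuous_on UNIV (\<lambda>p. F (fst p) (snd p))" "continuous_on UNIV (\<lambda>p. G (fst p) (snd p))"
  shows "double_integral (\<lambda>t t'. F t t' + G t t') = double_integral F + double_integral G"
  using double_integral_integrable[OF assms(1)] double_integral_integrable[OF assms(2)]
      continuous_on_add[OF assms]
  by (simp add: double_integral_eq_product assms scaleR_add_right case_prod_unfold)

lemma double_integral_bounded_linear:
  assumes F: "continuous_on UNIV (\<lambda>p. F (fst p) (snd p))" and T: "bounded_linear T"
  shows "double_integral (\<lambda>t t'. T (F t t')) = T (double_integral F)"
proof -
  have "continuous_on UNIV (\<lambda>p. T (F (fst p) (snd p)))"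
    by (rule bounded_linear.continuous_on[OF T F])
  then show ?thesis
    using integral_bounded_linear[OF T double_integral_integrable[OF F]]
        linear_cmul[OF bounded_linear.linear[OF T]]
    by (simp add: double_integral_eq_product F case_prod_unfold)
qed

text \<open>The form produced by two successive weak pairings, with one factor \<psi> in front of
  each single integral.\<close>

lemma double_integral_component:
  assumes F: "continuous_on UNIV (\<lambda>p. F (fst p) (snd p))"
  shows "double_integral F $ i $ j = (\<integral>t'. \<psi> t' * (\<integral>t. \<psi> t * F t t' $ i $ j \<partial>lborel) \<partial>lborel)"
proof -
  have T: "bounded_linear (\<lambda>P :: real^'n^'n. P $ i $ j)"
    by (rule bounded_linear_compose[OF bounded_linear_vec_nth bounded_linear_vec_nth])
  have int: "integrable (lborel \<Otimes>\<^sub>M lborel) (\<lambda>(t, t'). \<psi> t * \<psi> t' * F t t' $ i $ j)"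
    using integrable_bounded_linear[OF T double_integral_integrable[OF F]] by (simp add: case_prod_unfold)
  have "double_integral F $ i $ j = (\<integral>p. \<psi> (fst p) * \<psi> (snd p)
      * F (fst p) (snd p) $ i $ j \<partial>(lborel \<Otimes>\<^sub>M lborel))"
    unfolding double_integral_eq_product[OF F]
    using integral_bounded_linear[OF T double_integral_integrable[OF F]]
    by (simp add: case_prod_unfold)
  also have "\<dots> = (\<integral>t'. (\<integral>t. \<psi> t * \<psi> t' * F t t' $ i $ j \<partial>lborel) \<partial>lborel)"
    using lborel_pair.integral_snd[OF int] by (simp add: case_prod_unfold)
  also have "\<dots> = (\<integral>t'. \<psi> t' * (\<integral>t. \<psi> t * F t t' $ i $ j \<partial>lborel) \<partial>lborel)"
    by (simp add: mult.assoc mult.left_commute)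
  finally show ?thesis .
qed

text \<open>\<psi> has mean 0 and integrates out the variable on which f does not depend. This holds
  for any f, since a non-integrable integrand merely gives the integral 0.\<close>

lemma double_integral_one_variable: "double_integral (\<lambda>t t'. f t) = 0" "double_integral (\<lambda>t t'. f t') = 0"
proof -
  have "(\<integral>t. (\<psi> t * \<psi> t') *\<^sub>R f t \<partial>lborel) = \<psi> t' *\<^sub>R (\<integral>t. \<psi> t *\<^sub>R f t \<partial>lborel)" for t'
    by (simp add: mult.commute flip: integral_scaleR_right)
  then show "double_integral (\<lambda>t t'. f t) = 0"
    using \<psi>_integrable by (simp add: double_integral_def \<psi>_mean)
  have "(\<integral>t. (\<psi> t * \<psi> t') *\<^sub>R f t' \<partial>lborel) = 0" for t'
    using \<psi>_integrable by (simp add: \<psi>_mean)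
  then show "double_integral (\<lambda>t t'. f t') = 0"
    by (simp add: double_integral_def)
qed

section \<open>The wavelet coefficients and their covariances\<close>

abbreviation "D \<equiv> wavelet_coeff M \<psi> B"

lemma wavelet_integrand_eq:
  "wavelet_integrand \<psi> B j k = (\<lambda>z \<omega>. \<psi> z *\<^sub>R B (2 ^ j * z + 2 ^ j * real_of_int k) \<omega>)"
  by (simp add: fun_eq_iff wavelet_integrand_def)

lemma wavelet_coeff_unique:
  assumes "has_ms_integral M (wavelet_integrand \<psi> B j k) Y"
      "has_ms_integral M (wavelet_integrand \<psi> B j k) Y'"
  shows "AE \<omega> in M. Y \<omega> = Y' \<omega>"
  using assms unfolding wavelet_integrand_eq
  by (rule ms_continuous_process.weighted_ms_integral_unique[OF sampled_process _ _ \<psi>_measurable])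

lemma wavelet_coeff_exists:
  obtains Y where "has_ms_integral M (wavelet_integrand \<psi> B j k) Y" "\<And>c. (\<lambda>\<omega>. c \<bullet> Y \<omega>)
      \<in> closed_linear_span M B"
proof -
  obtain R where R: "R \<ge> 0" "\<And>t. \<psi> t \<noteq> 0 \<Longrightarrow> \<bar>t\<bar> \<le> R"
    by (rule \<psi>_support) blast
  interpret ms_continuous_process M "\<lambda>z. B (2 ^ j * z + 2 ^ j * real_of_int k)"
    by (rule sampled_process)
  have "\<psi> z = 0" if "z \<notin> {-R..R}" for z
    using R(2)[of z] that by (cases "\<psi> z = 0") (auto simp: abs_le_iff)
  from weighted_ms_integral_exists[OF \<psi>_integrable this] obtain Y
    where Y: "has_ms_integral M (\<lambda>z \<omega>. \<psi> z *\<^sub>R B (2 ^ j * z + 2 ^ j * real_of_int k) \<omega>) Y"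
      "\<And>c. (\<lambda>\<omega>. c \<bullet> Y \<omega>) \<in> closed_linear_span M (\<lambda>z. B (2 ^ j * z + 2 ^ j * real_of_int k))"
    by blast
  show ?thesis
    by (rule that[of Y], unfold wavelet_integrand_eq)
      (rule Y(1), rule subsetD[OF closed_linear_span_sampled Y(2)])
qed

lemma has_ms_integral_wavelet_coeff: "has_ms_integral M (wavelet_integrand \<psi> B j k) (D j k)"
proof -
  obtain Y where "has_ms_integral M (wavelet_integrand \<psi> B j k) Y"
    by (rule wavelet_coeff_exists)
  then show ?thesis
    unfolding wavelet_coeff_def ms_integral_def
    by (rule someI[where P = "has_ms_integral M (wavelet_integrand \<psi> B j k)"])
qed

lemma wavelet_coeff_square_integrable: "square_integrable_rv M (D j k)"
  using has_ms_integral_wavelet_coeff by (simp add: has_ms_integral_def)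

text \<open>\<open>D j k\<close> is some version of the integral, and only the version constructed
  above is known to be a limit of linear functionals. The two agree almost surely, and mean-square
  distances do not distinguish them.\<close>

lemma wavelet_coeff_span: "(\<lambda>\<omega>. c \<bullet> D j k \<omega>) \<in> closed_linear_span M B"
proof -
  obtain Y where Y: "has_ms_integral M (wavelet_integrand \<psi> B j k) Y" "\<And>c. (\<lambda>\<omega>. c \<bullet> Y \<omega>)
      \<in> closed_linear_span M B"
    by (rule wavelet_coeff_exists) blast
  have AE: "AE \<omega> in M. Y \<omega> = D j k \<omega>"
    by (rule wavelet_coeff_unique[OF Y(1) has_ms_integral_wavelet_coeff])
  obtain Vn where Vn: "\<And>n::nat. Vn n \<in> linear_functionals B" "(\<lambda>n. ms_norm M (\<lambda>\<omega>. c \<bullet> Y \<omega> - Vn n \<omega>)) \<longlonglongrightarrow> 0"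
    using Y(2)[of c] by (auto simp: closed_linear_span_def)
  have sqV: "square_integrable_rv M (Vn n)" for n
    by (rule linear_functionals_square_integrable[OF square_integrable Vn(1)])
  have sqY: "square_integrable_rv M Y"
    using Y(1) by (simp add: has_ms_integral_def)
  have [measurable]: "Vn n \<in> borel_measurable M" "Y \<in> borel_measurable M" "D j k \<in> borel_measurable M" for n
    using sqV sqY wavelet_coeff_square_integrable by (auto simp: square_integrable_rv_def)
  have "ms_norm M (\<lambda>\<omega>. c \<bullet> Y \<omega> - Vn n \<omega>) = ms_norm M (\<lambda>\<omega>. c \<bullet> D j k \<omega> - Vn n \<omega>)" for n
    unfolding ms_norm_def using AE by (intro arg_cong[where f = sqrt] integral_cong_AE) auto
  with Vn(2) have "(\<lambda>n. ms_norm M (\<lambda>\<omega>. c \<bullet> D j k \<omega> - Vn n \<omega>)) \<longlonglongrightarrow> 0"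
    by simp
  then show ?thesis
    using square_integrable_rv_inner[OF wavelet_coeff_square_integrable] Vn(1)
    unfolding closed_linear_span_def by (intro CollectI conjI exI[of _ Vn] allI)
qed

text \<open>The weak integral is tested against V times the i-th unit vector.\<close>

lemma wavelet_coeff_pairing:
  assumes "square_integrable_rv M V"
  shows "expectation (\<lambda>\<omega>. D j k \<omega> $ i * V \<omega>) =
    (\<integral>z. \<psi> z * expectation (\<lambda>\<omega>. B (2 ^ j * z + 2 ^ j * real_of_int k) \<omega> $ i * V \<omega>) \<partial>lborel)"
proof -
  have "square_integrable_rv M (\<lambda>\<omega>. V \<omega> *\<^sub>R axis i (1::real) :: real^'n)"
    by (rule square_integrable_rv_linear[OF bounded_linear_scaleR_left assms])
  from ms_continuous_process.weighted_pairing(2)[OF sampled_process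
      has_ms_integral_wavelet_coeff[of j k, unfolded wavelet_integrand_eq] this \<psi>_measurable]
  show ?thesis
    by (simp add: inner_axis mult.commute)
qed

lemma wavelet_coeff_mean: "expectation (D j k) = 0"
proof -
  have int: "integrable M (B t)" "integrable M (D j k)" for t
    using integral_norm_le_ms_norm(1) square_integrable wavelet_coeff_square_integrable by blast+
  have comp: "expectation X $ i = expectation (\<lambda>\<omega>. X \<omega> $ i)" if "integrable M X" for X ::
      "'a \<Rightarrow> real^'n" and i
    by (rule integral_bounded_linear[OF bounded_linear_vec_nth that, symmetric])
  have "square_integrable_rv M (\<lambda>\<omega>. 1 :: real)"
    by (simp add: square_integrable_rv_def)
  from wavelet_coeff_pairing[OF this, of j k]
  have "expectation (D j k) $ i = 0" for i
    by (simp add: comp[OF int(2)] comp[OF int(1), symmetric] centered)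
  then show ?thesis
    by (simp add: vec_eq_iff)
qed

definition wcov :: "nat \<Rightarrow> int \<Rightarrow> int \<Rightarrow> real^'n^'n" where
  "wcov j k k' = expectation (\<lambda>\<omega>. outer (D j k \<omega>) (D j k' \<omega>))"

lemma wcov_outer_integrable: "integrable M (\<lambda>\<omega>. outer (D j k \<omega>) (D j k' \<omega>))"
  by (rule bilinear_integrable[OF bounded_bilinear_outer_real wavelet_coeff_square_integrable
      wavelet_coeff_square_integrable])

lemma \<Gamma>_sampled_continuous: "continuous_on UNIV (\<lambda>p. \<Gamma> (a * fst p + b) (c * snd p + d))"
  by (intro continuous_intros continuous_on_compose2[OF \<Gamma>_continuous, of _
      "\<lambda>p. (a * fst p + b, c * snd p + d)", simplified])

text \<open>Two applications of \<open>wavelet_coeff_pairing\<close>, each with one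
  square-integrable variable held fixed: first against a coefficient, then against a value of B. No
  joint measurability of B in time and chance is involved.\<close>

lemma wcov_eq_double_integral:
  "wcov j k k' = double_integral (\<lambda>t t'. \<Gamma> (2 ^ j * t + 2 ^ j * real_of_int k) (2 ^ j * t'
      + 2 ^ j * real_of_int k'))"
proof -
  have sqc: "square_integrable_rv M (\<lambda>\<omega>. X \<omega> $ i)" if "square_integrable_rv M X" for X ::
      "'a \<Rightarrow> real^'n" and i
    by (rule square_integrable_rv_linear[OF bounded_linear_vec_nth that])
  have "wcov j k k' $ a $ b = double_integral (\<lambda>t t'. \<Gamma> (2 ^ j * t
      + 2 ^ j * real_of_int k) (2 ^ j * t' + 2 ^ j * real_of_int k')) $ a $ b" for a b
  proof -
    let ?s = "\<lambda>t. 2 ^ j * t + 2 ^ j * real_of_int k" and ?t = "\<lambda>t. 2 ^ j * t + 2 ^ j * real_of_int k'"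
    have "wcov j k k' $ a $ b = expectation (\<lambda>\<omega>. D j k' \<omega> $ b * D j k \<omega> $ a)"
      unfolding wcov_def integral_matrix_component(1)[OF wcov_outer_integrable] by (simp add: mult.commute)
    also have "\<dots> = (\<integral>t'. \<psi> t' * expectation (\<lambda>\<omega>. B (?t t') \<omega> $ b * D j k \<omega> $ a) \<partial>lborel)"
      by (rule wavelet_coeff_pairing[OF sqc[OF wavelet_coeff_square_integrable]])
    also have "\<dots> = (\<integral>t'. \<psi> t' * (\<integral>t. \<psi> t * \<Gamma> (?s t) (?t t') $ a $ b \<partial>lborel) \<partial>lborel)"
      using wavelet_coeff_pairing[OF sqc[OF square_integrable], of j k a _ b]
      by (simp add: mult.commute[of "B _ _ $ b"] \<Gamma>_component)
    also have "\<dots> = double_integral (\<lambda>t t'. \<Gamma> (?s t) (?t t')) $ a $ b"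
      by (rule double_integral_component[OF \<Gamma>_sampled_continuous, symmetric])
    finally show ?thesis .
  qed
  then show ?thesis by (simp add: vec_eq_iff)
qed

text \<open>Stationary increments rewrite the shifted covariance as the original one plus terms
  depending on t alone or on t' alone, which \<open>double_integral_one_variable\<close>
  annihilates.\<close>

theorem wcov_stationary: "wcov j (k + h) (k' + h) = wcov j k k'"
proof -
  define u where "u = 2 ^ j * real_of_int h"
  let ?s = "\<lambda>t. 2 ^ j * t + 2 ^ j * real_of_int k" and ?t = "\<lambda>t. 2 ^ j * t + 2 ^ j * real_of_int k'"
  have eq: "\<Gamma> (2 ^ j * t + 2 ^ j * real_of_int (k + h)) (2 ^ j * t' + 2 ^ j * real_of_int (k' + h))
      = \<Gamma> (?s t) (?t t') + ((\<Gamma> (?s t + u) u - \<Gamma> u u) + \<Gamma> u (?t t' + u))" for t t'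
    using stationary_increments[of "?s t" u "?t t'"] by (simp add: u_def algebra_simps)
  have c: "continuous_on UNIV (\<lambda>p :: real \<times> real. \<Gamma> (2 ^ j * fst p + v) u - \<Gamma> u u)"
    "continuous_on UNIV (\<lambda>p :: real \<times> real. \<Gamma> u (2 ^ j * snd p + v))" for v
    using \<Gamma>_sampled_continuous[of "2 ^ j" v 0 u] \<Gamma>_sampled_continuous[of 0 u "2 ^ j" v]
    by (auto intro!: continuous_intros)
  have "wcov j (k + h) (k' + h) = double_integral (\<lambda>t t'. \<Gamma> (?s t) (?t t')
      + ((\<Gamma> (?s t + u) u - \<Gamma> u u) + \<Gamma> u (?t t' + u)))"
    unfolding wcov_eq_double_integral eq ..
  also have "\<dots> = double_integral (\<lambda>t t'. \<Gamma> (?s t) (?t t'))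
      + (double_integral (\<lambda>t t'. \<Gamma> (?s t + u) u - \<Gamma> u u) + double_integral (\<lambda>t t'. \<Gamma> u (?t t' + u)))"
    unfolding add.assoc using c by (simp add: double_integral_add \<Gamma>_sampled_continuous continuous_on_add)
  also have "\<dots> = wcov j k k'"
    unfolding double_integral_one_variable wcov_eq_double_integral by simp
  finally show ?thesis .
qed

text \<open>As 2^j t + 2^j k = 2^j (t + k), self-similarity takes the matrices out of \<Gamma>, and
  by linearity they leave the double integral.\<close>

theorem wcov_scale: "wcov j k k' = mat_powr (2 ^ j) H ** wcov 0 k k' ** transpose (mat_powr (2 ^ j) H)"
proof -
  have "\<Gamma> (2 ^ j * t + 2 ^ j * real_of_int k) (2 ^ j * t' + 2 ^ j * real_of_int k')
      = mat_powr (2 ^ j) H ** \<Gamma> (1 * t + real_of_int k) (1 * t'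
          + real_of_int k') ** transpose (mat_powr (2 ^ j) H)" for t t'
    using self_similar[of "2 ^ j" "t + real_of_int k" "t' + real_of_int k'"]
    by (simp add: distrib_left mat_powr_transpose)
  note eq = this
  have T: "bounded_linear (\<lambda>R. mat_powr (2 ^ j) H ** R ** transpose (mat_powr (2 ^ j) H))"
    unfolding linear_conv_bounded_linear[symmetric]
    by (auto intro!: linearI simp: matrix_add_ldistrib matrix_add_rdistrib matrix_scaleR_left
        matrix_scaleR_right)
  show ?thesis
    unfolding wcov_eq_double_integral eq double_integral_bounded_linear[OF \<Gamma>_sampled_continuous T] by simp
qed

text \<open>Scalar covariances against test vectors, the form required by
  \<open>fdd_eq_gaussianI\<close>.\<close>

lemma wcov_inner: "expectation (\<lambda>\<omega>. (c \<bullet> D j k \<omega>) * (d \<bullet> D j k' \<omega>)) = c \<bullet> (wcov j k k' *v d)"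
proof -
  have T: "bounded_linear (\<lambda>P :: real^'n^'n. c \<bullet> (P *v d))"
    unfolding linear_conv_bounded_linear[symmetric]
    by (auto intro!: linearI simp: inner_vec_def matrix_vector_mult_def algebra_simps sum.distrib
        sum_distrib_left)
  have "(c \<bullet> x) * (d \<bullet> y) = c \<bullet> (outer x y *v d)" for x y
    by (simp add: inner_vec_def matrix_vector_mult_def sum_product sum_distrib_left ac_simps)
      (rule sum.swap)
  then show ?thesis
    unfolding wcov_def using integral_bounded_linear[OF T wcov_outer_integrable] by simp
qed

theorem fdd_eq_shift: "fdd_eq M (\<lambda>k. D j (k + h)) M (\<lambda>k. D j k)"
  by (rule fdd_eq_gaussianI[OF gaussian centered])
    (use wavelet_coeff_square_integrable in \<open>auto simp: square_integrable_rv_def wcov_inner wcov_stationary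
      intro: wavelet_coeff_span\<close>)

text \<open>The matrix moves to the test vector, so the transformed coefficients stay in the closed
  span, and their covariances are those of \<open>wcov_scale\<close>.\<close>

theorem fdd_eq_scale: "fdd_eq M (\<lambda>k. D j k) M (\<lambda>k \<omega>. mat_powr (2 ^ j) H *v D 0 k \<omega>)"
proof (rule fdd_eq_gaussianI[OF gaussian centered])
  let ?P = "mat_powr (2 ^ j) H"
  have P: "c \<bullet> (?P *v x) = (c v* ?P) \<bullet> x" for c x
    by (simp add: dot_lmul_matrix)
  show "(\<lambda>\<omega>. ?P *v D 0 k \<omega>) \<in> borel_measurable M" for k
    using square_integrable_rv_linear[OF _ wavelet_coeff_square_integrable, of "(*v) ?P" 0 k]
    by (simp add: square_integrable_rv_def)
  show "(\<lambda>\<omega>. c \<bullet> (?P *v D 0 k \<omega>)) \<in> closed_linear_span M B" for c k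
    unfolding P by (rule wavelet_coeff_span)
  show "expectation (\<lambda>\<omega>. (c \<bullet> D j s \<omega>) * (d \<bullet> D j t \<omega>))
      = expectation (\<lambda>\<omega>. (c \<bullet> (?P *v D 0 s \<omega>)) * (d \<bullet> (?P *v D 0 t \<omega>)))" for c d s t
    unfolding P wcov_inner wcov_scale[of j]
    by (simp add: dot_lmul_matrix vector_transpose_matrix matrix_vector_mul_assoc[symmetric] flip: P)
qed (use wavelet_coeff_square_integrable in \<open>auto simp: square_integrable_rv_def intro: wavelet_coeff_span\<close>)

text \<open>The condition j \<le> p makes the number of summands positive, and by stationarity all
  summands have the same mean.\<close>

theorem wavelet_variance_mean:
  assumes "j \<le> p"
  shows "expectation (wavelet_variance D (2 ^ p) j) = wcov j k k"
proof -
  let ?K = "2 ^ p div 2 ^ j :: nat"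
  have K: "?K \<noteq> 0"
    using assms by (simp add: power_diff[symmetric])
  have eq: "wcov j l l = wcov j k k" for l
    using wcov_stationary[of j k "l - k" k] by simp
  have "expectation (wavelet_variance D (2 ^ p) j) = (1 / real ?K) *\<^sub>R (\<Sum>l = 1..?K. wcov j (int l) (int l))"
    unfolding wavelet_variance_def wavelet_average_def wcov_def using wcov_outer_integrable by simp
  also have "\<dots> = wcov j k k"
    unfolding eq[of "int _"] using K by (simp add: sum_constant_scaleR del: sum_constant)
  finally show ?thesis .
qed

text \<open>The sample variance is a measurable function of finitely many coefficients at one scale,
  so its law is an image of their joint law; conjugating a sum of v v^T by P gives the same sum for
  the vectors P v.\<close>

theorem wavelet_variance_distr:
  "distr M borel (wavelet_variance D (2 ^ p) j) =
    distr M borel (\<lambda>\<omega>. mat_powr (2 ^ j) H ** wavelet_average D (2 ^ p div 2 ^ j) 0 \<omega> ** transpose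
        (mat_powr (2 ^ j) H))"
proof -
  let ?K = "2 ^ p div 2 ^ j :: nat" and ?P = "mat_powr (2 ^ j) H"
  let ?J = "int ` {1..?K}" let ?L = "PiM ?J (\<lambda>_. borel :: (real^'n) measure)"
  define h where "h x = (1 / real ?K) *\<^sub>R (\<Sum>k=1..?K. outer (x (int k)) (x (int k)))" for x ::
      "int \<Rightarrow> real^'n"
  have h: "h \<in> borel_measurable ?L"
    unfolding h_def
  proof (intro borel_measurable_scaleR borel_measurable_const borel_measurable_sum)
    fix k assume k: "k \<in> {1..?K}"
    have m: "(\<lambda>x. x (int k)) \<in> borel_measurable ?L"
      by (rule measurable_component_singleton) (use k in auto)
    show "(\<lambda>x. outer (x (int k)) (x (int k))) \<in> borel_measurable ?L"
      by (rule borel_measurable_continuous_Pair[where H = outer, OF m m])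
        (intro bounded_bilinear.continuous_on[OF bounded_bilinear_outer_real] continuous_intros)
  qed
  have eq: "distr M ?L (\<lambda>\<omega>. \<lambda>k\<in>?J. D j k \<omega>) = distr M ?L (\<lambda>\<omega>. \<lambda>k\<in>?J. ?P *v D 0 k \<omega>)"
    using fdd_eq_scale[of j] unfolding fdd_eq_def by blast
  have m: "(\<lambda>\<omega>. \<lambda>k\<in>?J. D j k \<omega>) \<in> measurable M ?L" "(\<lambda>\<omega>. \<lambda>k\<in>?J. ?P *v D 0 k \<omega>) \<in> measurable M ?L"
    using fdd_eq_scale[of j] unfolding fdd_eq_def by (auto intro!: measurable_restrict)
  have sandwich: "?P ** (c *\<^sub>R (\<Sum>k=1..n. outer (v k) (v k))) ** transpose ?P
      = c *\<^sub>R (\<Sum>k=1..n. outer (?P *v v k) (?P *v v k))"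
    for c n and v :: "nat \<Rightarrow> real^'n"
  proof -
    have L: "linear (\<lambda>R. ?P ** R ** transpose ?P :: real^'n^'n)"
      by (auto intro!: linearI simp: matrix_add_ldistrib matrix_add_rdistrib matrix_scaleR_left
          matrix_scaleR_right)
    have "?P ** outer x x ** transpose ?P = outer (?P *v x) (?P *v x)" for x
      by (simp add: vec_eq_iff matrix_mult_component matrix_vector_mult_def transpose_def
          sum_product sum_distrib_left
          sum_distrib_right ac_simps)
    then show ?thesis
      by (simp only: linear_cmul[OF L] linear_sum[OF L])
  qed
  have "wavelet_variance D (2 ^ p) j = h \<circ> (\<lambda>\<omega>. \<lambda>k\<in>?J. D j k \<omega>)"
    by (auto simp: fun_eq_iff h_def wavelet_variance_def wavelet_average_def intro!: sum.cong)
  moreover have "(\<lambda>\<omega>. ?P ** wavelet_average D ?K 0 \<omega> ** transpose ?P) = h \<circ> (\<lambda>\<omega>. \<lambda>k\<in>?J. ?P *v D 0 k \<omega>)"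
    unfolding wavelet_average_def sandwich by (auto simp: fun_eq_iff h_def intro!: sum.cong)
  ultimately show ?thesis
    using distr_distr[OF h m(1)] distr_distr[OF h m(2)] eq by simp
qed

end


section \<open>The wavelet spectrum\<close>

lemma borel_measurable_cnj [measurable]:
  "f \<in> borel_measurable L \<Longrightarrow> (\<lambda>x. cnj (f x)) \<in> borel_measurable L"
  by (rule borel_measurable_continuous_on[of cnj]) (intro continuous_intros)

lemma wavelet_spectral_density_component:
  "wavelet_spectral_density H A \<psi> j x $ a $ b = complex_of_real ((cmod (fourier \<psi> (2 ^ j * x)))\<^sup>2 / x\<^sup>2) *
    (spectral_factor H A x ** hermitian_transpose (spectral_factor H A x)) $ a $ b"
  unfolding wavelet_spectral_density_def spectral_factor_mult_hermitian[symmetric]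
  by (simp add: scaleR_conv_of_real[where 'a = complex])

text \<open>On a bounded support the phases are uniformly Lipschitz in the frequency. What is used
  below is continuity, which makes the set of frequencies with nonzero transform open.\<close>

lemma fourier_lipschitz:
  assumes \<psi>: "integrable lborel \<psi>" and R: "\<And>t. \<psi> t \<noteq> 0 \<Longrightarrow> \<bar>t\<bar> \<le> R"
  shows "cmod (fourier \<psi> x - fourier \<psi> y) \<le> \<bar>x - y\<bar> * (R * (\<integral>t. \<bar>\<psi> t\<bar> \<partial>lborel))"
proof -
  have [measurable]: "\<psi> \<in> borel_measurable borel"
    using \<psi> by auto
  have int: "integrable lborel (\<lambda>t. complex_of_real (\<psi> t) * cis (- (z * t)))" for z
    by (rule Bochner_Integration.integrable_bound[OF \<psi>]) (auto simp: norm_mult cis_conv_exp)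
  have "fourier \<psi> x - fourier \<psi> y = (\<integral>t. complex_of_real (\<psi> t) * cis (- (x * t))
      - complex_of_real (\<psi> t) * cis (- (y * t)) \<partial>lborel)"
    unfolding fourier_def by (rule Bochner_Integration.integral_diff[OF int int, symmetric])
  also have "cmod \<dots> \<le> (\<integral>t. \<bar>x - y\<bar> * (R * \<bar>\<psi> t\<bar>) \<partial>lborel)"
  proof (rule norm_integral_le)
    show "integrable lborel (\<lambda>t. \<bar>x - y\<bar> * (R * \<bar>\<psi> t\<bar>))"
      using \<psi> by simp
    fix t
    show "cmod (complex_of_real (\<psi> t) * cis (- (x * t)) - complex_of_real (\<psi> t) * cis (- (y * t)))
        \<le> \<bar>x - y\<bar> * (R * \<bar>\<psi> t\<bar>)"
    proof (cases "\<psi> t = 0")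
      case False
      have "cmod (complex_of_real (\<psi> t) * cis (- (x * t)) - complex_of_real (\<psi> t) * cis (- (y * t)))
          = \<bar>\<psi> t\<bar> * cmod (cis (- (x * t)) - cis (- (y * t)))"
        by (simp add: norm_mult flip: right_diff_distrib)
      also have "\<dots> \<le> \<bar>\<psi> t\<bar> * \<bar>- (x * t) - - (y * t)\<bar>"
        by (intro mult_left_mono norm_cis_diff_le) auto
      also have "\<bar>- (x * t) - - (y * t)\<bar> = \<bar>x - y\<bar> * \<bar>t\<bar>"
      proof -
        have "- (x * t) - - (y * t) = (y - x) * t"
          by (simp add: algebra_simps)
        then show ?thesis
          by (simp only: abs_mult abs_minus_commute)
      qed
      also have "\<bar>\<psi> t\<bar> * (\<bar>x - y\<bar> * \<bar>t\<bar>) \<le> \<bar>\<psi> t\<bar> * (\<bar>x - y\<bar> * R)"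
        by (intro mult_left_mono R[OF False]) auto
      finally show ?thesis
        by (simp add: ac_simps)
    qed simp
  qed
  also have "\<dots> = \<bar>x - y\<bar> * (R * (\<integral>t. \<bar>\<psi> t\<bar> \<partial>lborel))"
    by simp
  finally show ?thesis .
qed

lemma fourier_continuous:
  assumes "integrable lborel \<psi>" "\<And>t. \<psi> t \<noteq> 0 \<Longrightarrow> \<bar>t\<bar> \<le> R"
  shows "continuous_on UNIV (fourier \<psi>)"
  unfolding continuous_on_def
proof safe
  fix x
  have "((\<lambda>y. \<bar>y - x\<bar> * (R * (\<integral>t. \<bar>\<psi> t\<bar> \<partial>lborel))) \<longlongrightarrow> \<bar>x
      - x\<bar> * (R * (\<integral>t. \<bar>\<psi> t\<bar> \<partial>lborel))) (at x within UNIV)"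
    by (intro tendsto_intros)
  then have "((\<lambda>y. \<bar>y - x\<bar> * (R * (\<integral>t. \<bar>\<psi> t\<bar> \<partial>lborel))) \<longlongrightarrow> 0) (at x within UNIV)"
    by simp
  then show "(fourier \<psi> \<longlongrightarrow> fourier \<psi> x) (at x within UNIV)"
    by (rule LIM_zero_cancel[OF Lim_null_comparison[rotated]])
      (intro always_eventually allI fourier_lipschitz assms)
qed

text \<open>With \<open>fourier \<psi> = 0\<close>, the positive and the negative part of \<open>\<psi>\<close> are densities with
  the same characteristic function.\<close>

lemma fourier_injective:
  assumes \<psi>: "integrable lborel \<psi>" and zero: "\<And>x. fourier \<psi> x = 0"
  shows "AE t in lborel. \<psi> t = 0"
proof -
  have [measurable]: "\<psi> \<in> borel_measurable borel"
    using \<psi> by auto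
  define f g where "f = (\<lambda>t. max (\<psi> t) 0)" and "g = (\<lambda>t. max (- \<psi> t) 0)"
  have [measurable]: "f \<in> borel_measurable borel" "g \<in> borel_measurable borel"
    unfolding f_def g_def by measurable
  have fg: "0 \<le> f t" "0 \<le> g t" "\<psi> t = f t - g t" for t
    by (auto simp: f_def g_def)
  have int: "integrable lborel f" "integrable lborel g"
    by (rule Bochner_Integration.integrable_bound[OF \<psi>]; auto simp: f_def g_def)+
  have intc: "integrable lborel (\<lambda>t. f t *\<^sub>R iexp (x * t))"
      "integrable lborel (\<lambda>t. g t *\<^sub>R iexp (x * t))" for x
  proof -
    show "integrable lborel (\<lambda>t. f t *\<^sub>R iexp (x * t))"
      by (rule Bochner_Integration.integrable_bound[OF int(1)]) auto
    show "integrable lborel (\<lambda>t. g t *\<^sub>R iexp (x * t))"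
      by (rule Bochner_Integration.integrable_bound[OF int(2)]) auto
  qed
  have char: "(\<integral>t. f t *\<^sub>R iexp (x * t) \<partial>lborel) = (\<integral>t. g t *\<^sub>R iexp (x * t) \<partial>lborel)" for x
  proof -
    have "(\<integral>t. f t *\<^sub>R iexp (x * t) \<partial>lborel) - (\<integral>t. g t *\<^sub>R iexp (x * t) \<partial>lborel)
        = (\<integral>t. f t *\<^sub>R iexp (x * t) - g t *\<^sub>R iexp (x * t) \<partial>lborel)"
      by (rule Bochner_Integration.integral_diff[OF intc, symmetric])
    also have "\<dots> = fourier \<psi> (- x)"
      unfolding fourier_def fg(3) cis_conv_exp
      by (intro Bochner_Integration.integral_cong refl) (simp add: scaleR_conv_of_real left_diff_distrib)
    finally show ?thesis using zero by simp
  qed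
  define c where "c = (\<integral>t. f t \<partial>lborel)"
  have c: "(\<integral>t. g t \<partial>lborel) = c"
  proof -
    have "complex_of_real (\<integral>t. f t \<partial>lborel) = complex_of_real (\<integral>t. g t \<partial>lborel)"
      using char[of 0] by (simp add: scaleR_conv_of_real)
    then show ?thesis by (simp add: c_def)
  qed
  have "c \<ge> 0"
    unfolding c_def using fg by simp
  show ?thesis
  proof (cases "c = 0")
    case True
    have "AE t in lborel. f t = 0" "AE t in lborel. g t = 0"
      using integral_nonneg_eq_0_iff_AE[OF int(1)] integral_nonneg_eq_0_iff_AE[OF int(2)] fg(1,2) True
        c c_def[symmetric] by simp_all
    then show ?thesis
      by eventually_elim (simp add: fg(3))
  next
    case False
    then have "c > 0" using \<open>c \<ge> 0\<close> by simp
    \<comment> \<open>Applied to the positive and the negative part with the common mass c; the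
      masses agree by the transforms at frequency 0.\<close>
    have dist: "real_distribution (density lborel (\<lambda>t. ennreal (h t / c)))"
      and char_dens: "char (density lborel (\<lambda>t. ennreal (h t / c))) x
          = (1 / c) *\<^sub>R (\<integral>t. h t *\<^sub>R iexp (x * t) \<partial>lborel)"
      if [measurable]: "h \<in> borel_measurable borel" and h: "\<And>t. 0
          \<le> h t" "integrable lborel h" "(\<integral>t. h t \<partial>lborel) = c" for h x
    proof -
      have "(\<integral>\<^sup>+t. ennreal (h t / c) \<partial>lborel) = ennreal (\<integral>t. h t / c \<partial>lborel)"
        using h \<open>c > 0\<close> by (intro nn_integral_eq_integral) auto
      also have "\<dots> = 1"
        using h(3) \<open>c > 0\<close> by simp
      finally have "prob_space (density lborel (\<lambda>t. ennreal (h t / c)))"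
        by (intro prob_spaceI) (simp add: emeasure_density)
      then show "real_distribution (density lborel (\<lambda>t. ennreal (h t / c)))"
        by (simp add: real_distribution_def real_distribution_axioms_def)
      have "char (density lborel (\<lambda>t. ennreal (h t / c))) x
          = (\<integral>t. (1 / c) *\<^sub>R (h t *\<^sub>R iexp (x * t)) \<partial>lborel)"
        unfolding char_def using h(1) \<open>c > 0\<close> by (subst integral_density) auto
      then show "char (density lborel (\<lambda>t. ennreal (h t / c))) x
          = (1 / c) *\<^sub>R (\<integral>t. h t *\<^sub>R iexp (x * t) \<partial>lborel)"
        by (simp only: integral_scaleR_right)
    qed
    have cf: "(\<integral>t. f t \<partial>lborel) = c"
      by (simp add: c_def)
    note F = \<open>f \<in> borel_measurable borel\<close> fg(1) int(1) cf and G = \<open>g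
        \<in> borel_measurable borel\<close> fg(2) int(2) c
    have "density lborel (\<lambda>t. ennreal (f t / c)) = density lborel (\<lambda>t. ennreal (g t / c))"
    proof (rule Levy_uniqueness[OF dist[OF F] dist[OF G]], rule ext)
      show "char (density lborel (\<lambda>t. ennreal (f t / c))) x
          = char (density lborel (\<lambda>t. ennreal (g t / c))) x" for x
        unfolding char_dens[OF F] char_dens[OF G] char ..
    qed
    then have "AE t in lborel. ennreal (f t / c) = ennreal (g t / c)"
      by (intro sigma_finite_measure.density_unique[OF sigma_finite_lborel]) auto
    then show ?thesis
    proof eventually_elim
      case (elim t)
      then have "f t = g t"
        using fg(1,2)[of t] \<open>c > 0\<close> by simp
      then show ?case
        using fg(3)[of t] by simp
    qed
  qed
qed

context ofbm_wavelet
begin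

text \<open>A vanishing transform would make \<psi> zero almost everywhere, against the unit
  integral of its square.\<close>

lemma fourier_nonzero: "\<exists>x. fourier \<psi> x \<noteq> 0"
proof (rule ccontr)
  assume "\<not> ?thesis"
  then have "AE t in lborel. \<psi> t = 0"
    using fourier_injective[OF \<psi>_integrable] by blast
  then have "AE t in lborel. (\<psi> t)\<^sup>2 = 0"
    by eventually_elim simp
  then have "(\<integral>t. (\<psi> t)\<^sup>2 \<partial>lborel) = (\<integral>t. 0 \<partial>(lborel :: real measure))"
    by (intro integral_cong_AE) auto
  then show False
    using wavelet by (simp add: wavelet_def)
qed

text \<open>When \<Gamma> is symmetric, the variance of an increment is \<Gamma> t t + \<Gamma> t'
  t' - 2 \<Gamma> t t'. The first two terms depend on one variable and integrate to 0, whence the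
  factor -1/2.\<close>

lemma wcov_real_case:
  assumes "map_matrix Im (A ** hermitian_transpose A) = 0"
  defines "F \<equiv> \<lambda>t t'. mat_powr \<bar>t - t'\<bar> H ** \<Gamma> 1 1 ** mat_powr \<bar>t - t'\<bar> (transpose H)"
  shows "integrable (lborel \<Otimes>\<^sub>M lborel) (\<lambda>(t, t'). (\<psi> t * \<psi> t') *\<^sub>R F t t')"
    and "wcov 0 0 0 = - (1 / 2) *\<^sub>R double_integral F"
proof -
  have F: "F t t' = \<Gamma> (t - t') (t - t')" for t t'
    unfolding F_def by (rule \<Gamma>_diagonal[symmetric])
  have c: "continuous_on UNIV (\<lambda>p. F (fst p) (snd p))"
    unfolding F by (intro continuous_intros
      continuous_on_compose2[OF \<Gamma>_continuous, of _ "\<lambda>p. (fst p - snd p, fst p - snd p)", simplified])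
  show "integrable (lborel \<Otimes>\<^sub>M lborel) (\<lambda>(t, t'). (\<psi> t * \<psi> t') *\<^sub>R F t t')"
    by (rule double_integral_integrable[OF c])
  have eq: "F t t' = \<Gamma> t t + (\<Gamma> t' t' + (- 2) *\<^sub>R \<Gamma> t t')" for t t'
    unfolding F using stationary_increments[of "t - t'" t'
        "t - t'"] \<Gamma>_symmetric_if_real[OF assms(1), of t' t]
    by (simp add: scaleR_2 algebra_simps)
  have c1: "continuous_on UNIV (\<lambda>p :: real \<times> real. \<Gamma> (fst p) (fst p))"
      "continuous_on UNIV (\<lambda>p :: real \<times> real. \<Gamma> (snd p) (snd p))"
    by (intro continuous_intros continuous_on_compose2[OF \<Gamma>_continuous, of _
        "\<lambda>p. (fst p, fst p)", simplified]
      continuous_on_compose2[OF \<Gamma>_continuous, of _ "\<lambda>p. (snd p, snd p)", simplified])+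
  have c2: "continuous_on UNIV (\<lambda>p. (- 2) *\<^sub>R \<Gamma> (fst p) (snd p))"
    by (intro continuous_intros \<Gamma>_continuous)
  have "double_integral F = double_integral (\<lambda>t t'. \<Gamma> t t + (\<Gamma> t' t' + (- 2) *\<^sub>R \<Gamma> t t'))"
    unfolding eq ..
  also have "\<dots> = double_integral (\<lambda>t t'. \<Gamma> t t)
      + (double_integral (\<lambda>t t'. \<Gamma> t' t') + double_integral (\<lambda>t t'. (- 2) *\<^sub>R \<Gamma> t t'))"
    using c1 c2 by (simp only: double_integral_add continuous_on_add)
  also have "\<dots> = (- 2) *\<^sub>R wcov 0 0 0"
    unfolding double_integral_one_variable double_integral_bounded_linear[OF \<Gamma>_continuous
        bounded_linear_scaleR_right] wcov_eq_double_integral by simp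
  finally show "wcov 0 0 0 = - (1 / 2) *\<^sub>R double_integral F"
    by simp
qed

definition \<Psi> :: "nat \<Rightarrow> real \<Rightarrow> complex" where
  "\<Psi> j x = (\<integral>t. \<psi> t *\<^sub>R \<kappa> (2 ^ j * t) x \<partial>lborel)"

text \<open>The term -1 of the kernel disappears because \<psi> has mean 0, leaving the conjugate
  transform divided by ix. At x = 0 both sides are 0 through division by zero.\<close>

lemma \<Psi>_mult_cnj: "\<Psi> j x * cnj (\<Psi> j x) = complex_of_real ((cmod (fourier \<psi> (2 ^ j * x)))\<^sup>2 / x\<^sup>2)"
proof (cases "x = 0")
  case True
  then show ?thesis by (simp add: \<Psi>_def increment_kernel_def)
next
  case False
  have int: "integrable lborel (\<lambda>t. complex_of_real (\<psi> t) * cis (2 ^ j * x * t))"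
    by (rule Bochner_Integration.integrable_bound[OF \<psi>_integrable]) (auto simp: norm_mult cis_conv_exp)
  have intc: "integrable lborel (\<lambda>t. complex_of_real (\<psi> t))"
    using \<psi>_integrable by simp
  have "\<Psi> j x = (\<integral>t. (complex_of_real (\<psi> t) * cis (2 ^ j * x * t)
      - complex_of_real (\<psi> t)) / (\<i> * complex_of_real x) \<partial>lborel)"
    unfolding \<Psi>_def increment_kernel_def
    by (intro Bochner_Integration.integral_cong refl) (simp add: scaleR_conv_of_real algebra_simps)
  also have "\<dots> = (\<integral>t. complex_of_real (\<psi> t) * cis (2 ^ j * x * t)
      - complex_of_real (\<psi> t) \<partial>lborel) / (\<i> * complex_of_real x)"
    by (rule integral_divide_zero)
  also have "(\<integral>t. complex_of_real (\<psi> t) * cis (2 ^ j * x * t) - complex_of_real (\<psi> t) \<partial>lborel)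
      = (\<integral>t. complex_of_real (\<psi> t) * cis (2 ^ j * x * t) \<partial>lborel)"
    using int intc by (simp add: \<psi>_mean)
  also have "(\<integral>t. complex_of_real (\<psi> t) * cis (2 ^ j * x * t) \<partial>lborel) = cnj (fourier \<psi> (2 ^ j * x))"
    unfolding fourier_def Bochner_Integration.integral_cnj[symmetric] by (simp add: cis_cnj)
  finally have "\<Psi> j x = cnj (fourier \<psi> (2 ^ j * x)) / (\<i> * complex_of_real x)" .
  then have "\<Psi> j x * cnj (\<Psi> j x) = (fourier \<psi> (2 ^ j * x) * cnj (fourier \<psi> (2 ^ j * x))) /
      ((\<i> * complex_of_real x) * cnj (\<i> * complex_of_real x))"
    by (simp add: mult.commute)
  also have "(\<i> * complex_of_real x) * cnj (\<i> * complex_of_real x) = complex_of_real (x\<^sup>2)"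
    by (simp add: complex_eq_iff power2_eq_square)
  finally show ?thesis
    by (simp only: complex_norm_square[symmetric] of_real_divide)
qed

text \<open>The spectral representation of \<Gamma> is inserted into the double integral, and the
  frequency integral is moved outside in two steps, over t and then over t', each replacing a kernel
  by its transform \<open>\<Psi>\<close> or the conjugate of it.\<close>

theorem wcov_spectral:
  "integrable lborel (wavelet_spectral_density H A \<psi> j)"
  "mat_complex (wcov j 0 0) = (\<integral>x. wavelet_spectral_density H A \<psi> j x \<partial>lborel)"
proof -
  obtain R where R: "R \<ge> 0" "\<And>t. \<psi> t \<noteq> 0 \<Longrightarrow> \<bar>t\<bar> \<le> R"
    by (rule \<psi>_support) blast
  let ?G = "\<lambda>x. S x ** hermitian_transpose (S x)"
  have dens: "wavelet_spectral_density H A \<psi> j x $ a $ b = \<Psi> j x * cnj (\<Psi> j x) * ?G x $ a $ b" for x a b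
    unfolding wavelet_spectral_density_component \<Psi>_mult_cnj ..
  have [measurable]: "(\<lambda>x. ?G (f x) $ a $ b) \<in> borel_measurable L" if [measurable]: "f \<in> borel_measurable L"
    for f and L :: "'c measure" and a b
  proof -
    have "(\<lambda>x. S (f x)) \<in> borel_measurable L"
      by measurable
    then have "(\<lambda>x. S (f x) $ i $ k) \<in> borel_measurable L" for i k
      by (rule borel_measurable_continuous_on[rotated]) (intro continuous_intros)
    then show ?thesis
      unfolding matrix_mult_component hermitian_transpose_component by measurable
  qed
  have comp: "integrable lborel (\<lambda>x. \<Psi> j x * cnj (\<Psi> j x) * ?G x $ a $ b)"
    "complex_of_real (wcov j 0 0 $ a $ b) = (\<integral>x. \<Psi> j x * cnj (\<Psi> j x) * ?G x $ a $ b \<partial>lborel)" for a b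
  proof -
    define W where "W r x = (4 + r\<^sup>2) * ((norm (S x))\<^sup>2 / (1 + x\<^sup>2))" for r x
    have W: "integrable lborel (W r)" for r
      unfolding W_def by (rule integrable_mult_right[OF spectral_weight_integrable])
    let ?r = "2 ^ j * R"
    have t_le: "\<bar>2 ^ j * t\<bar> \<le> ?r" if "\<psi> t \<noteq> 0" for t
      using R(2)[OF that] by (simp add: abs_mult)
    \<comment> \<open>The restriction on s keeps the integrand below the single function
      \<open>W ?r\<close>; the outer integral only meets such s, because \<psi> vanishes
      elsewhere.\<close>
    have inner: "(\<integral>t. \<psi> t *\<^sub>R (\<integral>x. \<kappa> (2 ^ j * t) x * cnj (\<kappa> s x) * ?G x $ a $ b \<partial>lborel) \<partial>lborel)
        = (\<integral>x. \<Psi> j x * cnj (\<kappa> s x) * ?G x $ a $ b \<partial>lborel)" if s: "\<bar>s\<bar> \<le> ?r" for s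
    proof -
      have "(\<integral>t. \<psi> t *\<^sub>R (\<integral>x. \<kappa> (2 ^ j * t) x * cnj (\<kappa> s x) * ?G x $ a $ b \<partial>lborel) \<partial>lborel)
          = (\<integral>x. (\<integral>t. \<psi> t *\<^sub>R (\<kappa> (2 ^ j * t) x * cnj (\<kappa> s x) * ?G x $ a $ b) \<partial>lborel) \<partial>lborel)"
        by (rule weighted_integral_swap(1)[OF \<psi>_integrable _ W[of ?r]])
          (measurable, unfold W_def, intro spectral_integrand_le t_le s)
      also have "\<dots> = (\<integral>x. \<Psi> j x * cnj (\<kappa> s x) * ?G x $ a $ b \<partial>lborel)"
      proof (intro Bochner_Integration.integral_cong refl)
        fix x
        have "(\<integral>t. \<psi> t *\<^sub>R (\<kappa> (2 ^ j * t) x * cnj (\<kappa> s x) * ?G x $ a $ b) \<partial>lborel)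
            = (\<integral>t. (\<psi> t *\<^sub>R \<kappa> (2 ^ j * t) x) * (cnj (\<kappa> s x) * ?G x $ a $ b) \<partial>lborel)"
          by (simp add: mult.assoc)
        also have "\<dots> = \<Psi> j x * (cnj (\<kappa> s x) * ?G x $ a $ b)"
          unfolding \<Psi>_def by (rule integral_mult_left_zero)
        finally show "(\<integral>t. \<psi> t *\<^sub>R (\<kappa> (2 ^ j * t) x * cnj (\<kappa> s x) * ?G x $ a $ b) \<partial>lborel)
            = \<Psi> j x * cnj (\<kappa> s x) * ?G x $ a $ b"
          by (simp add: mult.assoc)
      qed
      finally show ?thesis .
    qed
    have [measurable]: "(\<lambda>x. \<Psi> j (f x)) \<in> borel_measurable L" if [measurable]: "f \<in> borel_measurable L"
      for f and L :: "(real \<times> real) measure"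
      unfolding \<Psi>_def by measurable
    \<comment> \<open>After the first exchange the integrand contains \<Psi>; its bound is the
      previous one integrated against the absolute value of \<psi>.\<close>
    have bound: "cmod (\<Psi> j x * cnj (\<kappa> s x) * ?G x $ a $ b) \<le> (\<integral>t. \<bar>\<psi> t\<bar> * W ?r x \<partial>lborel)" if s:
        "\<bar>s\<bar> \<le> ?r" for s x
    proof -
      have "\<Psi> j x * cnj (\<kappa> s x) * ?G x $ a $ b
          = (\<integral>t. (\<psi> t *\<^sub>R \<kappa> (2 ^ j * t) x) * (cnj (\<kappa> s x) * ?G x $ a $ b) \<partial>lborel)"
        unfolding \<Psi>_def mult.assoc by (rule integral_mult_left_zero[symmetric])
      also have "cmod \<dots> \<le> (\<integral>t. \<bar>\<psi> t\<bar> * W ?r x \<partial>lborel)"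
      proof (rule norm_integral_le)
        show "integrable lborel (\<lambda>t. \<bar>\<psi> t\<bar> * W ?r x)"
          using \<psi>_integrable by simp
        fix t
        show "cmod ((\<psi> t *\<^sub>R \<kappa> (2 ^ j * t) x) * (cnj (\<kappa> s x) * ?G x $ a $ b)) \<le> \<bar>\<psi> t\<bar> * W ?r x"
        proof (cases "\<psi> t = 0")
          case False
          have "cmod ((\<psi> t *\<^sub>R \<kappa> (2 ^ j * t) x) * (cnj (\<kappa> s x) * ?G x $ a $ b))
              = \<bar>\<psi> t\<bar> * cmod (\<kappa> (2 ^ j * t) x * cnj (\<kappa> s x) * ?G x $ a $ b)"
            by (simp add: norm_mult)
          also have "\<dots> \<le> \<bar>\<psi> t\<bar> * W ?r x"
            unfolding W_def by (intro mult_left_mono spectral_integrand_le t_le[OF False] s) simp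
          finally show ?thesis .
        qed simp
      qed
      finally show ?thesis .
    qed
    have k: "(\<lambda>p. \<Psi> j (snd p) * cnj (\<kappa> (2 ^ j * fst p) (snd p)) * ?G (snd p) $ a $ b)
        \<in> borel_measurable (borel \<Otimes>\<^sub>M borel)"
      by measurable
    have h: "integrable lborel (\<lambda>x. \<integral>t. \<bar>\<psi> t\<bar> * W ?r x \<partial>lborel)"
      using W[of ?r] by simp
    note swap = weighted_integral_swap[where k = "\<lambda>t x. \<Psi> j x * cnj (\<kappa> (2 ^ j * t) x) * ?G x $ a $ b",
        OF \<psi>_integrable k h bound[OF t_le]]
    have pull: "(\<integral>t. \<psi> t *\<^sub>R (\<Psi> j x * cnj (\<kappa> (2 ^ j * t) x) * ?G x $ a $ b) \<partial>lborel)
        = \<Psi> j x * cnj (\<Psi> j x) * ?G x $ a $ b" for x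
    proof -
      have "(\<integral>t. \<psi> t *\<^sub>R (\<Psi> j x * cnj (\<kappa> (2 ^ j * t) x) * ?G x $ a $ b) \<partial>lborel)
          = (\<integral>t. (\<Psi> j x * ?G x $ a $ b) * cnj (\<psi> t *\<^sub>R \<kappa> (2 ^ j * t) x) \<partial>lborel)"
        by (intro Bochner_Integration.integral_cong refl) (simp add: scaleR_conv_of_real ac_simps)
      also have "\<dots> = (\<Psi> j x * ?G x $ a $ b) * (\<integral>t. cnj (\<psi> t *\<^sub>R \<kappa> (2 ^ j * t) x) \<partial>lborel)"
        by (rule integral_mult_right_zero)
      also have "\<dots> = \<Psi> j x * cnj (\<Psi> j x) * ?G x $ a $ b"
        unfolding Bochner_Integration.integral_cnj \<Psi>_def[symmetric] by (simp add: ac_simps)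
      finally show ?thesis .
    qed
    show "integrable lborel (\<lambda>x. \<Psi> j x * cnj (\<Psi> j x) * ?G x $ a $ b)"
      using swap(2) unfolding pull .
    have "complex_of_real (wcov j 0 0 $ a $ b)
        = complex_of_real (\<integral>t'. \<psi> t' * (\<integral>t. \<psi> t * \<Gamma> (2 ^ j * t) (2 ^ j * t') $ a $ b \<partial>lborel) \<partial>lborel)"
      unfolding wcov_eq_double_integral using double_integral_component[OF \<Gamma>_sampled_continuous[of
          "2 ^ j" 0 "2 ^ j" 0]] by simp
    also have "\<dots> = (\<integral>t'. \<psi> t' *\<^sub>R (\<integral>t. \<psi> t *\<^sub>R complex_of_real (\<Gamma> (2 ^ j * t) (2 ^ j * t') $ a $ b)
        \<partial>lborel) \<partial>lborel)"
      by (simp add: scaleR_conv_of_real flip: integral_complex_of_real)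
    also have "\<dots> = (\<integral>t'. \<psi> t' *\<^sub>R (\<integral>x. \<Psi> j x * cnj (\<kappa> (2 ^ j * t') x) * ?G x $ a $ b \<partial>lborel) \<partial>lborel)"
    proof (intro Bochner_Integration.integral_cong refl)
      fix t'
      show "\<psi> t' *\<^sub>R (\<integral>t. \<psi> t *\<^sub>R complex_of_real (\<Gamma> (2 ^ j * t) (2 ^ j * t') $ a $ b) \<partial>lborel)
          = \<psi> t' *\<^sub>R (\<integral>x. \<Psi> j x * cnj (\<kappa> (2 ^ j * t') x) * ?G x $ a $ b \<partial>lborel)"
        unfolding spectral_component(2) using inner[OF t_le, of t'] by (cases "\<psi> t' = 0") simp_all
    qed
    also have "\<dots> = (\<integral>x. \<Psi> j x * cnj (\<Psi> j x) * ?G x $ a $ b \<partial>lborel)"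
      using swap(1) unfolding pull .
    finally show "complex_of_real (wcov j 0 0 $ a $ b) = (\<integral>x. \<Psi> j x * cnj (\<Psi> j x) * ?G x $ a $ b \<partial>lborel)" .
  qed
  show int: "integrable lborel (wavelet_spectral_density H A \<psi> j)"
    by (rule integrable_matrix) (use comp(1) in \<open>simp add: dens\<close>)
  show "mat_complex (wcov j 0 0) = (\<integral>x. wavelet_spectral_density H A \<psi> j x \<partial>lborel)"
    using integral_matrix_component(1)[OF int] comp(2) by (simp add: vec_eq_iff dens)
qed

text \<open>A null vector v makes the quadratic form vanish, which is the integral of a nonnegative
  density. The density is then 0 at some frequency x where the transform of \<psi> is not, and there
  v^T S(x) = 0; full rank of the real part of A A^* forces v = 0.\<close>

theorem det_wcov: "det (wcov j 0 0) \<noteq> 0"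
proof
  assume "det (wcov j 0 0) = 0"
  then obtain v where v: "v \<noteq> 0" "wcov j 0 0 *v v = 0"
    using invertible_det_nz[of "wcov j 0 0"] invertible_left_inverse[of "wcov j 0 0"]
      matrix_left_invertible_ker[of "wcov j 0 0"] by auto
  let ?G = "\<lambda>x. S x ** hermitian_transpose (S x)"
  \<comment> \<open>u is the row vector v^T S(x), so r below is the quadratic form of the spectral
    density at v.\<close>
  define u where "u x k = (\<Sum>a\<in>UNIV. complex_of_real (v $ a) * S x $ a $ k)" for x k
  define r where "r x = (cmod (fourier \<psi> (2 ^ j * x)))\<^sup>2 / x\<^sup>2 * (\<Sum>k\<in>UNIV. (cmod (u x k))\<^sup>2)" for x
  have quad: "(\<Sum>a\<in>UNIV. \<Sum>b\<in>UNIV. complex_of_real (v $ a * v $ b) * wavelet_spectral_density H A \<psi> j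
      x $ a $ b)
      = complex_of_real (r x)" for x
  proof -
    have "complex_of_real (\<Sum>k\<in>UNIV. (cmod (u x k))\<^sup>2) = (\<Sum>k\<in>UNIV. u x k * cnj (u x k))"
      by (simp only: of_real_sum complex_norm_square)
    also have "\<dots> = (\<Sum>k\<in>UNIV. \<Sum>a\<in>UNIV. \<Sum>b\<in>UNIV. complex_of_real (v $ a * v $ b)
        * (S x $ a $ k * cnj (S x $ b $ k)))"
      by (simp add: u_def sum_product ac_simps)
    also have "\<dots> = (\<Sum>a\<in>UNIV. \<Sum>k\<in>UNIV. \<Sum>b\<in>UNIV. complex_of_real (v $ a * v $ b)
        * (S x $ a $ k * cnj (S x $ b $ k)))"
      by (rule sum.swap)
    also have "\<dots> = (\<Sum>a\<in>UNIV. \<Sum>b\<in>UNIV. \<Sum>k\<in>UNIV. complex_of_real (v $ a * v $ b)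
        * (S x $ a $ k * cnj (S x $ b $ k)))"
      by (intro sum.cong refl sum.swap)
    also have "\<dots> = (\<Sum>a\<in>UNIV. \<Sum>b\<in>UNIV. complex_of_real (v $ a * v $ b) * ?G x $ a $ b)"
      by (simp add: matrix_mult_component sum_distrib_left)
    finally show ?thesis
      unfolding wavelet_spectral_density_component r_def of_real_mult[of "_ / _"]
      by (simp add: sum_distrib_left ac_simps)
  qed
  note dens = integral_matrix_component[OF wcov_spectral(1)]
  have "complex_of_real (v \<bullet> (wcov j 0 0 *v v))
      = (\<Sum>a\<in>UNIV. \<Sum>b\<in>UNIV. complex_of_real (v $ a * v $ b) * mat_complex (wcov j 0 0) $ a $ b)"
    by (simp add: inner_vec_def matrix_vector_mult_def sum_distrib_left ac_simps)
  also have "\<dots> = (\<integral>x. (\<Sum>a\<in>UNIV. \<Sum>b\<in>UNIV. complex_of_real (v $ a * v $ b)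
      * wavelet_spectral_density H A \<psi> j x $ a $ b) \<partial>lborel)"
    unfolding wcov_spectral(2) dens(1) using dens(2) by simp
  finally have "(\<integral>x. r x \<partial>lborel) = 0"
    unfolding quad using v(2) by simp
  moreover have int: "integrable lborel r"
  proof -
    have "integrable lborel (\<lambda>x. \<Sum>a\<in>UNIV. \<Sum>b\<in>UNIV. complex_of_real (v $ a * v $ b)
        * wavelet_spectral_density H A \<psi> j x $ a $ b)"
      by (intro Bochner_Integration.integrable_sum integrable_mult_right dens(2))
    then show ?thesis
      unfolding quad complex_of_real_integrable_eq .
  qed
  moreover have "0 \<le> r x" for x
    unfolding r_def by (intro mult_nonneg_nonneg divide_nonneg_nonneg sum_nonneg) auto
  ultimately have AE: "AE x in lborel. r x = 0"
    by (simp add: integral_nonneg_eq_0_iff_AE)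
  define U where "U = {x. fourier \<psi> (2 ^ j * x) \<noteq> 0}"
  obtain R where R: "R \<ge> 0" "\<And>t. \<psi> t \<noteq> 0 \<Longrightarrow> \<bar>t\<bar> \<le> R"
    by (rule \<psi>_support) blast
  have "continuous_on UNIV (\<lambda>x. fourier \<psi> (2 ^ j * x))"
    by (intro continuous_on_compose2[OF fourier_continuous[OF \<psi>_integrable R(2)]] continuous_intros) auto
  then have "open U"
    unfolding U_def by (intro open_Collect_neq continuous_on_const)
  moreover have "U \<noteq> {}"
  proof -
    obtain x where "fourier \<psi> x \<noteq> 0"
      using fourier_nonzero by blast
    then have "x / 2 ^ j \<in> U" by (simp add: U_def)
    then show ?thesis by blast
  qed
  ultimately have "\<not> negligible U"
    by (rule open_not_negligible)
  \<comment> \<open>A nonempty open set is not a null set, so it meets the set where r = 0, whose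
    complement is null.\<close>
  have "\<exists>x\<in>U. r x = 0"
  proof (rule ccontr)
    assume "\<not> ?thesis"
    with AE have "AE x in lborel. x \<notin> U"
      by (auto elim: eventually_mono)
    then have "U \<in> null_sets lborel"
      using \<open>open U\<close> AE_iff_null_sets[of U lborel] by simp
    then show False
      using \<open>\<not> negligible U\<close> by (simp add: negligible_iff_null_sets null_sets_completionI)
  qed
  then obtain x where x: "x \<in> U" "r x = 0"
    by blast
  \<comment> \<open>Frequency 0 has to be excluded: there S, and hence u, vanishes by convention and
    carries no information on v.\<close>
  have "fourier \<psi> 0 = 0"
    by (simp add: fourier_def \<psi>_mean)
  then have "x \<noteq> 0"
    using x(1) by (auto simp: U_def)
  then have "(\<Sum>k\<in>UNIV. (cmod (u x k))\<^sup>2) = 0"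
    using x by (auto simp: r_def U_def)
  then have u0: "u x k = 0" for k
    by (subst (asm) sum_nonneg_eq_0_iff) auto
  let ?P = "mat_powr \<bar>x\<bar> (- ofbm_exponent H)"
  \<comment> \<open>v^T S(x) is y^T A for x > 0 and y^T times the conjugate of A for x < 0; as y is
    real, conjugation gives y^T A = 0 in both cases.\<close>
  define y where "y = transpose ?P *v v"
  have yA: "(\<Sum>b\<in>UNIV. complex_of_real (y $ b) * A $ b $ k) = 0" for k
  proof -
    have y: "(\<Sum>a\<in>UNIV. complex_of_real (v $ a) * (mat_complex ?P ** C) $ a $ k)
        = (\<Sum>b\<in>UNIV. complex_of_real (y $ b) * C $ b $ k)"
      for C :: "complex^'n^'n"
    proof -
      have "(\<Sum>a\<in>UNIV. complex_of_real (v $ a) * (mat_complex ?P ** C) $ a $ k)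
          = (\<Sum>a\<in>UNIV. \<Sum>b\<in>UNIV. complex_of_real (v $ a) * (complex_of_real (?P $ a $ b) * C $ b $ k))"
        by (simp add: matrix_mult_component sum_distrib_left)
      also have "\<dots> = (\<Sum>b\<in>UNIV. \<Sum>a\<in>UNIV. complex_of_real (v $ a)
          * (complex_of_real (?P $ a $ b) * C $ b $ k))"
        by (rule sum.swap)
      also have "\<dots> = (\<Sum>b\<in>UNIV. complex_of_real (y $ b) * C $ b $ k)"
        by (simp add: y_def matrix_vector_mult_def transpose_def sum_distrib_left sum_distrib_right
            ac_simps)
      finally show ?thesis .
    qed
    show ?thesis
    proof (cases "x > 0")
      case True
      then have "S x = mat_complex ?P ** A"
        by (simp add: spectral_factor_def max_def vec_eq_iff matrix_mult_component)
      then show ?thesis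
        using u0[of k] y[of A] by (simp only: u_def)
    next
      case False
      then have "S x = mat_complex ?P ** mat_cnj A"
        using \<open>x \<noteq> 0\<close> by (simp add: spectral_factor_def max_def vec_eq_iff matrix_mult_component)
      then have "(\<Sum>b\<in>UNIV. complex_of_real (y $ b) * cnj (A $ b $ k)) = 0"
        using u0[of k] y[of "mat_cnj A"] by (simp only: u_def mat_cnj_component)
      then have "cnj (\<Sum>b\<in>UNIV. complex_of_real (y $ b) * cnj (A $ b $ k)) = 0"
        by (simp only: complex_cnj_zero)
      then show ?thesis
        by simp
    qed
  qed
  \<comment> \<open>As y is real, A^* y is the conjugate of the transpose of y^T A, hence 0. So A
    A^* annihilates y, and so does its real part.\<close>
  have "(map_matrix Re (A ** hermitian_transpose A) *v y) $ a = 0" for a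
  proof -
    have "(map_matrix Re (A ** hermitian_transpose A) *v y) $ a
        = Re (\<Sum>b\<in>UNIV. \<Sum>k\<in>UNIV. A $ a $ k * cnj (complex_of_real (y $ b) * A $ b $ k))"
      by (simp add: matrix_vector_mult_def map_matrix_def matrix_mult_component sum_distrib_right
          sum_distrib_left algebra_simps)
    also have "(\<Sum>b\<in>UNIV. \<Sum>k\<in>UNIV. A $ a $ k * cnj (complex_of_real (y $ b) * A $ b $ k))
        = (\<Sum>k\<in>UNIV. \<Sum>b\<in>UNIV. A $ a $ k * cnj (complex_of_real (y $ b) * A $ b $ k))"
      by (rule sum.swap)
    also have "\<dots> = (\<Sum>k\<in>UNIV. A $ a $ k * cnj (\<Sum>b\<in>UNIV. complex_of_real (y $ b) * A $ b $ k))"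
      by (simp only: cnj_sum sum_distrib_left)
    also have "\<dots> = 0"
      unfolding yA by simp
    finally show ?thesis by simp
  qed
  then have Ry: "map_matrix Re (A ** hermitian_transpose A) *v y = 0"
    by (simp add: vec_eq_iff)
  have "inj ((*v) (map_matrix Re (A ** hermitian_transpose A)))"
    using ofbm by (simp add: ofbm_def full_rank_injective[symmetric])
  from injD[OF this, of y 0] Ry have "y = 0"
    by simp
  \<comment> \<open>A power of a positive number is an invertible matrix, so y = 0 gives v =
    0.\<close>
  have "?P ** mat_powr (inverse \<bar>x\<bar>) (- ofbm_exponent H) = mat 1"
    using \<open>x \<noteq> 0\<close> by (intro mat_powr_inverse) simp
  then have "transpose (mat_powr (inverse \<bar>x\<bar>) (- ofbm_exponent H)) ** transpose ?P = mat 1"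
    by (simp flip: matrix_transpose_mul add: transpose_mat)
  then have "v = transpose (mat_powr (inverse \<bar>x\<bar>) (- ofbm_exponent H)) *v y"
    unfolding y_def by (simp only: matrix_vector_mul_assoc matrix_vector_mul_lid)
  with v(1) \<open>y = 0\<close> show False
    by simp
qed

end


theorem proposition3p1:
  fixes M :: "'a measure" and B :: "real \<Rightarrow> 'a \<Rightarrow> real^'n"
    and N :: "'b measure" and Bt :: "real set \<Rightarrow> 'b \<Rightarrow> complex^'n"
    and H :: "real^'n^'n" and A :: "complex^'n^'n"
    and \<psi> :: "real \<Rightarrow> real" and N\<^sub>\<psi> :: nat and \<alpha> :: real
    and D :: "nat \<Rightarrow> int \<Rightarrow> 'a \<Rightarrow> real^'n"
    and EW :: "nat \<Rightarrow> nat \<Rightarrow> real^'n^'n"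
  assumes dim: "CARD('n) \<ge> 2"
    and ofbm: "ofbm M B N Bt H A"
    and wavelet: "wavelet \<psi> N\<^sub>\<psi> \<alpha>"
    and D: "D = wavelet_coeff M \<psi> B"
    and EW: "EW = (\<lambda>\<nu> j. \<integral>\<omega>. wavelet_variance D \<nu> j \<omega> \<partial>M)"
  shows "(\<forall>j k. has_ms_integral M (wavelet_integrand \<psi> B j k) (D j k) \<and>
           (\<forall>Y. has_ms_integral M (wavelet_integrand \<psi> B j k) Y \<longrightarrow> (AE \<omega> in M. Y \<omega> = D j k \<omega>)) \<and>
           (\<integral>\<omega>. D j k \<omega> \<partial>M) = 0) \<and>
    (\<forall>j h. fdd_eq M (\<lambda>k. D j (k + h)) M (\<lambda>k. D j k)) \<and>
    (\<forall>j. fdd_eq M (\<lambda>k. D j k) M (\<lambda>k \<omega>. mat_powr 2 (real j *\<^sub>R H) *v D 0 k \<omega>)) \<and>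
    ((\<forall>p j k. j \<le> p \<longrightarrow> EW (2 ^ p) j = (\<integral>\<omega>. outer (D j k \<omega>) (D j k \<omega>) \<partial>M)) \<and>
         (\<exists>C>0. \<forall>p j. j \<le> p \<longrightarrow>
           integrable lborel (wavelet_spectral_density H A \<psi> j) \<and>
           mat_complex (EW (2 ^ p) j) = C *\<^sub>R (\<integral>x. wavelet_spectral_density H A \<psi> j x \<partial>lborel))) \<and>
    (\<forall>p j. j \<le> p \<longrightarrow>
         EW (2 ^ p) j =
           mat_powr 2 (real j *\<^sub>R H) ** EW (2 ^ p) 0 ** mat_powr 2 (real j *\<^sub>R transpose H) \<and>
         integrable (lborel \<Otimes>\<^sub>M lborel)
           (\<lambda>(t, t'). (\<psi> t * \<psi> t') *\<^sub>R (\<integral>\<omega>. outer (B t \<omega>) (B t' \<omega>) \<partial>M)) \<and>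
         EW (2 ^ p) j =
           mat_powr 2 (real j *\<^sub>R H) **
             (\<integral>t'. (\<integral>t. (\<psi> t * \<psi> t') *\<^sub>R (\<integral>\<omega>. outer (B t \<omega>) (B t' \<omega>) \<partial>M) \<partial>lborel) \<partial>lborel) **
           mat_powr 2 (real j *\<^sub>R transpose H)) \<and>
    (map_matrix Im (A ** hermitian_transpose A) = 0 \<longrightarrow>
         (\<forall>p j. j \<le> p \<longrightarrow>
         (let \<Sigma> = (\<integral>\<omega>. outer (B 1 \<omega>) (B 1 \<omega>) \<partial>M);
              F = (\<lambda>t t'. (\<psi> t * \<psi> t') *\<^sub>R
                    (mat_powr \<bar>t - t'\<bar> H ** \<Sigma> ** mat_powr \<bar>t - t'\<bar> (transpose H)))
          in integrable (lborel \<Otimes>\<^sub>M lborel) (\<lambda>(t, t'). F t t') \<and>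
             EW (2 ^ p) j = - (1 / 2) *\<^sub>R
               (mat_powr 2 (real j *\<^sub>R H) ** (\<integral>t'. (\<integral>t. F t t' \<partial>lborel) \<partial>lborel) **
                mat_powr 2 (real j *\<^sub>R transpose H))))) \<and>
    (\<forall>p j. j \<le> p \<longrightarrow>
         distr M borel (wavelet_variance D (2 ^ p) j) =
         distr M borel (\<lambda>\<omega>. mat_powr 2 (real j *\<^sub>R H) **
           wavelet_average D (2 ^ p div 2 ^ j) 0 \<omega> ** mat_powr 2 (real j *\<^sub>R transpose H))) \<and>
    (\<forall>p j. j \<le> p \<longrightarrow> det (EW (2 ^ p) j) \<noteq> 0)"
proof -
  interpret ofbm_wavelet M B N Bt H A \<psi> N\<^sub>\<psi> \<alpha>
    using ofbm wavelet by unfold_locales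
  \<comment> \<open>The shift k is left free: \<open>P4\<close> uses this for independence of k, the
    other parts take k = 0.\<close>
  have EW_wcov: "EW (2 ^ p) j = wcov j k k" if "j \<le> p" for p j k
    unfolding EW D by (rule wavelet_variance_mean[OF that])
  have T: "mat_powr 2 (real j *\<^sub>R transpose H) = transpose (mat_powr (2 ^ j) H)" for j
    unfolding mat_powr_power mat_powr_transpose ..
  have scale: "EW (2 ^ p) j = mat_powr 2 (real j *\<^sub>R H) ** wcov 0 0 0 ** mat_powr 2
      (real j *\<^sub>R transpose H)"
    if "j \<le> p" for p j
    unfolding EW_wcov[OF that, of 0] T unfolding mat_powr_power by (rule wcov_scale)
  have P1: "\<forall>j k. has_ms_integral M (wavelet_integrand \<psi> B j k) (D j k) \<and>
      (\<forall>Y. has_ms_integral M (wavelet_integrand \<psi> B j k) Y \<longrightarrow> (AE \<omega> in M. Y \<omega> = D j k \<omega>)) \<and>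
      (\<integral>\<omega>. D j k \<omega> \<partial>M) = 0"
    unfolding D using has_ms_integral_wavelet_coeff wavelet_coeff_unique wavelet_coeff_mean by blast
  have P2: "\<forall>j h. fdd_eq M (\<lambda>k. D j (k + h)) M (\<lambda>k. D j k)"
    unfolding D using fdd_eq_shift by blast
  have P3: "\<forall>j. fdd_eq M (\<lambda>k. D j k) M (\<lambda>k \<omega>. mat_powr 2 (real j *\<^sub>R H) *v D 0 k \<omega>)"
    unfolding D mat_powr_power using fdd_eq_scale by blast
  have P4: "(\<forall>p j k. j \<le> p \<longrightarrow> EW (2 ^ p) j = (\<integral>\<omega>. outer (D j k \<omega>) (D j k \<omega>) \<partial>M)) \<and>
      (\<exists>C>0. \<forall>p j. j \<le> p \<longrightarrow> integrable lborel (wavelet_spectral_density H A \<psi> j) \<and>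
        mat_complex (EW (2 ^ p) j) = C *\<^sub>R (\<integral>x. wavelet_spectral_density H A \<psi> j x \<partial>lborel))"
  \<comment> \<open>The constant is 1 because \<open>fourier\<close> carries no normalising factor
    and the covariance of the random measure is Lebesgue measure times the identity.\<close>
  proof (intro conjI allI impI exI[of _ 1])
    fix p j :: nat and k assume le: "j \<le> p"
    show "EW (2 ^ p) j = (\<integral>\<omega>. outer (D j k \<omega>) (D j k \<omega>) \<partial>M)"
      unfolding EW_wcov[OF le, of k] wcov_def D ..
    show "mat_complex (EW (2 ^ p) j) = 1 *\<^sub>R (\<integral>x. wavelet_spectral_density H A \<psi> j x \<partial>lborel)"
      unfolding EW_wcov[OF le, of 0] wcov_spectral(2) by simp
  qed (use wcov_spectral(1) in simp_all)
  have wcov0: "wcov 0 0 0 = (\<integral>t'. (\<integral>t. (\<psi> t * \<psi> t') *\<^sub>R (\<integral>\<omega>. outer (B t \<omega>) (B t' \<omega>) \<partial>M) \<partial>lborel) \<partial>lborel)"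
    unfolding wcov_eq_double_integral double_integral_def \<Gamma>_def by simp
  have P5: "\<forall>p j. j \<le> p \<longrightarrow>
      EW (2 ^ p) j = mat_powr 2 (real j *\<^sub>R H) ** EW (2 ^ p) 0 ** mat_powr 2 (real j *\<^sub>R transpose H) \<and>
      integrable (lborel \<Otimes>\<^sub>M lborel) (\<lambda>(t, t'). (\<psi> t * \<psi> t') *\<^sub>R (\<integral>\<omega>. outer (B t \<omega>) (B t' \<omega>) \<partial>M)) \<and>
      EW (2 ^ p) j = mat_powr 2 (real j *\<^sub>R H) **
        (\<integral>t'. (\<integral>t. (\<psi> t * \<psi> t') *\<^sub>R (\<integral>\<omega>. outer (B t \<omega>) (B t' \<omega>) \<partial>M) \<partial>lborel) \<partial>lborel) **
        mat_powr 2 (real j *\<^sub>R transpose H)"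
    using scale double_integral_integrable[OF \<Gamma>_continuous] EW_wcov[of 0 _ 0]
    unfolding wcov0[symmetric] by (simp add: \<Gamma>_def)
  have P5': "map_matrix Im (A ** hermitian_transpose A) = 0 \<longrightarrow>
      (\<forall>p j. j \<le> p \<longrightarrow>
        (let \<Sigma> = (\<integral>\<omega>. outer (B 1 \<omega>) (B 1 \<omega>) \<partial>M);
             F = (\<lambda>t t'. (\<psi> t * \<psi> t') *\<^sub>R
                   (mat_powr \<bar>t - t'\<bar> H ** \<Sigma> ** mat_powr \<bar>t - t'\<bar> (transpose H)))
         in integrable (lborel \<Otimes>\<^sub>M lborel) (\<lambda>(t, t'). F t t') \<and>
            EW (2 ^ p) j = - (1 / 2) *\<^sub>R
              (mat_powr 2 (real j *\<^sub>R H) ** (\<integral>t'. (\<integral>t. F t t' \<partial>lborel) \<partial>lborel) **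
               mat_powr 2 (real j *\<^sub>R transpose H))))"
    unfolding Let_def
  proof (intro impI allI conjI)
    assume real: "map_matrix Im (A ** hermitian_transpose A) = 0"
    note * = wcov_real_case[OF real, unfolded double_integral_def \<Gamma>_def]
    fix p j :: nat assume le: "j \<le> p"
    show "integrable (lborel \<Otimes>\<^sub>M lborel) (\<lambda>(t, t'). (\<psi> t * \<psi> t') *\<^sub>R
        (mat_powr \<bar>t - t'\<bar> H ** (\<integral>\<omega>. outer (B 1 \<omega>) (B 1 \<omega>) \<partial>M) ** mat_powr \<bar>t - t'\<bar> (transpose H)))"
      by (rule *(1))
    show "EW (2 ^ p) j = - (1 / 2) *\<^sub>R (mat_powr 2 (real j *\<^sub>R H) **
        (\<integral>t'. (\<integral>t. (\<psi> t * \<psi> t') *\<^sub>R (mat_powr \<bar>t - t'\<bar> H ** (\<integral>\<omega>. outer (B 1 \<omega>) (B 1 \<omega>) \<partial>M) **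
          mat_powr \<bar>t - t'\<bar> (transpose H)) \<partial>lborel) \<partial>lborel) ** mat_powr 2 (real j *\<^sub>R transpose H))"
      unfolding scale[OF le] *(2) matrix_scaleR_left matrix_scaleR_right ..
  qed
  have P6: "\<forall>p j. j \<le> p \<longrightarrow> distr M borel (wavelet_variance D (2 ^ p) j) =
      distr M borel (\<lambda>\<omega>. mat_powr 2 (real j *\<^sub>R H) **
        wavelet_average D (2 ^ p div 2 ^ j) 0 \<omega> ** mat_powr 2 (real j *\<^sub>R transpose H))"
    unfolding D T unfolding mat_powr_power using wavelet_variance_distr by blast
  have P7: "\<forall>p j. j \<le> p \<longrightarrow> det (EW (2 ^ p) j) \<noteq> 0"
    using EW_wcov[of _ _ 0] det_wcov by simp
  show ?thesis
    by (intro conjI P1 P2 P3 P4[THEN conjunct1] P4[THEN conjunct2] P5 P5' P6 P7)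
qed

end
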